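(* Let $k,p\geq1$ be integers with $p+k\leq n$, let $m=n-p+1$, and let $\widehat R_{1,m}$ denote the leave-one-out estimator, computed from $\mathcal{D}_m$, of the $k$NN classification rule $\mathcal{A}_k$. Then: (i) for $q=2$, $$\mathbb{E}\big[(\widehat R_{1,m}-\mathbb{E}[\widehat R_{1,m}])^2\big]\leq C_1\frac{k^{3/2}}{m};$$ (ii) for every $q>2$, $$\mathbb{E}\big[|\widehat R_{1,m}-\mathbb{E}[\widehat R_{1,m}]|^q\big]\leq(C_2\,k)^q\Big(\frac qm\Big)^{q/2},$$ with $C_1=2+16\gamma_d$ and $C_2=4\gamma_d\sqrt{2\kappa}$.
   Context: Let $\mathcal{X}\subset\mathbb{R}^d$ and let $Z_i=(X_i,Y_i)\in\mathcal{X}\times\{0,1\}$, $1\le i\le n$, be i.i.d. copies of a pair $(X,Y)$ with arbitrary distribution; $\mathcal{D}_m=\{Z_1,\ldots,Z_m\}$. $k$NN rule: for a sample $\mathcal{D}$ of at least $k$ labelled points and $x\in\mathbb{R}^d$, let $Y_{(1)}(x),\ldots,Y_{(k)}(x)$ be the labels of the $k$ points of the sample closest to $x$ in Euclidean norm (distance ties are broken by smallest index). Then $\mathcal{A}_k^{\mathcal{D}}(x)=1$ if $\frac1k\sum_{i=1}^kY_{(i)}(x)>\frac12$, $\mathcal{A}_k^{\mathcal{D}}(x)=0$ if $\frac1k\sum_{i=1}^kY_{(i)}(x)<\frac12$, and $\mathcal{A}_k^{\mathcal{D}}(x)$ is a Bernoulli$(1/2)$ variable otherwise (independent of the data and of the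 other such variables). Leave-one-out estimator: $\widehat R_{1,m}=\frac1m\sum_{i=1}^m\mathbf{1}_{\{\mathcal{A}_k^{\mathcal{D}_m\setminus\{Z_i\}}(X_i)\neq Y_i\}}$. $\gamma_d$ is the constant of Stone's lemma, depending only on $d$ (and growing exponentially with $d$): given finitely many points in $\mathbb{R}^d$ and $k\ge1$, any of these points belongs to the $k$ nearest neighbors of at most $k\gamma_d$ of the other points. It is a standing convention that this property holds almost surely, under the tie-breaking in use, for all finite families of points drawn from the $X_i$'s and independent copies of them. $\kappa\leq1.271$ is a universal constant such that for every $q\geq2$, all independent $U_1,\ldots,U_N$ with independent copies $U_1',\ldots,U_N'$, and every measurable real function $f$, setting $\zeta=f(U_1,\ldots,U_N)$ and $\zeta_i'=f(U_1,\ldots,U_i',\ldots,U_N)$, one has $\|\zeta-\mathbb{E}\zeta\|_q\leq\sqrt{2\kappa q}\,\sqrt{\|\sum_{i=1}^N(\zeta-\zeta_i')^2\|_{q/2}}$, where $\|U\|_q=(\mathbb{E}|U|^q)^{1/q}$. *)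

theory Defs
  imports "HOL-Probability.Probability"
begin

text \<open>
  A sample is a family indexed by a finite set \<open>I\<close> of naturals, so that removing an observation
  means removing its index. Distance ties are broken by smallest index.
\<close>

definition nearer :: "(nat \<Rightarrow> 'a::metric_space) \<Rightarrow> 'a \<Rightarrow> nat \<Rightarrow> nat \<Rightarrow> bool" where
  "nearer x y j i \<longleftrightarrow> dist (x j) y < dist (x i) y \<or> (dist (x j) y = dist (x i) y \<and> j < i)"

text \<open>
  Since \<open>nearer x y\<close> is a strict linear order on indices, the \<open>k\<close> nearest neighbours of \<open>y\<close> are
  the indices preceded by fewer than \<open>k\<close> others; all of \<open>I\<close> is returned if \<open>card I \<le> k\<close>.
\<close>

definition knn :: "nat \<Rightarrow> nat set \<Rightarrow> (nat \<Rightarrow> 'a::metric_space) \<Rightarrow> 'a \<Rightarrow> nat set" where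
  "knn k I x y = {i \<in> I. card {j \<in> I. nearer x y j i} < k}"

text \<open>The boolean \<open>b\<close> is the outcome of the fair coin used when the vote is a draw.\<close>

definition knn_rule ::
  "nat \<Rightarrow> nat set \<Rightarrow> (nat \<Rightarrow> (real^'d) \<times> real) \<Rightarrow> bool \<Rightarrow> real^'d \<Rightarrow> real" where
  "knn_rule k I z b y =
     (let v = (\<Sum>i \<in> knn k I (\<lambda>i. fst (z i)) y. snd (z i)) / real k
      in if v > 1/2 then 1 else if v < 1/2 then 0 else of_bool b)"

text \<open>Each of the \<open>m\<close> predictions has a coin of its own, \<open>b i\<close>.\<close>

definition loo_risk ::
  "nat \<Rightarrow> nat \<Rightarrow> (nat \<Rightarrow> (real^'d) \<times> real) \<Rightarrow> (nat \<Rightarrow> bool) \<Rightarrow> real" where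
  "loo_risk k m z b =
     1 / real m * (\<Sum>i=1..m. of_bool (knn_rule k ({1..m} - {i}) z (b i) (fst (z i)) \<noteq> snd (z i)))"

text \<open>
  The conclusion of Stone's lemma for the points \<open>x i\<close>, \<open>i \<in> I\<close>, under index tie-breaking. The
  neighbours of \<open>x j\<close> are sought among the points other than \<open>x j\<close> itself.
\<close>

definition stone_bound :: "real \<Rightarrow> nat set \<Rightarrow> (nat \<Rightarrow> 'a::metric_space) \<Rightarrow> bool" where
  "stone_bound \<gamma> I x \<longleftrightarrow>
     (\<forall>k\<ge>1. \<forall>i\<in>I. real (card {j \<in> I - {i}. i \<in> knn k (I - {j}) x (x j)}) \<le> real k * \<gamma>)"

text \<open>
  A constant for Stone's lemma in dimension \<open>d\<close>. Configurations with distance ties have to be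
  excluded: with index tie-breaking, if all points coincide the first one is a nearest neighbour
  of every other one.
\<close>

definition stone_constant :: "'d::finite itself \<Rightarrow> real \<Rightarrow> bool" where
  "stone_constant _ \<gamma> \<longleftrightarrow>
     (\<forall>I (x :: nat \<Rightarrow> real^'d).
        finite I \<and> (\<forall>i\<in>I. inj_on (\<lambda>j. dist (x j) (x i)) (I - {i})) \<longrightarrow> stone_bound \<gamma> I x)"

definition lnorm :: "'a measure \<Rightarrow> real \<Rightarrow> ('a \<Rightarrow> real) \<Rightarrow> real" where
  "lnorm M q U = (\<integral>\<omega>. \<bar>U \<omega>\<bar> powr q \<partial>M) powr (1 / q)"

text \<open>
  The generalised Efron--Stein inequality with constant \<open>\<kappa>\<close>, for independent \<open>U\<^sub>1, \<dots>, U\<^sub>N\<close> with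
  laws \<open>\<mu> 1, \<dots>, \<mu> N\<close> on the type \<open>'u\<close>. The joint law of the family and of its independent
  copy is the product measure \<open>Q \<Otimes>\<^sub>M Q\<close>; its points are the pairs \<open>(u, u')\<close>. The norms take values
  in \<open>[0, \<infinity>]\<close>, and the inequality is void when the right-hand side is infinite; when
  it is finite, so is the left-hand side. This is what the two integrability clauses express.
\<close>

definition efron_stein_constant :: "'u itself \<Rightarrow> real \<Rightarrow> bool" where
  "efron_stein_constant _ \<kappa> \<longleftrightarrow>
     (\<forall>q\<ge>2. \<forall>N (\<mu> :: nat \<Rightarrow> 'u measure) (f :: (nat \<Rightarrow> 'u) \<Rightarrow> real).
        (\<forall>i\<in>{1..N}. prob_space (\<mu> i)) \<longrightarrow>
        (let Q = PiM {1..N} \<mu>;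
             D = (\<lambda>(u, u'). \<Sum>i=1..N. (f u - f (u(i := u' i)))\<^sup>2)
         in f \<in> borel_measurable Q \<longrightarrow> integrable Q f \<longrightarrow>
            integrable (Q \<Otimes>\<^sub>M Q) (\<lambda>w. \<bar>D w\<bar> powr (q / 2)) \<longrightarrow>
            integrable Q (\<lambda>u. \<bar>f u - (\<integral>v. f v \<partial>Q)\<bar> powr q) \<and>
            lnorm Q q (\<lambda>u. f u - (\<integral>v. f v \<partial>Q))
              \<le> sqrt (2 * \<kappa> * q) * sqrt (lnorm (Q \<Otimes>\<^sub>M Q) (q / 2) D)))"

end

theory Submission
  imports Defs
begin

text \<open>
  Replacing observation \<open>i\<close> changes its own term in the leave-one-out sum and those terms \<open>j\<close> for
  which it is, before or after the replacement, among the neighbours of \<open>x j\<close>; by Stone's lemma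
  there are at most \<open>1 + 2 k \<gamma>\<close> such terms in all. This bounds all increments, and (ii) is then the
  generalised Efron--Stein inequality.

  For \<open>q = 2\<close> the constant \<open>\<kappa>\<close> is too large, so the classical Efron--Stein inequality (constant
  \<open>1/2\<close>) is used instead. The gain from \<open>k\<^sup>2\<close> to \<open>k\<^bsup>3/2\<^esup>\<close> comes from the fact that a term
  can only change if the vote is within one of a draw. Given the \<open>k + 1\<close>-st nearest neighbour, the
  labels of the first \<open>k\<close> are i.i.d., so this has probability at most \<open>4 / sqrt k\<close>, and the
  expected number of changes caused by one replacement is at most \<open>1 + 8 sqrt k\<close>.

  Distance ties may have positive probability even under the hypotheses on \<open>\<gamma>\<close>, and then the
  labels of the neighbours selected by index are not conditionally i.i.d. However, the law of their
  sum does not change when ties are broken by independent uniform variables.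
\<close>

subsection \<open>Nearest neighbours\<close>

text \<open>The exponent 3/2 arises because the two factors of a squared increment are treated
  differently. Let \<open>s\<close> be the number of terms that one replacement may change. Stone's
  lemma bounds one factor \<open>s\<close> almost surely by 1 + 2 k \<gamma>; the other enters only
  through its expectation. Summed over the replaced observations, that expectation can be counted
  per prediction instead: a prediction has at most k neighbours, and they matter only if its vote is
  close, which makes k * 4 / sqrt k = 4 sqrt k for each of the two samples.

  Conditioning on the next neighbour gives i.i.d. labels only if being nearer is a relation between
  the values of two observations, since then the event factorises over the coordinates. Breaking
  ties by index is not of this kind. Hence orders are treated abstractly, and tie-breakers become
  part of the observations.

  The resulting bound (1 + 2 k \<gamma>) (1 + 8 sqrt k) / (2 m) is at most (9/2) (1 + 2 \<gamma>)
  k^(3/2) / m, which stays below the claimed one because \<gamma> is at least 1. For (ii), 1 + 2 k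
  \<gamma> is absorbed into 4 k \<gamma>.\<close>

definition strict_order_on :: "'i set \<Rightarrow> ('i \<Rightarrow> 'i \<Rightarrow> bool) \<Rightarrow> bool" where
  "strict_order_on I r \<longleftrightarrow> (\<forall>i\<in>I. \<not> r i i) \<and>
     (\<forall>i\<in>I. \<forall>j\<in>I. \<forall>l\<in>I. r i j \<longrightarrow> r j l \<longrightarrow> r i l) \<and>
     (\<forall>i\<in>I. \<forall>j\<in>I. i \<noteq> j \<longrightarrow> r i j \<or> r j i)"

text \<open>Selection by rank, detached from distances so that it serves both for ties broken by
  index and for ties broken by random variables.\<close>

definition first :: "nat \<Rightarrow> 'i set \<Rightarrow> ('i \<Rightarrow> 'i \<Rightarrow> bool) \<Rightarrow> 'i set" where
  "first k I r = {i \<in> I. card {j \<in> I. r j i} < k}"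

lemma knn_first: "knn k I x y = first k I (nearer x y)"
  by (simp add: knn_def first_def)

lemma strict_order_nearer: "strict_order_on I (nearer x y)"
  unfolding strict_order_on_def
proof (intro conjI ballI impI)
  show "\<not> nearer x y i i" for i by (simp add: nearer_def)
  show "nearer x y i l" if "nearer x y i j" "nearer x y j l" for i j l
    using that by (auto simp: nearer_def)
  show "nearer x y i j \<or> nearer x y j i" if "i \<noteq> j" for i j
    using that by (cases "dist (x i) y" "dist (x j) y" rule: linorder_cases) (auto simp: nearer_def)
qed

lemma
  assumes "strict_order_on I r"
  shows strict_order_on_irrefl: "i \<in> I \<Longrightarrow> \<not> r i i"
    and strict_order_on_trans: "i \<in> I \<Longrightarrow> j \<in> I \<Longrightarrow> l \<in> I \<Longrightarrow> r i j \<Longrightarrow> r j l \<Longrightarrow> r i l"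
    and strict_order_on_total: "i \<in> I \<Longrightarrow> j \<in> I \<Longrightarrow> i \<noteq> j \<Longrightarrow> r i j \<or> r j i"
proof -
  note * = assms[unfolded strict_order_on_def]
  show "i \<in> I \<Longrightarrow> \<not> r i i" by (rule *[THEN conjunct1, rule_format])
  show "i \<in> I \<Longrightarrow> j \<in> I \<Longrightarrow> l \<in> I \<Longrightarrow> r i j \<Longrightarrow> r j l \<Longrightarrow> r i l"
    by (rule *[THEN conjunct2, THEN conjunct1, rule_format])
  show "i \<in> I \<Longrightarrow> j \<in> I \<Longrightarrow> i \<noteq> j \<Longrightarrow> r i j \<or> r j i"
    by (rule *[THEN conjunct2, THEN conjunct2, rule_format])
qed

lemma strict_order_on_subset:
  assumes r: "strict_order_on I r" and J: "J \<subseteq> I"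
  shows "strict_order_on J r"
  unfolding strict_order_on_def
proof (intro conjI ballI impI)
  show "\<not> r i i" if "i \<in> J" for i
    using strict_order_on_irrefl[OF r] that J by auto
  show "r i l" if "i \<in> J" "j \<in> J" "l \<in> J" "r i j" "r j l" for i j l
    by (rule strict_order_on_trans[OF r, of i j]) (use that J in auto)
  show "r i j \<or> r j i" if "i \<in> J" "j \<in> J" "i \<noteq> j" for i j
    by (rule strict_order_on_total[OF r]) (use that J in auto)
qed

text \<open>Along \<open>r\<close> the set of predecessors grows by transitivity, and strictly,
  since the smaller element itself enters it. Totality gives the converse.\<close>

lemma rank_less_iff:
  assumes I: "finite I" and r: "strict_order_on I r" and i: "i \<in> I" "l \<in> I"
  shows "card {j \<in> I. r j i} < card {j \<in> I. r j l} \<longleftrightarrow> r i l"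
proof -
  have mono: "card {j \<in> I. r j i} < card {j \<in> I. r j l}" if "i \<in> I" "l \<in> I" "r i l" for i l
  proof (rule psubset_card_mono)
    have "{j \<in> I. r j i} \<subseteq> {j \<in> I. r j l}"
      using strict_order_on_trans[OF r _ that(1,2) _ that(3)] by auto
    moreover have "i \<notin> {j \<in> I. r j i}" "i \<in> {j \<in> I. r j l}"
      using strict_order_on_irrefl[OF r] that by auto
    ultimately show "{j \<in> I. r j i} \<subset> {j \<in> I. r j l}" by auto
  qed (use I in auto)
  show ?thesis
  proof (cases "i = l")
    case True
    then show ?thesis using strict_order_on_irrefl[OF r] i by simp
  next
    case False
    then show ?thesis using strict_order_on_total[OF r i] mono[of i l] mono[of l i] i by auto
  qed
qed

text \<open>Ranks are injective because they reflect the order, and they stay below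
  \<open>card I\<close> because no element precedes itself; counting then gives
  surjectivity.\<close>

lemma bij_betw_rank:
  assumes "finite I" and r: "strict_order_on I r"
  shows "bij_betw (\<lambda>i. card {j \<in> I. r j i}) I {..<card I}"
proof -
  let ?\<rho> = "\<lambda>i. card {j \<in> I. r j i}"
  have mono: "?\<rho> i < ?\<rho> l \<longleftrightarrow> r i l" if "i \<in> I" "l \<in> I" for i l
    using that by (rule rank_less_iff[OF assms])
  have inj: "inj_on ?\<rho> I"
  proof (rule inj_onI)
    fix i l assume *: "i \<in> I" "l \<in> I" "?\<rho> i = ?\<rho> l"
    show "i = l"
    proof (rule ccontr)
      assume "i \<noteq> l"
      then have "r i l \<or> r l i" using * by (intro strict_order_on_total[OF r])
      then show False using mono[of i l] mono[of l i] * by auto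
    qed
  qed
  have "?\<rho> ` I \<subseteq> {..<card I}"
  proof clarsimp
    fix i assume "i \<in> I"
    then have "{j \<in> I. r j i} \<subset> I" using strict_order_on_irrefl[OF r] by auto
    then show "?\<rho> i < card I" using assms(1) by (rule psubset_card_mono[rotated])
  qed
  moreover have "card (?\<rho> ` I) = card {..<card I}" using inj by (simp add: card_image)
  ultimately have "?\<rho> ` I = {..<card I}" by (simp add: card_subset_eq)
  with inj show ?thesis by (simp add: bij_betw_def)
qed

lemma card_first:
  assumes "finite I" "strict_order_on I r"
  shows "card (first k I r) = min k (card I)"
proof -
  let ?\<rho> = "\<lambda>i. card {j \<in> I. r j i}"
  have b: "bij_betw ?\<rho> I {..<card I}" using assms by (rule bij_betw_rank)
  have "?\<rho> ` first k I r = {..<min k (card I)}"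
  proof (intro equalityI subsetI)
    fix s assume "s \<in> ?\<rho> ` first k I r"
    then show "s \<in> {..<min k (card I)}" using b by (auto simp: first_def bij_betw_def)
  next
    fix s assume s: "s \<in> {..<min k (card I)}"
    then obtain i where "i \<in> I" "s = ?\<rho> i" using b by (auto simp: bij_betw_def)
    then show "s \<in> ?\<rho> ` first k I r" using s by (intro image_eqI) (auto simp: first_def)
  qed
  moreover have "inj_on ?\<rho> (first k I r)"
    using b[THEN bij_betw_imp_inj_on] by (rule inj_on_subset) (auto simp: first_def)
  ultimately show ?thesis using card_image[of ?\<rho> "first k I r"] by simp
qed

text \<open>Elements of equal rank are matched. Later this turns the order of the indices into the
  order of the random tie-breakers.\<close>

lemma strict_order_on_isomorphic:
  assumes I: "finite I" and r: "strict_order_on I r" and r': "strict_order_on I r'"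
  obtains \<sigma> where "bij_betw \<sigma> I I" "\<And>i j. i \<in> I \<Longrightarrow> j \<in> I \<Longrightarrow> r' i j \<longleftrightarrow> r (\<sigma> i) (\<sigma> j)"
proof -
  let ?\<rho> = "\<lambda>i. card {j \<in> I. r j i}" and ?\<rho>' = "\<lambda>i. card {j \<in> I. r' j i}"
  define \<sigma> where "\<sigma> = inv_into I ?\<rho> \<circ> ?\<rho>'"
  have b: "bij_betw ?\<rho> I {..<card I}" "bij_betw ?\<rho>' I {..<card I}"
    using bij_betw_rank I r r' by blast+
  then have \<sigma>: "bij_betw \<sigma> I I"
    unfolding \<sigma>_def by (intro bij_betw_trans[of ?\<rho>' I "{..<card I}"] bij_betw_inv_into)
  have \<rho>\<sigma>: "?\<rho> (\<sigma> i) = ?\<rho>' i" if "i \<in> I" for i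
  proof -
    have "?\<rho>' i \<in> ?\<rho> ` I" using b that by (auto simp: bij_betw_def)
    then show ?thesis unfolding \<sigma>_def comp_def by (rule f_inv_into_f)
  qed
  have "r' i j \<longleftrightarrow> r (\<sigma> i) (\<sigma> j)" if "i \<in> I" "j \<in> I" for i j
  proof -
    have "\<sigma> i \<in> I" "\<sigma> j \<in> I" using \<sigma> that by (auto simp: bij_betw_def)
    then show ?thesis
      using rank_less_iff[OF I r' that] rank_less_iff[OF I r, of "\<sigma> i" "\<sigma> j"] \<rho>\<sigma> that by simp
  qed
  with \<sigma> show thesis by (rule that)
qed

text \<open>With \<open>l\<close> as the (k+1)-st nearest neighbour, this describes the selected set
  by comparisons with \<open>l\<close> alone.\<close>

lemma first_eq_below:
  assumes I: "finite I" and r: "strict_order_on I r" and l: "l \<in> I" and k: "card {j \<in> I. r j l} = k"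
  shows "first k I r = {j \<in> I. r j l}"
  using rank_less_iff[OF I r _ l] k by (auto simp: first_def)

lemma first_subset: "first k I r \<subseteq> I"
  by (auto simp: first_def)

lemma first_mono: "k \<le> l \<Longrightarrow> first k I r \<subseteq> first l I r"
  by (auto simp: first_def)

text \<open>Dropping \<open>i\<close> lowers every other rank by at most one. So
  \<open>first k I r - {i}\<close> lies between the first \<open>k - 1\<close> and the first
  \<open>k\<close> elements of the rest, and its cardinality decides with which of them it
  coincides.\<close>

lemma first_remove_cases:
  assumes I: "finite I" and r: "strict_order_on I r" and i: "i \<in> I" and k: "k \<ge> 1" "k \<le> card I"
  shows "first k I r - {i} = first (if i \<in> first k I r then k - 1 else k) (I - {i}) r"
proof -
  let ?F = "first k I r" and ?J = "I - {i}"
  have fin: "finite ?F" using I by (rule finite_subset[OF first_subset])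
  have cF: "card ?F = k" using I r k by (simp add: card_first)
  have rJ: "strict_order_on ?J r" using r by (rule strict_order_on_subset) auto
  have cJ: "card ?J = card I - 1" using I i by simp
  have split: "card {j \<in> I. r j e} = card {j \<in> ?J. r j e} + of_bool (r i e)" for e
  proof (cases "r i e")
    case True
    then have "{j \<in> I. r j e} = insert i {j \<in> ?J. r j e}" using i by auto
    then show ?thesis using True I by simp
  next
    case False
    then have "{j \<in> I. r j e} = {j \<in> ?J. r j e}" by auto
    then show ?thesis using False by simp
  qed
  have sub1: "first (k - 1) ?J r \<subseteq> ?F - {i}" using split by (auto simp: first_def split: if_splits)
  have sub2: "?F - {i} \<subseteq> first k ?J r" using split by (auto simp: first_def split: if_splits)
  show ?thesis
  proof (cases "i \<in> ?F")
    case True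
    have "card (first (k - 1) ?J r) = card (?F - {i})"
      using card_first[OF _ rJ] I True cF cJ k fin by simp
    then have "first (k - 1) ?J r = ?F - {i}" by (intro card_subset_eq) (use fin sub1 in auto)
    then show ?thesis using True by simp
  next
    case False
    have "card (first k ?J r) \<le> k" using card_first[OF _ rJ] I by simp
    moreover have "finite (first k ?J r)" using I by (intro finite_subset[OF first_subset]) simp
    moreover have "?F - {i} = ?F" using False by simp
    ultimately show ?thesis using sub2 False cF card_seteq[of "first k ?J r" ?F] by simp
  qed
qed

text \<open>The point is that \<open>s\<close> does not involve what is stored at \<open>i\<close>:
  the votes before and after a replacement of \<open>i\<close> lie in one common interval of length
  1.\<close>

lemma sum_first_remove_bounds:
  fixes y :: "'i \<Rightarrow> real"
  assumes I: "finite I" and r: "strict_order_on I r" and i: "i \<in> I" and k: "k \<ge> 1" "k \<le> card I"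
    and y: "\<And>j. j \<in> I \<Longrightarrow> y j \<in> {0, 1}"
  defines "s \<equiv> sum y (first (k - 1) (I - {i}) r)"
  shows "sum y (first k I r) \<in> {s .. s + 1}"
proof -
  let ?F = "first k I r" and ?J = "I - {i}"
  have fin: "finite ?F" using I by (rule finite_subset[OF first_subset])
  have finJ: "finite (first l ?J r)" for l using I by (intro finite_subset[OF first_subset]) simp
  have rJ: "strict_order_on ?J r" using r by (rule strict_order_on_subset) auto
  note rem = first_remove_cases[OF I r i k]
  show ?thesis
  proof (cases "i \<in> ?F")
    case True
    have "sum y ?F = y i + sum y (?F - {i})" by (rule sum.remove[OF fin True])
    also have "sum y (?F - {i}) = s" using rem True by (simp add: s_def)
    finally show ?thesis using y[OF i] by auto
  next
    case False
    \<comment> \<open>Here the vote counts the first \<open>k\<close> of the other elements, while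
      \<open>s\<close> counts the first \<open>k - 1\<close>; \<open>?E\<close> is the
      difference.\<close>
    let ?E = "first k ?J r - first (k - 1) ?J r"
    have sub: "first (k - 1) ?J r \<subseteq> first k ?J r" by (rule first_mono) simp
    have FE: "?F = first k ?J r" using rem False by simp
    have "card (first k ?J r) - card (first (k - 1) ?J r) \<le> 1"
      using card_first[OF _ rJ] I by simp
    then have cE: "card ?E \<le> 1" using sub finJ by (simp add: card_Diff_subset)
    have yJ: "0 \<le> y e \<and> y e \<le> 1" if "e \<in> ?E" for e using that y[of e] by (auto simp: first_def)
    have "sum y ?F = s + sum y ?E" unfolding FE s_def using sum.subset_diff[OF sub finJ, of y] by simp
    moreover have "0 \<le> sum y ?E" by (rule sum_nonneg) (use yJ in blast)
    moreover have "sum y ?E \<le> real (card ?E) * 1" by (rule sum_bounded_above) (use yJ in blast)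
    ultimately show ?thesis using cE by simp
  qed
qed

lemma first_cong:
  assumes "\<And>i j. i \<in> I \<Longrightarrow> j \<in> I \<Longrightarrow> r j i = r' j i"
  shows "first k I r = first k I r'"
proof -
  have "{j \<in> I. r j i} = {j \<in> I. r' j i}" if "i \<in> I" for i using assms that by auto
  then show ?thesis by (auto simp: first_def)
qed

section \<open>Effect of replacing one observation on a vote\<close>

definition close_vote :: "nat \<Rightarrow> nat set \<Rightarrow> (nat \<Rightarrow> 'a::metric_space \<times> real) \<Rightarrow> 'a \<Rightarrow> bool" where
  "close_vote k I z y \<longleftrightarrow> \<bar>(\<Sum>i \<in> knn k I (\<lambda>i. fst (z i)) y. snd (z i)) - real k / 2\<bar> \<le> 1"

text \<open>Both votes lie in \<open>{s .. s + 1}\<close>, so a changed decision forces each of them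
  to within 1 of a draw; this is the origin of the width in \<open>close_vote\<close>. The coin is
  the same on both sides and cannot cause the change by itself.\<close>

lemma knn_rule_replace:
  fixes z z' :: "nat \<Rightarrow> (real^'d) \<times> real"
  assumes I: "finite I" and k: "k \<ge> 1" "k \<le> card I" and i: "i \<in> I"
    and zz: "\<And>j. j \<in> I \<Longrightarrow> j \<noteq> i \<Longrightarrow> z' j = z j"
    and lab: "\<And>j. j \<in> I \<Longrightarrow> snd (z j) \<in> {0, 1}" "\<And>j. j \<in> I \<Longrightarrow> snd (z' j) \<in> {0, 1}"
    and ne: "knn_rule k I z b y \<noteq> knn_rule k I z' b y"
  shows "i \<in> knn k I (\<lambda>i. fst (z i)) y \<and> close_vote k I z y \<or>
         i \<in> knn k I (\<lambda>i. fst (z' i)) y \<and> close_vote k I z' y"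
proof -
  let ?r = "nearer (\<lambda>i. fst (z i)) y" and ?r' = "nearer (\<lambda>i. fst (z' i)) y"
  let ?S = "\<Sum>i \<in> knn k I (\<lambda>i. fst (z i)) y. snd (z i)"
  let ?S' = "\<Sum>i \<in> knn k I (\<lambda>i. fst (z' i)) y. snd (z' i)"
  define s where "s = (\<Sum>j \<in> first (k - 1) (I - {i}) ?r. snd (z j))"
  have firstJ: "first l (I - {i}) ?r' = first l (I - {i}) ?r" for l
    by (rule first_cong) (use zz in \<open>auto simp: nearer_def\<close>)
  have s': "s = (\<Sum>j \<in> first (k - 1) (I - {i}) ?r'. snd (z' j))"
    unfolding s_def firstJ by (rule sum.cong[OF refl]) (use zz in \<open>auto simp: first_def\<close>)
  have S: "?S \<in> {s .. s + 1}"
    unfolding knn_first s_def using lab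
    by (intro sum_first_remove_bounds I strict_order_nearer i k) auto
  have S': "?S' \<in> {s .. s + 1}"
    unfolding knn_first s' using lab
    by (intro sum_first_remove_bounds I strict_order_nearer i k) auto
  have kpos: "real k > 0" using k by simp
  have gt: "v / real k > 1/2 \<longleftrightarrow> v > real k / 2" for v using kpos by (simp add: field_simps)
  have lt: "v / real k < 1/2 \<longleftrightarrow> v < real k / 2" for v using kpos by (simp add: field_simps)
  have "knn_rule k I z b y = (if ?S > real k / 2 then 1 else if ?S < real k / 2 then 0 else of_bool b)"
    "knn_rule k I z' b y = (if ?S' > real k / 2 then 1 else if ?S' < real k / 2 then 0 else of_bool b)"
    by (simp_all only: knn_rule_def Let_def gt lt)
  \<comment> \<open>The votes are not strictly on the same side of \<open>k / 2\<close>, so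
    \<open>k / 2\<close> belongs to their common interval.\<close>
  with ne have "\<not> (?S > real k / 2 \<and> ?S' > real k / 2)" "\<not> (?S < real k / 2 \<and> ?S' < real k / 2)"
    by auto
  then have cl: "close_vote k I z y" "close_vote k I z' y"
    using S S' unfolding close_vote_def by auto
  \<comment> \<open>Were \<open>i\<close> selected in neither sample, both selections would be the
    first \<open>k\<close> of the other indices, with unchanged labels.\<close>
  have "i \<in> knn k I (\<lambda>i. fst (z i)) y \<or> i \<in> knn k I (\<lambda>i. fst (z' i)) y"
  proof (rule ccontr)
    assume "\<not> ?thesis"
    then have n: "i \<notin> first k I ?r" "i \<notin> first k I ?r'" by (auto simp: knn_first)
    have eq: "first k I ?r = first k I ?r'"
      using first_remove_cases[OF I strict_order_nearer i k, of "\<lambda>i. fst (z i)" y]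
        first_remove_cases[OF I strict_order_nearer i k, of "\<lambda>i. fst (z' i)" y] n
      by (simp add: firstJ)
    have "?S = ?S'" unfolding knn_first eq
      by (rule sum.cong[OF refl]) (use n zz eq in \<open>metis DiffE first_subset subsetD\<close>)
    then show False using ne by (simp add: knn_rule_def)
  qed
  with cl show ?thesis by blast
qed

subsection \<open>Binomial sums near the middle\<close>

text \<open>Consecutive central coefficients have ratio 2 (2j+1) / (j+1). The bound survives the
  step because sqrt ((2j+1) (2j+3)) \<le> 2j+2.\<close>

lemma central_binomial_upper_bound: "real ((2*j) choose j) \<le> 4^j / sqrt (real (2*j+1))"
proof (induction j)
  case (Suc j)
  define B where "B = real ((2 * Suc j) choose Suc j)"
  define a b where "a = real (2*j+1)" and "b = real (2*Suc j+1)"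
  have rec: "real (Suc j) * B = 2 * a * real ((2*j) choose j)"
  proof -
    have d: "2 * Suc j = Suc (2*j+1)" "2*j+1 = Suc (2*j)" by simp_all
    have "Suc j * ((2 * Suc j) choose Suc j) = 2 * Suc j * (Suc (2*j) choose Suc j)"
      using Suc_times_binomial[of j "2*j+1"] binomial_symmetric[of j "2*j+1"] unfolding d by simp
    also have "\<dots> = 2 * (2*j+1) * ((2*j) choose j)" using Suc_times_binomial[of j "2*j"] by simp
    finally have "real (Suc j * ((2 * Suc j) choose Suc j)) = real (2 * (2*j+1) * ((2*j) choose j))"
      by (rule arg_cong)
    then show ?thesis by (simp only: of_nat_mult of_nat_numeral B_def a_def)
  qed
  have ab: "a > 0" "b > 0" by (auto simp: a_def b_def)
  have "sqrt a * sqrt b = sqrt (a * b)" by (simp add: real_sqrt_mult)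
  also have "\<dots> \<le> sqrt ((2 * real (j+1))\<^sup>2)"
    by (rule real_sqrt_le_mono) (simp add: power2_eq_square algebra_simps a_def b_def)
  also have "\<dots> = 2 * real (j+1)" by simp
  finally have *: "sqrt a * sqrt b \<le> 2 * real (j+1)" .
  have "B = 2 * a / real (Suc j) * real ((2*j) choose j)" using rec by (simp add: field_simps)
  also have "\<dots> \<le> 2 * a / real (Suc j) * (4^j / sqrt a)"
    using Suc ab by (intro mult_left_mono) (auto simp: a_def)
  also have "\<dots> = 4^j * (2 * (a / sqrt a) / real (Suc j))" by (simp add: mult_ac)
  also have "a / sqrt a = sqrt a" using ab by (simp add: real_div_sqrt)
  also have "4^j * (2 * sqrt a / real (Suc j)) \<le> 4^j * (4 / sqrt b)"
    using * ab by (intro mult_left_mono) (auto simp: field_simps)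
  finally show ?case by (simp add: B_def b_def mult.commute del: binomial_Suc_Suc)
qed simp

text \<open>For odd k = 2j+1 the middle coefficient is half of the central coefficient for 2j+2, so
  both parities reduce to the previous lemma.\<close>

lemma middle_binomial_upper_bound:
  assumes "k \<ge> 1"
  shows "real (k choose (k div 2)) / 2^k \<le> 1 / sqrt (real k)"
proof (cases "even k")
  case True
  then obtain j where j: "k = 2*j" by (auto elim: evenE)
  have "(2::real)^k = 4^j" by (simp add: j power_mult)
  then have "real (k choose (k div 2)) / 2^k \<le> 1 / sqrt (real (2*j+1))"
    using central_binomial_upper_bound[of j] by (simp add: j field_simps)
  also have "\<dots> \<le> 1 / sqrt (real k)" using assms by (intro divide_left_mono) (auto simp: j)
  finally show ?thesis .
next
  case False
  then obtain j where j: "k = 2*j+1" by (auto elim: oddE)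
  define B where "B = real ((2*j+2) choose (j+1))"
  have "(2*j+2) choose (j+1) = 2 * ((2*j+1) choose j)"
    using binomial_symmetric[of j "2*j+1"] by simp
  then have "B = 2 * real (k choose (k div 2))" by (simp add: B_def j)
  moreover have "B \<le> 4^(j+1) / sqrt (real (2*j+3))"
    using central_binomial_upper_bound[of "j+1"] by (simp add: B_def add.commute del: binomial_Suc_Suc)
  moreover have "4^(j+1) = 2 * (2::real)^k" by (simp add: j power_mult)
  ultimately have "real (k choose (k div 2)) / 2^k \<le> 1 / sqrt (real (2*j+3))"
    by (simp add: field_simps)
  also have "\<dots> \<le> 1 / sqrt (real k)" using assms by (intro divide_left_mono) (auto simp: j)
  finally show ?thesis .
qed

lemma mult_power_le:
  fixes a b :: real
  assumes "a \<ge> 0" "b \<ge> 0"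
  shows "(a * b)^j \<le> (a + b)^(2*j) / 4^j"
proof -
  have "a * b \<le> (a + b)\<^sup>2 / 4"
    using zero_le_power2[of "a - b"] by (simp add: power2_eq_square algebra_simps)
  then have "(a * b)^j \<le> ((a + b)\<^sup>2 / 4)^j" using assms by (intro power_mono) auto
  then show ?thesis by (simp add: power_divide power_mult)
qed

text \<open>Homogeneous in \<open>a\<close> and \<open>b\<close>, because they will be the masses of
  a set split by label, which need not add up to 1. The window contains at most three values of
  \<open>s\<close>; after the largest binomial coefficient is pulled out, a b \<le> (a+b)^2 / 4
  controls the remaining powers.\<close>

lemma sum_close_binomial_le:
  fixes a b :: real
  assumes k: "k \<ge> 1" and ab: "a \<ge> 0" "b \<ge> 0"
  shows "(\<Sum>s | s \<le> k \<and> \<bar>real s - real k / 2\<bar> \<le> 1. real (k choose s) * (a^s * b^(k - s)))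
           \<le> 4 / sqrt (real k) * (a + b)^k"
proof -
  define T where "T = {s. s \<le> k \<and> \<bar>real s - real k / 2\<bar> \<le> 1}"
  define C where "C = real (k choose (k div 2))"
  have C0: "C \<ge> 0" by (simp add: C_def)
  have "(\<Sum>s\<in>T. real (k choose s) * (a^s * b^(k - s))) \<le> (\<Sum>s\<in>T. C * (a^s * b^(k - s)))"
    unfolding C_def using ab by (intro sum_mono mult_right_mono) (auto simp: binomial_maximum)
  also have "\<dots> = C * (\<Sum>s\<in>T. a^s * b^(k - s))" by (simp add: sum_distrib_left)
  also have "(\<Sum>s\<in>T. a^s * b^(k - s)) \<le> 4 / 2^k * (a + b)^k"
  proof (cases "even k")
    case True
    then obtain j where j: "k = 2*j" by (auto elim: evenE)
    then obtain i where i: "j = Suc i" using k by (cases j) auto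
    have "real k / 2 = real i + 1" by (simp add: j i)
    \<comment> \<open>The window is j - 1, j, j + 1. The product (a b)^(j-1) is bounded by
      (a+b)^(2j-2) / 4^(j-1), and the missing factor 4 gives the constant 4 of the
      statement.\<close>
    then have T: "T = {i, Suc i, Suc (Suc i)}" unfolding T_def by (auto simp: j i abs_le_iff field_simps)
    have "(\<Sum>s\<in>T. a^s * b^(k - s)) = (a * b)^i * (a^2 + a * b + b^2)"
      unfolding T by (simp add: j i algebra_simps power2_eq_square power_mult_distrib)
    also have "\<dots> \<le> (a * b)^i * (a + b)^2"
      using ab by (intro mult_left_mono) (auto simp: power2_eq_square algebra_simps)
    also have "\<dots> \<le> (a + b)^(2*i) / 4^i * (a + b)^2"
      using ab by (intro mult_right_mono mult_power_le) auto
    also have "\<dots> = 4 / 2^k * (a + b)^k"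
      by (simp add: j i power_mult power2_eq_square)
    finally show ?thesis .
  next
    case False
    then obtain j where j: "k = 2*j+1" by (auto elim: oddE)
    have "real k / 2 = real j + 1 / 2" by (simp add: j)
    then have T: "T = {j, Suc j}" unfolding T_def by (auto simp: j abs_le_iff field_simps)
    have "(\<Sum>s\<in>T. a^s * b^(k - s)) = (a * b)^j * (a + b)"
      unfolding T by (simp add: j algebra_simps power_mult_distrib)
    also have "\<dots> \<le> (a + b)^(2*j) / 4^j * (a + b)"
      using ab by (intro mult_right_mono mult_power_le) auto
    \<comment> \<open>The odd case yields only 2 / 2^k; it is doubled to agree with the even
      case.\<close>
    also have "\<dots> \<le> 2 * ((a + b)^(2*j) / 4^j * (a + b))"
    proof -
      define X where "X = (a + b)^(2*j) / 4^j * (a + b)"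
      have "X \<ge> 0" using ab by (simp add: X_def)
      then have "X \<le> 2 * X" by simp
      then show ?thesis unfolding X_def .
    qed
    also have "\<dots> = 4 / 2^k * (a + b)^k" by (simp add: j power_mult)
    finally show ?thesis .
  qed
  then have "C * (\<Sum>s\<in>T. a^s * b^(k - s)) \<le> C * (4 / 2^k * (a + b)^k)"
    by (rule mult_left_mono) (rule C0)
  also have "\<dots> = (C / 2^k) * (4 * (a + b)^k)" by simp
  also have "\<dots> \<le> (1 / sqrt (real k)) * (4 * (a + b)^k)"
    unfolding C_def using ab by (intro mult_right_mono middle_binomial_upper_bound k) auto
  finally show ?thesis by (simp add: T_def)
qed

lemma sum_subsets_close_le:
  fixes a b :: real
  assumes K: "finite K" "card K = k" and k: "k \<ge> 1" and ab: "a \<ge> 0" "b \<ge> 0"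
  shows "(\<Sum>L | L \<subseteq> K \<and> \<bar>real (card L) - real k / 2\<bar> \<le> 1. a^card L * b^(k - card L))
           \<le> 4 / sqrt (real k) * (a + b)^k"
proof -
  let ?T = "{s. s \<le> k \<and> \<bar>real s - real k / 2\<bar> \<le> 1}"
  let ?F = "{L. L \<subseteq> K \<and> \<bar>real (card L) - real k / 2\<bar> \<le> 1}"
  have "(\<Sum>L\<in>?F. a^card L * b^(k - card L)) = (\<Sum>s\<in>?T. \<Sum>L\<in>{L\<in>?F. card L = s}. a^card L * b^(k - card L))"
    using K by (intro sum.group[symmetric]) (auto intro: card_mono)
  also have "\<dots> = (\<Sum>s\<in>?T. real (k choose s) * (a^s * b^(k - s)))"
  proof (rule sum.cong[OF refl])
    fix s assume "s \<in> ?T"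
    then have "{L\<in>?F. card L = s} = {L. L \<subseteq> K \<and> card L = s}" by auto
    then show "(\<Sum>L\<in>{L\<in>?F. card L = s}. a^card L * b^(k - card L)) = real (k choose s) * (a^s * b^(k - s))"
      using n_subsets[OF K(1), of s] K(2) by simp
  qed
  also have "\<dots> \<le> 4 / sqrt (real k) * (a + b)^k" by (rule sum_close_binomial_le[OF k ab])
  finally show ?thesis .
qed

subsection \<open>Anti-concentration of the vote\<close>

lemma measure_PiM_PiE:
  assumes M: "\<And>i. prob_space (M i)" and I: "finite I" and A: "\<And>i. i \<in> I \<Longrightarrow> A i \<in> sets (M i)"
  shows "measure (PiM I M) (Pi\<^sub>E I A) = (\<Prod>i\<in>I. measure (M i) (A i))"
proof -
  interpret product_prob_space M I by (rule product_prob_spaceI) (rule M)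
  have "emeasure (PiM I M) (Pi\<^sub>E I A) = (\<Prod>i\<in>I. ennreal (measure (M i) (A i)))"
    using emeasure_PiM[OF I, of A] A by (simp add: M.emeasure_eq_measure)
  also have "\<dots> = ennreal (\<Prod>i\<in>I. measure (M i) (A i))" by (rule prod_ennreal) simp
  finally show ?thesis by (simp add: measure_def prod_nonneg)
qed

text \<open>The conditional statement given \<open>C\<close>, multiplied out so that a box of
  measure zero needs no special care. Inside \<open>C\<close> the labels in \<open>K\<close> are
  independent with a common law; splitting \<open>C\<close> by the set \<open>L\<close> of points
  labelled 1 gives a binomial sum, whose bound is uniform in that law.\<close>

lemma vote_box:
  fixes y :: "'b \<Rightarrow> real"
  assumes M: "prob_space M" and Near: "Near \<in> sets M" and Far: "Far \<in> sets M"
    and y[measurable]: "y \<in> borel_measurable M" and y01: "\<And>w. w \<in> space M \<Longrightarrow> y w \<in> {0, 1}"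
    and J: "finite J" "K \<subseteq> J" and k: "card K = k" "k \<ge> 1"
  defines "C \<equiv> \<Pi>\<^sub>E i\<in>J. if i \<in> K then Near else Far"
  shows "measure (PiM J (\<lambda>_. M)) {w \<in> C. \<bar>(\<Sum>i\<in>K. y (w i)) - real k / 2\<bar> \<le> 1}
           \<le> 4 / sqrt (real k) * measure (PiM J (\<lambda>_. M)) C"
proof -
  interpret M: prob_space M by fact
  interpret P: prob_space "PiM J (\<lambda>_. M)" by (rule prob_space_PiM) (rule M)
  note [measurable] = Near Far
  define Y where "Y v = {w \<in> Near. y w = v}" for v
  have Y[measurable]: "Y v \<in> sets M" for v
  proof -
    have "Y v = Near \<inter> {w \<in> space M. y w = v}" using sets.sets_into_space[OF Near] by (auto simp: Y_def)
    then show ?thesis by simp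
  qed
  \<comment> \<open>The factor contributed by the points outside \<open>K\<close>, the same for
    every label pattern.\<close>
  define c where "c = measure M Far ^ card (J - K)"
  have finK: "finite K" using J finite_subset by blast
  define C' where "C' L = (\<Pi>\<^sub>E i\<in>J. if i \<in> K then if i \<in> L then Y 1 else Y 0 else Far)" for L
  have prodJ: "(\<Prod>i\<in>J. f i) = (\<Prod>i\<in>K. f i) * (\<Prod>i\<in>J - K. f i)" for f :: "_ \<Rightarrow> real"
    using prod.subset_diff[OF J(2,1), of f] by (simp add: mult.commute)
  have C': "measure (PiM J (\<lambda>_. M)) (C' L) = measure M (Y 1) ^ card L * measure M (Y 0) ^ (k - card L) * c"
    if L: "L \<subseteq> K" for L
  proof -
    have "measure (PiM J (\<lambda>_. M)) (C' L) =
        (\<Prod>i\<in>J. measure M (if i \<in> K then if i \<in> L then Y 1 else Y 0 else Far))"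
      unfolding C'_def by (rule measure_PiM_PiE) (use M J in auto)
    also have "\<dots> = (\<Prod>i\<in>K. measure M (if i \<in> L then Y 1 else Y 0)) * (\<Prod>i\<in>J - K. measure M Far)"
      unfolding prodJ by (intro arg_cong2[where f="(*)"] prod.cong) auto
    also have "(\<Prod>i\<in>K. measure M (if i \<in> L then Y 1 else Y 0)) = (\<Prod>i\<in>K - L. measure M (Y 0)) * (\<Prod>i\<in>L. measure M (Y 1))"
      unfolding prod.subset_diff[OF L finK] by (intro arg_cong2[where f="(*)"] prod.cong) auto
    also have "card (K - L) = k - card L" using L finK k by (simp add: card_Diff_subset finite_subset)
    ultimately show ?thesis by (simp add: c_def)
  qed
  have C: "measure (PiM J (\<lambda>_. M)) C = measure M Near ^ k * c"
  proof -
    have "measure (PiM J (\<lambda>_. M)) C = (\<Prod>i\<in>J. measure M (if i \<in> K then Near else Far))"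
      unfolding C_def by (rule measure_PiM_PiE) (use M J in auto)
    also have "\<dots> = (\<Prod>i\<in>K. measure M Near) * (\<Prod>i\<in>J - K. measure M Far)"
      unfolding prodJ by (intro arg_cong2[where f="(*)"] prod.cong) auto
    finally show ?thesis using k by (simp add: c_def)
  qed
  have Near01: "measure M Near = measure M (Y 1) + measure M (Y 0)"
  proof -
    have "Near = Y 1 \<union> Y 0" using y01 sets.sets_into_space[OF Near] by (auto simp: Y_def)
    then have "measure M Near = measure M (Y 1 \<union> Y 0)" by simp
    also have "\<dots> = measure M (Y 1) + measure M (Y 0)"
      by (rule M.finite_measure_Union) (auto simp: Y_def[of 0] Y_def[of 1] intro: Y)
    finally show ?thesis .
  qed
  define F where "F = {L. L \<subseteq> K \<and> \<bar>real (card L) - real k / 2\<bar> \<le> 1}"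
  have finF: "finite F" unfolding F_def using finK by simp
  have sets': "C' L \<in> sets (PiM J (\<lambda>_. M))" for L
    unfolding C'_def using J by (intro sets_PiM_I_finite) auto
  \<comment> \<open>Only an upper bound is wanted, so it suffices to cover the event by the boxes
    whose number of labels 1 lies in the window.\<close>
  have "{w \<in> C. \<bar>(\<Sum>i\<in>K. y (w i)) - real k / 2\<bar> \<le> 1} \<subseteq> (\<Union>L\<in>F. C' L)"
  proof
    fix w assume w: "w \<in> {w \<in> C. \<bar>(\<Sum>i\<in>K. y (w i)) - real k / 2\<bar> \<le> 1}"
    define L where "L = {i \<in> K. y (w i) = 1}"
    have wK: "w i \<in> Near" if "i \<in> K" for i
    proof -
      have "w \<in> (\<Pi>\<^sub>E i\<in>J. if i \<in> K then Near else Far)" using w by (simp add: C_def)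
      moreover have "i \<in> J" using that J by auto
      ultimately have "w i \<in> (if i \<in> K then Near else Far)" by (rule PiE_mem)
      then show ?thesis using that by simp
    qed
    have y': "y (w i) = of_bool (i \<in> L)" if "i \<in> K" for i
      using y01[of "w i"] wK[OF that] that sets.sets_into_space[OF Near] by (auto simp: L_def)
    have "(\<Sum>i\<in>K. y (w i)) = (\<Sum>i\<in>K. of_bool (i \<in> L))" by (rule sum.cong) (use y' in auto)
    also have "\<dots> = real (card (K \<inter> L))" using finK by (simp add: sum_of_bool_eq)
    also have "K \<inter> L = L" by (auto simp: L_def)
    finally have LF: "L \<in> F" using w by (auto simp: F_def L_def)
    have wC: "w \<in> (\<Pi>\<^sub>E i\<in>J. if i \<in> K then Near else Far)" using w by (simp add: C_def)
    have "w \<in> C' L"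
      unfolding C'_def
    proof (rule PiE_I)
      fix i assume i: "i \<in> J"
      show "w i \<in> (if i \<in> K then if i \<in> L then Y 1 else Y 0 else Far)"
        using PiE_mem[OF wC i] wK[of i] y'[of i] by (auto simp: Y_def)
    next
      fix i assume "i \<notin> J"
      then show "w i = undefined" by (rule PiE_arb[OF wC])
    qed
    with LF show "w \<in> (\<Union>L\<in>F. C' L)" by blast
  qed
  then have "measure (PiM J (\<lambda>_. M)) {w \<in> C. \<bar>(\<Sum>i\<in>K. y (w i)) - real k / 2\<bar> \<le> 1}
      \<le> measure (PiM J (\<lambda>_. M)) (\<Union>L\<in>F. C' L)"
    by (rule P.finite_measure_mono) (use sets' finF in \<open>intro sets.finite_UN\<close>)
  also have "\<dots> \<le> (\<Sum>L\<in>F. measure (PiM J (\<lambda>_. M)) (C' L))"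
    using sets' finF by (intro P.finite_measure_subadditive_finite) auto
  also have "\<dots> = (\<Sum>L\<in>F. measure M (Y 1) ^ card L * measure M (Y 0) ^ (k - card L)) * c"
    unfolding sum_distrib_right by (rule sum.cong) (auto simp: C' F_def)
  also have "\<dots> \<le> (4 / sqrt (real k) * (measure M (Y 1) + measure M (Y 0)) ^ k) * c"
    unfolding F_def using finK k
    by (intro mult_right_mono sum_subsets_close_le) (auto simp: c_def)
  also have "\<dots> = 4 / sqrt (real k) * measure (PiM J (\<lambda>_. M)) C"
    by (simp add: C Near01)
  finally show ?thesis .
qed

text \<open>
  Below, \<open>H l K\<close> is the event that \<open>K\<close> consists of the \<open>k\<close> first points and \<open>l\<close> is the next one.
  These events are disjoint, and given the value at \<open>l\<close> the values in \<open>K\<close> are i.i.d.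
\<close>

lemma vote_anticoncentration:
  fixes y :: "'b \<Rightarrow> real" and I :: "nat set"
  assumes M: "prob_space M"
    and y[measurable]: "y \<in> borel_measurable M" and y01: "\<And>w. w \<in> space M \<Longrightarrow> y w \<in> {0, 1}"
    and r[measurable]: "Measurable.pred (M \<Otimes>\<^sub>M M) (\<lambda>p. r (fst p) (snd p))"
    and I: "finite I" "k \<le> card I" and k: "k \<ge> 1"
    and r_AE: "AE w in PiM I (\<lambda>_. M). strict_order_on I (\<lambda>i j. r (w i) (w j))"
  shows "measure (PiM I (\<lambda>_. M)) {w \<in> space (PiM I (\<lambda>_. M)).
      \<bar>(\<Sum>i \<in> first k I (\<lambda>i j. r (w i) (w j)). y (w i)) - real k / 2\<bar> \<le> 1} \<le> 4 / sqrt (real k)"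
proof -
  interpret M: prob_space M by fact
  let ?P = "PiM I (\<lambda>_. M)"
  interpret P: prob_space ?P by (rule prob_space_PiM) (rule M)
  interpret PP: product_prob_space "\<lambda>_. M" I by (rule product_prob_spaceI) (rule M)
  let ?\<rho> = "4 / sqrt (real k)"
  let ?close = "\<lambda>K w. \<bar>(\<Sum>i\<in>K. y (w i)) - real k / 2\<bar> \<le> 1"
  have rI[measurable]: "Measurable.pred ?P (\<lambda>w. r (w i) (w j))" if "i \<in> I" "j \<in> I" for i j
    using measurable_compose[where f="\<lambda>w. (w i, w j)" and M="?P", OF _ r] that by simp
  have yI[measurable]: "(\<lambda>w. y (w i)) \<in> borel_measurable ?P" if "i \<in> I" for i
    by (rule measurable_compose[where N=M and f="\<lambda>w. w i", OF _ y]) (simp add: that)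
  show ?thesis
  proof (cases "card I = k")
    case True
    \<comment> \<open>Without a further point there is no next neighbour to condition on. All points
      are then selected, and the conditional with equal branches brings the whole space into the
      shape of the box in \<open>vote_box\<close>.\<close>
    let ?C = "\<Pi>\<^sub>E i\<in>I. if i \<in> I then space M else space M"
    have C: "?C = space ?P" by (simp add: space_PiM)
    have "AE w in ?P. first k I (\<lambda>i j. r (w i) (w j)) = I"
      using r_AE
    proof eventually_elim
      case (elim w)
      then show ?case
        using card_first[OF I(1) elim, of k] True first_subset I(1) card_subset_eq by (metis min.idem)
    qed
    then have "AE w in ?P. w \<in> {w \<in> space ?P. ?close (first k I (\<lambda>i j. r (w i) (w j))) w} \<longrightarrow>
        w \<in> {w \<in> ?C. ?close I w}"
      unfolding C by eventually_elim auto
    moreover have "{w \<in> ?C. ?close I w} \<in> sets ?P" unfolding C by measurable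
    ultimately have "measure ?P {w \<in> space ?P. ?close (first k I (\<lambda>i j. r (w i) (w j))) w}
        \<le> measure ?P {w \<in> ?C. ?close I w}"
      by (rule P.finite_measure_mono_AE)
    also have "\<dots> \<le> ?\<rho> * measure ?P ?C"
      using vote_box[OF M sets.top sets.top y y01 I(1) subset_refl True k] by simp
    also have "\<dots> = ?\<rho>" unfolding C P.prob_space by simp
    finally show ?thesis .
  next
    case False
    then have kI: "k < card I" using I by simp
    define H where "H l K = {w \<in> space ?P. (\<forall>i\<in>K. r (w i) (w l)) \<and> (\<forall>i\<in>I - {l} - K. r (w l) (w i))}" for l K
    define H' where "H' l K = {w \<in> H l K. ?close K w}" for l K
    define T where "T = {(l, K). l \<in> I \<and> K \<subseteq> I - {l} \<and> card K = k}"
    have finT: "finite T"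
      by (rule finite_subset[of _ "I \<times> Pow I"]) (use I in \<open>auto simp: T_def\<close>)
    have H[measurable]: "H l K \<in> sets ?P" and H'[measurable]: "H' l K \<in> sets ?P" if "(l, K) \<in> T" for l K
    proof -
      have *: "l \<in> I" "K \<subseteq> I" "finite K" "finite (I - {l} - K)" using that I finite_subset by (auto simp: T_def)
      have [measurable]: "Measurable.pred ?P (\<lambda>w. \<forall>i\<in>K. r (w i) (w l))"
        using * by (intro pred_intros_finite rI) auto
      have [measurable]: "Measurable.pred ?P (\<lambda>w. \<forall>i\<in>I - {l} - K. r (w l) (w i))"
        using * by (intro pred_intros_finite rI) auto
      have [measurable]: "(\<lambda>w. \<Sum>i\<in>K. y (w i)) \<in> borel_measurable ?P"
        using * by (intro borel_measurable_sum yI) auto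
      show "H l K \<in> sets ?P" unfolding H_def by measurable
      have "H' l K = {w \<in> space ?P. ((\<forall>i\<in>K. r (w i) (w l)) \<and> (\<forall>i\<in>I - {l} - K. r (w l) (w i))) \<and> ?close K w}"
        by (auto simp: H'_def H_def)
      then show "H' l K \<in> sets ?P" by simp
    qed
    \<comment> \<open>Once the value \<open>v\<close> at \<open>l\<close> is fixed,
      \<open>H l K\<close> requires the coordinates in \<open>K\<close> to precede \<open>v\<close>
      and all others to follow it, which is a box. The factor \<open>?\<rho>\<close> from
      \<open>vote_box\<close> does not depend on \<open>v\<close> and survives integration over
      it.\<close>
    have bound: "measure ?P (H' l K) \<le> ?\<rho> * measure ?P (H l K)" if lK: "(l, K) \<in> T" for l K
    proof -
      let ?J = "I - {l}"
      let ?Q = "PiM ?J (\<lambda>_. M)"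
      interpret Q: prob_space ?Q by (rule prob_space_PiM) (rule M)
      have *: "l \<in> I" "K \<subseteq> ?J" "card K = k" "finite ?J" using lK I by (auto simp: T_def)
      have ins: "insert l ?J = I" using * by auto
      define Near where "Near v = {w \<in> space M. r w v}" for v
      define Far where "Far v = {w \<in> space M. r v w}" for v
      define C where "C v = (\<Pi>\<^sub>E i\<in>?J. if i \<in> K then Near v else Far v)" for v
      have NF[measurable]: "Near v \<in> sets M" "Far v \<in> sets M" if "v \<in> space M" for v
        using measurable_compose[OF _ r, of "\<lambda>w. (w, v)" M] measurable_compose[OF _ r, of "\<lambda>w. (v, w)" M] that
        by (auto simp: Near_def Far_def)
      have iH: "x(l := v) \<in> H l K \<longleftrightarrow> x \<in> C v" if "x \<in> space ?Q" "v \<in> space M" for x v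
      proof -
        have 1: "x(l := v) \<in> space ?P"
          using that *(1) by (auto simp: space_PiM PiE_iff extensional_def)
        have 2: "x i \<in> space M" if "i \<in> ?J" for i using that \<open>x \<in> space ?Q\<close> by (auto simp: space_PiM)
        have 3: "x \<in> extensional ?J" using \<open>x \<in> space ?Q\<close> by (auto simp: space_PiM PiE_iff)
        have "x(l := v) \<in> H l K \<longleftrightarrow> (\<forall>i\<in>K. r (x i) v) \<and> (\<forall>i\<in>?J - K. r v (x i))"
          unfolding H_def using 1 *(2) by (auto intro!: ball_cong)
        also have "\<dots> \<longleftrightarrow> x \<in> C v"
          unfolding C_def PiE_iff Near_def Far_def using 2 3 *(2) by auto
        finally show ?thesis .
      qed
      have iH': "x(l := v) \<in> H' l K \<longleftrightarrow> x \<in> {x \<in> C v. ?close K x}" if "x \<in> space ?Q" "v \<in> space M" for x v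
      proof -
        have "(\<Sum>i\<in>K. y ((x(l := v)) i)) = (\<Sum>i\<in>K. y (x i))" by (rule sum.cong) (use *(2) in auto)
        then show ?thesis using iH[OF that] by (simp add: H'_def)
      qed
      have fold: "emeasure ?P A = (\<integral>\<^sup>+ v. emeasure ?Q (B v) \<partial>M)"
        if A: "A \<in> sets ?P" and B: "\<And>v. v \<in> space M \<Longrightarrow> B v \<in> sets ?Q"
          and AB: "\<And>x v. x \<in> space ?Q \<Longrightarrow> v \<in> space M \<Longrightarrow> x(l := v) \<in> A \<longleftrightarrow> x \<in> B v" for A B
      proof -
        have "emeasure ?P A = (\<integral>\<^sup>+ w. indicator A w \<partial>PiM (insert l ?J) (\<lambda>_. M))"
          unfolding ins using A by simp
        also have "\<dots> = (\<integral>\<^sup>+ v. (\<integral>\<^sup>+ x. indicator A (x(l := v)) \<partial>?Q) \<partial>M)"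
          by (rule PP.product_nn_integral_insert_rev[OF *(4)]) (unfold ins, use A in auto)
        also have "\<dots> = (\<integral>\<^sup>+ v. emeasure ?Q (B v) \<partial>M)"
        proof (rule nn_integral_cong)
          fix v assume v: "v \<in> space M"
          have "(\<integral>\<^sup>+ x. indicator A (x(l := v)) \<partial>?Q) = (\<integral>\<^sup>+ x. indicator (B v) x \<partial>?Q)"
            by (rule nn_integral_cong) (use AB[OF _ v] in \<open>auto simp: indicator_def\<close>)
          then show "(\<integral>\<^sup>+ x. indicator A (x(l := v)) \<partial>?Q) = emeasure ?Q (B v)" using B[OF v] by simp
        qed
        finally show ?thesis .
      qed
      have Csets: "C v \<in> sets ?Q" if "v \<in> space M" for v
        unfolding C_def using *(4) NF[OF that] by (intro sets_PiM_I_finite) auto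
      have C'sets: "{x \<in> C v. ?close K x} \<in> sets ?Q" if "v \<in> space M" for v
      proof -
        have [measurable]: "(\<lambda>w. \<Sum>i\<in>K. y (w i)) \<in> borel_measurable ?Q"
        proof (rule borel_measurable_sum)
          fix i assume "i \<in> K"
          then have "i \<in> ?J" using *(2) by auto
          then show "(\<lambda>w. y (w i)) \<in> borel_measurable ?Q"
            by (intro measurable_compose[where N=M and f="\<lambda>w. w i", OF _ y]) simp
        qed
        have "{x \<in> C v. ?close K x} = C v \<inter> {x \<in> space ?Q. ?close K x}"
          using sets.sets_into_space[OF Csets[OF that]] by auto
        then show ?thesis using Csets[OF that] by simp
      qed
      have "emeasure ?P (H' l K) = (\<integral>\<^sup>+ v. emeasure ?Q {x \<in> C v. ?close K x} \<partial>M)"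
        by (rule fold[OF H'[OF lK] C'sets iH'])
      also have "\<dots> \<le> (\<integral>\<^sup>+ v. ennreal ?\<rho> * emeasure ?Q (C v) \<partial>M)"
      proof (rule nn_integral_mono)
        fix v assume v: "v \<in> space M"
        show "emeasure ?Q {x \<in> C v. ?close K x} \<le> ennreal ?\<rho> * emeasure ?Q (C v)"
          using vote_box[OF M NF[OF v] y y01 *(4,2,3) k]
          by (simp add: C_def Q.emeasure_eq_measure flip: ennreal_mult')
      qed
      also have "\<dots> = (\<integral>\<^sup>+ v. (\<integral>\<^sup>+ x. ennreal ?\<rho> * indicator (H l K) (x(l := v)) \<partial>?Q) \<partial>M)"
      proof (rule nn_integral_cong)
        fix v assume v: "v \<in> space M"
        have "(\<integral>\<^sup>+ x. ennreal ?\<rho> * indicator (H l K) (x(l := v)) \<partial>?Q) = (\<integral>\<^sup>+ x. ennreal ?\<rho> * indicator (C v) x \<partial>?Q)"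
          by (rule nn_integral_cong) (use iH[OF _ v] in \<open>auto simp: indicator_def\<close>)
        also have "\<dots> = ennreal ?\<rho> * emeasure ?Q (C v)" using Csets[OF v] by (rule nn_integral_cmult_indicator)
        finally show "ennreal ?\<rho> * emeasure ?Q (C v) = (\<integral>\<^sup>+ x. ennreal ?\<rho> * indicator (H l K) (x(l := v)) \<partial>?Q)" by simp
      qed
      also have "\<dots> = (\<integral>\<^sup>+ w. ennreal ?\<rho> * indicator (H l K) w \<partial>PiM (insert l ?J) (\<lambda>_. M))"
        by (rule PP.product_nn_integral_insert_rev[symmetric, OF *(4)]) (unfold ins, use H[OF lK] in auto)
      also have "\<dots> = ennreal ?\<rho> * emeasure ?P (H l K)"
        unfolding ins using H[OF lK] by (rule nn_integral_cmult_indicator)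
      finally show ?thesis
        by (simp add: P.emeasure_eq_measure flip: ennreal_mult')
    qed
    \<comment> \<open>As \<open>k < card I\<close>, some \<open>l\<close> has exactly
      \<open>k\<close> predecessors, and these are the selected points.\<close>
    have sub: "AE w in ?P. w \<in> {w \<in> space ?P. ?close (first k I (\<lambda>i j. r (w i) (w j))) w} \<longrightarrow>
        w \<in> (\<Union>(l, K)\<in>T. H' l K)"
      using r_AE AE_space
    proof eventually_elim
      case (elim w)
      let ?r = "\<lambda>i j. r (w i) (w j)"
      have "k \<in> (\<lambda>i. card {j \<in> I. ?r j i}) ` I"
        using bij_betw_rank[OF I(1) elim(1)] kI by (auto simp: bij_betw_def)
      then obtain l where l: "l \<in> I" "card {j \<in> I. ?r j l} = k" by auto
      let ?K = "{j \<in> I. ?r j l}"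
      have "first k I ?r = ?K" by (rule first_eq_below[OF I(1) elim(1) l])
      moreover have "(l, ?K) \<in> T"
        using l strict_order_on_irrefl[OF elim(1) l(1)] by (auto simp: T_def)
      moreover have "w \<in> H l ?K"
        using elim(2) l strict_order_on_total[OF elim(1)] by (auto simp: H_def)
      ultimately show ?case by (auto simp: H'_def)
    qed
    \<comment> \<open>A pair is determined by \<open>w\<close>: its \<open>l\<close> has rank
      \<open>k\<close>, and its \<open>K\<close> consists of the predecessors of \<open>l\<close>.
      This uses the order axioms, which hold only almost surely, so the sum of the indicators is
      bounded under the integral.\<close>
    have le1: "(\<Sum>(l, K)\<in>T. measure ?P (H l K)) \<le> 1"
    proof -
      have "ennreal (\<Sum>(l, K)\<in>T. measure ?P (H l K)) = (\<Sum>p\<in>T. emeasure ?P (H (fst p) (snd p)))"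
        by (subst sum_ennreal[symmetric]) (auto simp: P.emeasure_eq_measure split_beta)
      also have "\<dots> = (\<Sum>p\<in>T. \<integral>\<^sup>+ w. indicator (H (fst p) (snd p)) w \<partial>?P)"
        by (rule sum.cong[OF refl]) (use H in \<open>auto simp: split_beta\<close>)
      also have "\<dots> = (\<integral>\<^sup>+ w. (\<Sum>p\<in>T. indicator (H (fst p) (snd p)) w) \<partial>?P)"
        by (rule nn_integral_sum[symmetric]) (use H in auto)
      also have "\<dots> \<le> (\<integral>\<^sup>+ w. 1 \<partial>?P)"
      proof (rule nn_integral_mono_AE)
        show "AE w in ?P. (\<Sum>p\<in>T. indicator (H (fst p) (snd p)) w) \<le> (1::ennreal)"
          using r_AE
        proof eventually_elim
          case (elim w)
          let ?r = "\<lambda>i j. r (w i) (w j)"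
          have K: "K = {j \<in> I. ?r j l}" if "(l, K) \<in> T" "w \<in> H l K" for l K
          proof -
            have *: "l \<in> I" "K \<subseteq> I - {l}" using that by (auto simp: T_def)
            have "\<not> ?r j l" if "j \<in> I - {l} - K" for j
            proof
              assume "?r j l"
              moreover have "?r l j" using that \<open>w \<in> H l K\<close> by (auto simp: H_def)
              ultimately have "?r l l" using strict_order_on_trans[OF elim, of l j l] that * by auto
              then show False using strict_order_on_irrefl[OF elim *(1)] by simp
            qed
            then show ?thesis using * that strict_order_on_irrefl[OF elim *(1)] by (auto simp: H_def)
          qed
          have uniq: "p = p'" if p: "p \<in> T" "w \<in> H (fst p) (snd p)" and p': "p' \<in> T" "w \<in> H (fst p') (snd p')" for p p'
          proof -
            have e: "snd p = {j \<in> I. ?r j (fst p)}" "snd p' = {j \<in> I. ?r j (fst p')}"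
              using K[of "fst p" "snd p"] K[of "fst p'" "snd p'"] p p' by auto
            have c: "card (snd p) = k" "card (snd p') = k" "fst p \<in> I" "fst p' \<in> I"
              using p p' by (auto simp: T_def)
            have "fst p = fst p'"
              using bij_betw_imp_inj_on[OF bij_betw_rank[OF I(1) elim]] c e
              by (auto simp: inj_on_def)
            then show ?thesis using e by (simp add: prod_eq_iff)
          qed
          show ?case
          proof (cases "\<exists>p\<in>T. w \<in> H (fst p) (snd p)")
            case True
            then obtain p where p: "p \<in> T" "w \<in> H (fst p) (snd p)" by blast
            have "(\<Sum>q\<in>T. indicator (H (fst q) (snd q)) w) = (\<Sum>q\<in>T. if q = p then 1 else (0::ennreal))"
            proof (rule sum.cong[OF refl])
              fix q assume "q \<in> T"
              then show "indicator (H (fst q) (snd q)) w = (if q = p then 1 else (0::ennreal))"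
                using uniq[of q p] p by (cases "q = p") (auto simp: indicator_def)
            qed
            also have "\<dots> \<le> 1" using finT by (simp add: sum.delta)
            finally show ?thesis .
          next
            case False
            then have "(\<Sum>q\<in>T. indicator (H (fst q) (snd q)) w) = (0::ennreal)"
              by (intro sum.neutral) auto
            then show ?thesis by simp
          qed
        qed
      qed
      also have "\<dots> = ennreal 1" by (simp add: P.emeasure_space_1)
      finally show ?thesis by simp
    qed
    have "(\<Union>(l, K)\<in>T. H' l K) \<in> sets ?P" using finT H' by (intro sets.finite_UN) auto
    with sub have "measure ?P {w \<in> space ?P. ?close (first k I (\<lambda>i j. r (w i) (w j))) w}
        \<le> measure ?P (\<Union>(l, K)\<in>T. H' l K)"
      by (rule P.finite_measure_mono_AE)
    also have "\<dots> \<le> (\<Sum>(l, K)\<in>T. measure ?P (H' l K))"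
      using P.finite_measure_subadditive_finite[OF finT, of "\<lambda>(l, K). H' l K"] H' by (auto simp: split_beta image_subset_iff)
    also have "\<dots> \<le> (\<Sum>(l, K)\<in>T. ?\<rho> * measure ?P (H l K))"
      by (rule sum_mono) (use bound in auto)
    also have "\<dots> = ?\<rho> * (\<Sum>(l, K)\<in>T. measure ?P (H l K))"
      by (simp add: sum_distrib_left split_beta)
    also have "\<dots> \<le> ?\<rho> * 1" using le1 by (intro mult_left_mono) auto
    finally show ?thesis by simp
  qed
qed

section \<open>Independent tie-breakers\<close>

lemma distr_pair_PiM:
  assumes I: "finite I" and M: "\<And>i. prob_space (M i)" and N: "\<And>i. prob_space (N i)"
  shows "distr (PiM I M \<Otimes>\<^sub>M PiM I N) (PiM I (\<lambda>i. M i \<Otimes>\<^sub>M N i)) (\<lambda>(x, y). \<lambda>i\<in>I. (x i, y i)) =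
    PiM I (\<lambda>i. M i \<Otimes>\<^sub>M N i)"
proof -
  have MN: "prob_space (M i \<Otimes>\<^sub>M N i)" for i
    using M N by (intro prob_space_pair)
  interpret M: product_prob_space M I by (rule product_prob_spaceI) (rule M)
  interpret N: product_prob_space N I by (rule product_prob_spaceI) (rule N)
  interpret MN: product_prob_space "\<lambda>i. M i \<Otimes>\<^sub>M N i" I by (rule product_prob_spaceI) (rule MN)
  have PN: "prob_space (PiM I N)" by (rule prob_space_PiM) (rule N)
  let ?t = "\<lambda>(x, y). \<lambda>i\<in>I. (x i, y i)"
  have t[measurable]: "?t \<in> PiM I M \<Otimes>\<^sub>M PiM I N \<rightarrow>\<^sub>M PiM I (\<lambda>i. M i \<Otimes>\<^sub>M N i)"
    unfolding split_beta by (rule measurable_restrict) measurable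
  \<comment> \<open>A finite product is determined by its values on boxes. The preimage of a box,
    cut at a fixed \<open>x\<close>, is again a box, so Fubini's theorem gives a product over
    \<open>I\<close> of integrals in one coordinate.\<close>
  show ?thesis
  proof (rule MN.PiM_eqI[OF I])
    fix A assume A: "\<And>i. i \<in> I \<Longrightarrow> A i \<in> sets (M i \<Otimes>\<^sub>M N i)"
    have slice[measurable]: "(\<lambda>x. emeasure (N i) (Pair x -` A i)) \<in> borel_measurable (M i)" if "i \<in> I" for i
    proof -
      interpret pair_sigma_finite "M i" "N i"
        by (intro pair_sigma_finite.intro prob_space_imp_sigma_finite M N)
      show ?thesis by (rule measurable_emeasure_Pair1) (rule A[OF that])
    qed
    have "emeasure (distr (PiM I M \<Otimes>\<^sub>M PiM I N) (PiM I (\<lambda>i. M i \<Otimes>\<^sub>M N i)) ?t) (Pi\<^sub>E I A) =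
        emeasure (PiM I M \<Otimes>\<^sub>M PiM I N) (?t -` (Pi\<^sub>E I A) \<inter> space (PiM I M \<Otimes>\<^sub>M PiM I N))"
      using A I by (intro emeasure_distr t sets_PiM_I_finite) auto
    also have "\<dots> = (\<integral>\<^sup>+ x. emeasure (PiM I N) (Pair x -` (?t -` (Pi\<^sub>E I A) \<inter> space (PiM I M \<Otimes>\<^sub>M PiM I N))) \<partial>PiM I M)"
      using A I by (intro sigma_finite_measure.emeasure_pair_measure_alt[OF prob_space_imp_sigma_finite[OF PN]] measurable_sets[OF t] sets_PiM_I_finite) auto
    also have "\<dots> = (\<integral>\<^sup>+ x. (\<Prod>i\<in>I. emeasure (N i) (Pair (x i) -` A i)) \<partial>PiM I M)"
    proof (rule nn_integral_cong)
      fix x assume x: "x \<in> space (PiM I M)"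
      have "Pair x -` (?t -` (Pi\<^sub>E I A) \<inter> space (PiM I M \<Otimes>\<^sub>M PiM I N)) = (\<Pi>\<^sub>E i\<in>I. Pair (x i) -` A i)"
      proof (intro set_eqI iffI)
        fix y assume "y \<in> Pair x -` (?t -` (Pi\<^sub>E I A) \<inter> space (PiM I M \<Otimes>\<^sub>M PiM I N))"
        then show "y \<in> (\<Pi>\<^sub>E i\<in>I. Pair (x i) -` A i)"
          by (auto simp: space_pair_measure space_PiM PiE_iff split: if_splits)
      next
        fix y assume y: "y \<in> (\<Pi>\<^sub>E i\<in>I. Pair (x i) -` A i)"
        have "y i \<in> space (N i)" if "i \<in> I" for i
          using y that sets.sets_into_space[OF A[OF that]] by (auto simp: PiE_iff space_pair_measure)
        with y x show "y \<in> Pair x -` (?t -` (Pi\<^sub>E I A) \<inter> space (PiM I M \<Otimes>\<^sub>M PiM I N))"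
          by (auto simp: space_pair_measure space_PiM PiE_iff split: if_splits)
      qed
      moreover have "emeasure (PiM I N) (\<Pi>\<^sub>E i\<in>I. Pair (x i) -` A i) = (\<Prod>i\<in>I. emeasure (N i) (Pair (x i) -` A i))"
        by (rule N.emeasure_PiM[OF I]) (rule sets_Pair1[OF A])
      ultimately show "emeasure (PiM I N) (Pair x -` (?t -` (Pi\<^sub>E I A) \<inter> space (PiM I M \<Otimes>\<^sub>M PiM I N))) =
          (\<Prod>i\<in>I. emeasure (N i) (Pair (x i) -` A i))" by simp
    qed
    also have "\<dots> = (\<Prod>i\<in>I. \<integral>\<^sup>+ x. emeasure (N i) (Pair x -` A i) \<partial>M i)"
      by (rule M.product_nn_integral_prod[OF I slice])
    also have "\<dots> = (\<Prod>i\<in>I. emeasure (M i \<Otimes>\<^sub>M N i) (A i))"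
    proof (rule prod.cong[OF refl])
      fix i assume i: "i \<in> I"
      show "(\<integral>\<^sup>+ x. emeasure (N i) (Pair x -` A i) \<partial>M i) = emeasure (M i \<Otimes>\<^sub>M N i) (A i)"

        by (rule sigma_finite_measure.emeasure_pair_measure_alt[OF prob_space_imp_sigma_finite[OF N], symmetric])
          (rule A[OF i])
    qed
    finally show "emeasure (distr (PiM I M \<Otimes>\<^sub>M PiM I N) (PiM I (\<lambda>i. M i \<Otimes>\<^sub>M N i)) ?t) (Pi\<^sub>E I A) =
      (\<Prod>i\<in>I. emeasure (M i \<Otimes>\<^sub>M N i) (A i))" .
  qed simp
qed

text \<open>With the coordinates other than \<open>i\<close> frozen, \<open>g (w j)\<close> is a
  constant, which \<open>g (w i)\<close> avoids almost surely; only finitely many pairs have to be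
  considered.\<close>

lemma AE_PiM_inj_on:
  fixes g :: "'b \<Rightarrow> real"
  assumes M: "prob_space M" and g[measurable]: "g \<in> borel_measurable M"
    and noatom: "\<And>c. AE v in M. g v \<noteq> c" and I: "finite I"
  shows "AE w in PiM I (\<lambda>_. M). inj_on (\<lambda>i. g (w i)) I"
proof -
  interpret PP: product_prob_space "\<lambda>_. M" I by (rule product_prob_spaceI) (rule M)
  have ne: "AE w in PiM I (\<lambda>_. M). g (w i) \<noteq> g (w j)" if ij: "i \<in> I" "j \<in> I" "i \<noteq> j" for i j
  proof -
    let ?J = "I - {i}"
    have ins: "insert i ?J = I" and J: "finite ?J" "i \<notin> ?J" using ij I by auto
    let ?E = "{w \<in> space (PiM I (\<lambda>_. M)). g (w i) = g (w j)}"
    have [measurable]: "(\<lambda>w. g (w l)) \<in> borel_measurable (PiM I (\<lambda>_. M))" if "l \<in> I" for l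
      by (rule measurable_compose[where N=M and f="\<lambda>w. w l", OF _ g]) (simp add: that)
    have E: "?E \<in> sets (PiM I (\<lambda>_. M))" using ij by measurable
    have "emeasure (PiM I (\<lambda>_. M)) ?E = (\<integral>\<^sup>+ w. indicator ?E w \<partial>PiM (insert i ?J) (\<lambda>_. M))"
      unfolding ins using E by simp
    also have "\<dots> = (\<integral>\<^sup>+ x. (\<integral>\<^sup>+ v. indicator ?E (x(i := v)) \<partial>M) \<partial>PiM ?J (\<lambda>_. M))"
      by (rule PP.product_nn_integral_insert[OF J]) (unfold ins, use E in simp)
    also have "\<dots> \<le> (\<integral>\<^sup>+ x. (\<integral>\<^sup>+ v. 0 \<partial>M) \<partial>PiM ?J (\<lambda>_. M))"
    proof (rule nn_integral_mono, rule nn_integral_mono_AE)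
      fix x
      show "AE v in M. indicator ?E (x(i := v)) \<le> (0::ennreal)"
        using noatom[of "g (x j)"] by eventually_elim (use ij in \<open>auto simp: indicator_def\<close>)
    qed
    finally have "?E \<in> null_sets (PiM I (\<lambda>_. M))" using E by auto
    then have "AE w in PiM I (\<lambda>_. M). w \<notin> ?E" by (rule AE_not_in)
    then show ?thesis using AE_space by eventually_elim auto
  qed
  have "AE w in PiM I (\<lambda>_. M). \<forall>i\<in>I. \<forall>j\<in>I. i \<noteq> j \<longrightarrow> g (w i) \<noteq> g (w j)"
  proof (intro AE_finite_allI I)
    fix i j assume "i \<in> I" "j \<in> I"
    then show "AE w in PiM I (\<lambda>_. M). i \<noteq> j \<longrightarrow> g (w i) \<noteq> g (w j)"
      using ne[of i j] by (cases "i = j") auto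
  qed
  then show ?thesis by eventually_elim (auto simp: inj_on_def)
qed

text \<open>An order isomorphism preserves the number of predecessors.\<close>

lemma first_image:
  assumes \<sigma>: "bij_betw \<sigma> I I" and r: "\<And>i j. i \<in> I \<Longrightarrow> j \<in> I \<Longrightarrow> r' i j \<longleftrightarrow> r (\<sigma> i) (\<sigma> j)"
  shows "first k I r = \<sigma> ` first k I r'"
proof -
  have c: "card {j \<in> I. r j (\<sigma> i)} = card {j \<in> I. r' j i}" if "i \<in> I" for i
  proof -
    have "{j \<in> I. r j (\<sigma> i)} = \<sigma> ` {j \<in> I. r' j i}"
    proof (intro set_eqI iffI)
      fix j assume j: "j \<in> {j \<in> I. r j (\<sigma> i)}"
      then obtain l where "l \<in> I" "j = \<sigma> l" using \<sigma> by (auto simp: bij_betw_def)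
      then show "j \<in> \<sigma> ` {j \<in> I. r' j i}" using j r[of l i] that by auto
    qed (use \<sigma> r that in \<open>auto simp: bij_betw_def\<close>)
    moreover have "inj_on \<sigma> {j \<in> I. r' j i}"
      using \<sigma>[THEN bij_betw_imp_inj_on] by (rule inj_on_subset) auto
    ultimately show ?thesis by (simp add: card_image)
  qed
  show ?thesis
  proof (intro set_eqI iffI)
    fix j assume j: "j \<in> first k I r"
    then obtain l where "l \<in> I" "j = \<sigma> l" using \<sigma> first_subset by (force simp: bij_betw_def)
    then show "j \<in> \<sigma> ` first k I r'" using j c[of l] by (auto simp: first_def)
  next
    fix j assume "j \<in> \<sigma> ` first k I r'"
    then show "j \<in> first k I r" using c \<sigma> by (auto simp: first_def bij_betw_def)
  qed
qed

lemma measurable_mem_first: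
  fixes I :: "nat set"
  assumes [measurable]: "\<And>j. j \<in> I \<Longrightarrow> Measurable.pred N (\<lambda>w. R w j i)"
  shows "Measurable.pred N (\<lambda>w. i \<in> first k I (R w))"
proof (cases "i \<in> I")
  case True
  have "{w \<in> space N. j \<in> {j \<in> I. R w j i}} \<in> sets N" for j
    by (cases "j \<in> I") auto
  then have [measurable]: "(\<lambda>w. card {j \<in> I. R w j i}) \<in> measurable N (count_space UNIV)"
    by (rule measurable_card)
  show ?thesis using True unfolding first_def by simp
qed (simp add: first_def)

lemma pred_lexicographic:
  fixes f g :: "'w \<Rightarrow> real"
  assumes [measurable]: "f \<in> borel_measurable N" "g \<in> borel_measurable N"
  shows "Measurable.pred N (\<lambda>w. f w < g w \<or> f w = g w \<and> c)"
  by measurable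

text \<open>The random index set is removed by summing over all of \<open>I\<close> with the
  indicator of selection.\<close>

lemma borel_measurable_sum_first:
  fixes I :: "nat set" and y :: "'w \<Rightarrow> nat \<Rightarrow> real"
  assumes I: "finite I"
    and R: "\<And>i j. i \<in> I \<Longrightarrow> j \<in> I \<Longrightarrow> Measurable.pred N (\<lambda>w. R w i j)"
    and y[measurable]: "\<And>i. i \<in> I \<Longrightarrow> (\<lambda>w. y w i) \<in> borel_measurable N"
  shows "(\<lambda>w. \<Sum>i\<in>first k I (R w). y w i) \<in> borel_measurable N"
proof -
  have [measurable]: "Measurable.pred N (\<lambda>w. i \<in> first k I (R w))" if "i \<in> I" for i
    using that by (intro measurable_mem_first R)
  have "(\<Sum>i\<in>first k I (R w). y w i) = (\<Sum>i\<in>I. if i \<in> first k I (R w) then y w i else 0)" for w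
    using I first_subset[of k I "R w"] by (simp add: sum.If_cases Int_absorb1)
  moreover have "(\<lambda>w. \<Sum>i\<in>I. if i \<in> first k I (R w) then y w i else 0) \<in> borel_measurable N"
    by measurable
  ultimately show ?thesis by simp
qed

text \<open>Labels enter through the indicator of label 1, because
  \<open>vote_anticoncentration\<close> asks for values in {0, 1} everywhere, whereas the labels of
  a sample have them only almost surely.\<close>

lemma knn_vote_anticoncentration:
  fixes P :: "('a::{metric_space,second_countable_topology} \<times> real) measure" and x :: 'a
  assumes P: "prob_space P" and sets_P: "sets P = sets borel"
    and I: "finite I" "k \<le> card I" and k: "k \<ge> 1"
  shows "measure (PiM I (\<lambda>_. P)) {z \<in> space (PiM I (\<lambda>_. P)).
      \<bar>(\<Sum>i \<in> knn k I (\<lambda>i. fst (z i)) x. of_bool (snd (z i) = 1)) - real k / 2\<bar> \<le> 1} \<le> 4 / sqrt (real k)"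
proof -
  have sP[measurable_cong]: "sets P = sets ((borel :: 'a measure) \<Otimes>\<^sub>M (borel :: real measure))" using sets_P unfolding borel_prod .
  \<comment> \<open>For fixed distinct \<open>u\<close>, breaking ties by \<open>u\<close> amounts to permuting the sample, which preserves its law.\<close>
  define U where "U = uniform_measure lborel {0..1::real}"
  have sU[measurable_cong]: "sets U = sets borel" by (simp add: U_def)
  have U: "prob_space U" unfolding U_def by (rule prob_space_uniform_measure) auto
  define M where "M = P \<Otimes>\<^sub>M U"
  have [measurable_cong]: "sets M = sets (((borel :: 'a measure) \<Otimes>\<^sub>M (borel :: real measure)) \<Otimes>\<^sub>M (borel :: real measure))"
    unfolding M_def by (intro sets_pair_measure_cong sP sU)
  have M: "prob_space M" unfolding M_def by (intro prob_space_pair P U)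
  define y :: "('a \<times> real) \<times> real \<Rightarrow> real" where "y p = of_bool (snd (fst p) = 1)" for p
  define r :: "('a \<times> real) \<times> real \<Rightarrow> ('a \<times> real) \<times> real \<Rightarrow> bool" where
    "r p q \<longleftrightarrow> dist (fst (fst p)) x < dist (fst (fst q)) x \<or>
      (dist (fst (fst p)) x = dist (fst (fst q)) x \<and> snd p < snd q)" for p q
  have y_meas[measurable]: "y \<in> borel_measurable M" unfolding y_def by measurable
  have r_meas[measurable]: "Measurable.pred (M \<Otimes>\<^sub>M M) (\<lambda>p. r (fst p) (snd p))"
    unfolding r_def by measurable
  have noatom: "AE v in M. snd v \<noteq> c" for c
  proof -
    have *: "AE u in U. u \<noteq> c"
      unfolding U_def using AE_lborel_singleton[of c] by (intro AE_uniform_measureI) auto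
    have snd: "distr M U snd = U"
    proof -
      interpret P: prob_space P by fact
      interpret U: prob_space U by fact
      interpret PU: pair_prob_space P U ..
      show ?thesis
      proof (rule measure_eqI)
        fix A assume "A \<in> sets (distr M U snd)"
        then have A: "A \<in> sets U" by simp
        have "snd -` A \<inter> space M = space P \<times> A"
          using sets.sets_into_space[OF A] by (auto simp: M_def space_pair_measure)
        then show "emeasure (distr M U snd) A = emeasure U A"
          using A by (simp add: M_def emeasure_distr U.emeasure_pair_measure_Times P.emeasure_space_1)
      qed simp
    qed
    have "AE u in distr M U snd. u \<noteq> c" unfolding snd by (rule *)
    then show ?thesis by (rule AE_distrD[rotated]) (simp add: M_def)
  qed
  have "AE w in PiM I (\<lambda>_. M). inj_on (\<lambda>i. snd (w i)) I"
    by (rule AE_PiM_inj_on[OF M _ noatom I(1)]) measurable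
  then have r_AE: "AE w in PiM I (\<lambda>_. M). strict_order_on I (\<lambda>i j. r (w i) (w j))"
  proof eventually_elim
    case (elim w)
    show ?case
      unfolding strict_order_on_def
    proof (intro conjI ballI impI)
      show "\<not> r (w i) (w i)" for i by (simp add: r_def)
      show "r (w i) (w l)" if "r (w i) (w j)" "r (w j) (w l)" for i j l
        using that by (auto simp: r_def)
      show "r (w i) (w j) \<or> r (w j) (w i)" if "i \<in> I" "j \<in> I" "i \<noteq> j" for i j
      proof -
        have "snd (w i) \<noteq> snd (w j)" using elim that by (auto simp: inj_on_def)
        then show ?thesis
          by (cases "dist (fst (fst (w i))) x" "dist (fst (fst (w j))) x" rule: linorder_cases)
            (auto simp: r_def)
      qed
    qed
  qed
  define E where "E = {w \<in> space (PiM I (\<lambda>_. M)).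
      \<bar>(\<Sum>i \<in> first k I (\<lambda>i j. r (w i) (w j)). y (w i)) - real k / 2\<bar> \<le> 1}"
  have bound: "measure (PiM I (\<lambda>_. M)) E \<le> 4 / sqrt (real k)"
    unfolding E_def by (rule vote_anticoncentration[OF M y_meas _ r_meas I k r_AE]) (simp add: y_def)
  let ?P = "PiM I (\<lambda>_. P)" and ?U = "PiM I (\<lambda>_. U)"
  define E0 where "E0 = {z \<in> space ?P.
      \<bar>(\<Sum>i \<in> first k I (nearer (\<lambda>i. fst (z i)) x). of_bool (snd (z i) = 1)) - real k / 2\<bar> \<le> 1}"
  have dI: "(\<lambda>z. dist (fst (z i)) x) \<in> borel_measurable ?P" if "i \<in> I" for i
    by (rule measurable_compose[where N=P and f="\<lambda>z. z i"]) (use that in simp, measurable)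
  have lI: "(\<lambda>z. of_bool (snd (z i) = 1) :: real) \<in> borel_measurable ?P" if "i \<in> I" for i
    by (rule measurable_compose[where N=P and f="\<lambda>z. z i"]) (use that in simp, measurable)
  have E0: "E0 \<in> sets ?P"
  proof -
    have "Measurable.pred ?P (\<lambda>z. nearer (\<lambda>i. fst (z i)) x i j)" if "i \<in> I" "j \<in> I" for i j
      unfolding nearer_def by (rule pred_lexicographic) (use that dI in auto)
    then have [measurable]: "(\<lambda>z. \<Sum>i \<in> first k I (nearer (\<lambda>i. fst (z i)) x). of_bool (snd (z i) = 1) :: real) \<in> borel_measurable ?P"
      by (rule borel_measurable_sum_first[OF I(1) _ lI])
    show ?thesis unfolding E0_def by measurable
  qed
  have rI: "Measurable.pred (PiM I (\<lambda>_. M)) (\<lambda>w. r (w i) (w j))" if "i \<in> I" "j \<in> I" for i j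
    using measurable_compose[where f="\<lambda>w. (w i, w j)" and M="PiM I (\<lambda>_. M)", OF _ r_meas] that by simp
  have yI: "(\<lambda>w. y (w i)) \<in> borel_measurable (PiM I (\<lambda>_. M))" if "i \<in> I" for i
    by (rule measurable_compose[where N=M and f="\<lambda>w. w i", OF _ y_meas]) (simp add: that)
  have E: "E \<in> sets (PiM I (\<lambda>_. M))"
  proof -
    have [measurable]: "(\<lambda>w. \<Sum>i \<in> first k I (\<lambda>i j. r (w i) (w j)). y (w i)) \<in> borel_measurable (PiM I (\<lambda>_. M))"
      by (rule borel_measurable_sum_first[OF I(1) rI yI])
    show ?thesis unfolding E_def by measurable
  qed
  have slice: "emeasure ?P {z \<in> space ?P. (\<lambda>i\<in>I. (z i, u i)) \<in> E} = emeasure ?P E0"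
    if u: "u \<in> space ?U" "inj_on u I" for u
  proof -
    have "strict_order_on I (\<lambda>i j. u i < u j)"
      unfolding strict_order_on_def
    proof (intro conjI ballI impI)
      show "u i < u j \<or> u j < u i" if "i \<in> I" "j \<in> I" "i \<noteq> j" for i j
        using inj_onD[OF u(2) _ that(1,2)] that(3) by linarith
    qed auto
    moreover have "strict_order_on I (\<lambda>i j. i < (j::nat))"
      unfolding strict_order_on_def by auto
    \<comment> \<open>Position \<open>i\<close> of the rearranged sample holds observation
      \<open>\<sigma> i\<close>. As \<open>\<sigma>\<close> carries the order of the indices to that
      of \<open>u\<close>, ties by index after the rearrangement are ties by \<open>u\<close> before
      it.\<close>
    ultimately obtain \<sigma> where \<sigma>: "bij_betw \<sigma> I I"
      and \<sigma>_less: "\<And>i j. i \<in> I \<Longrightarrow> j \<in> I \<Longrightarrow> i < j \<longleftrightarrow> u (\<sigma> i) < u (\<sigma> j)"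
      using strict_order_on_isomorphic[OF I(1)] by blast
    have \<sigma>I: "\<sigma> i \<in> I" if "i \<in> I" for i using \<sigma> that by (auto simp: bij_betw_def)
    let ?t = "\<lambda>z. \<lambda>i\<in>I. z (\<sigma> i)"
    have t[measurable]: "?t \<in> ?P \<rightarrow>\<^sub>M ?P" by (rule measurable_restrict) (simp add: \<sigma>I)
    have "distr ?P ?P ?t = ?P"
      using distr_PiM_reindex[of I "\<lambda>_. P" \<sigma> I] P \<sigma> \<sigma>I by (auto simp: bij_betw_def)
    then have "emeasure ?P E0 = emeasure (distr ?P ?P ?t) E0" by simp
    also have "\<dots> = emeasure ?P (?t -` E0 \<inter> space ?P)" by (rule emeasure_distr[OF t E0])
    also have "?t -` E0 \<inter> space ?P = {z \<in> space ?P. (\<lambda>i\<in>I. (z i, u i)) \<in> E}"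
    proof -
      have "?t z \<in> E0 \<longleftrightarrow> (\<lambda>i\<in>I. (z i, u i)) \<in> E" if z: "z \<in> space ?P" for z
      proof -
        let ?w = "\<lambda>i\<in>I. (z i, u i)"
        let ?F = "first k I (nearer (\<lambda>i. fst (?t z i)) x)"
        have im: "first k I (\<lambda>i j. r (?w i) (?w j)) = \<sigma> ` ?F"
          by (rule first_image[OF \<sigma>]) (auto simp: nearer_def r_def \<sigma>I \<sigma>_less)
        have FI: "?F \<subseteq> I" by (rule first_subset)
        have inj: "inj_on \<sigma> ?F" using bij_betw_imp_inj_on[OF \<sigma>] FI by (rule inj_on_subset)
        have "(\<Sum>i \<in> first k I (\<lambda>i j. r (?w i) (?w j)). y (?w i)) = (\<Sum>i\<in>?F. y (?w (\<sigma> i)))"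
          unfolding im by (rule sum.reindex[OF inj, unfolded comp_def])
        also have "\<dots> = (\<Sum>i\<in>?F. of_bool (snd (?t z i) = 1))"
          by (rule sum.cong[OF refl]) (use FI \<sigma>I in \<open>auto simp: y_def\<close>)
        finally have eq: "(\<Sum>i \<in> first k I (\<lambda>i j. r (?w i) (?w j)). y (?w i)) =
            (\<Sum>i\<in>?F. of_bool (snd (?t z i) = 1))" .
        have "?t z \<in> space ?P" using measurable_space[OF t z] .
        moreover have "?w \<in> space (PiM I (\<lambda>_. M))"
          using z u(1) by (auto simp: space_PiM M_def space_pair_measure PiE_iff)
        ultimately show ?thesis unfolding E0_def E_def mem_Collect_eq eq by simp
      qed
      then show ?thesis by auto
    qed
    finally show ?thesis by simp
  qed
  interpret PP: prob_space ?P by (rule prob_space_PiM) (rule P)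
  interpret UU: prob_space ?U by (rule prob_space_PiM) (rule U)
  interpret PU: pair_prob_space ?P ?U ..
  interpret MM: prob_space "PiM I (\<lambda>_. M)" by (rule prob_space_PiM) (rule M)
  let ?T = "\<lambda>(z, u). \<lambda>i\<in>I. (z i, u i)"
  have T[measurable]: "?T \<in> ?P \<Otimes>\<^sub>M ?U \<rightarrow>\<^sub>M PiM I (\<lambda>_. M)"
    unfolding split_beta M_def by (rule measurable_restrict) measurable
  have inj_AE: "AE u in ?U. inj_on u I"
  proof -
    have "AE u in U. u \<noteq> c" for c
      unfolding U_def using AE_lborel_singleton[of c] by (intro AE_uniform_measureI) auto
    then show ?thesis using AE_PiM_inj_on[OF U, of "\<lambda>u. u"] I by simp
  qed
  have "emeasure (PiM I (\<lambda>_. M)) E = emeasure (distr (?P \<Otimes>\<^sub>M ?U) (PiM I (\<lambda>_. M)) ?T) E"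
    using distr_pair_PiM[of I "\<lambda>_. P" "\<lambda>_. U"] I P U by (simp add: M_def)
  also have "\<dots> = emeasure (?P \<Otimes>\<^sub>M ?U) (?T -` E \<inter> space (?P \<Otimes>\<^sub>M ?U))"
    by (rule emeasure_distr[OF T E])
  \<comment> \<open>Integrating over \<open>u\<close> last is what allows \<open>\<sigma>\<close>,
    which depends on \<open>u\<close>, to be used: almost every \<open>u\<close> is injective on
    \<open>I\<close>, and its slice has the probability of \<open>E0\<close>.\<close>
  also have "\<dots> = (\<integral>\<^sup>+ u. emeasure ?P ((\<lambda>z. (z, u)) -` (?T -` E \<inter> space (?P \<Otimes>\<^sub>M ?U))) \<partial>?U)"
    by (rule PU.emeasure_pair_measure_alt2) (rule measurable_sets[OF T E])
  also have "\<dots> = (\<integral>\<^sup>+ u. emeasure ?P E0 \<partial>?U)"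
  proof (rule nn_integral_cong_AE)
    show "AE u in ?U. emeasure ?P ((\<lambda>z. (z, u)) -` (?T -` E \<inter> space (?P \<Otimes>\<^sub>M ?U))) = emeasure ?P E0"
      using inj_AE AE_space
    proof eventually_elim
      case (elim u)
      have "(\<lambda>z. (z, u)) -` (?T -` E \<inter> space (?P \<Otimes>\<^sub>M ?U)) = {z \<in> space ?P. (\<lambda>i\<in>I. (z i, u i)) \<in> E}"
        using elim by (auto simp: space_pair_measure)
      then show ?case using slice[OF elim(2,1)] by simp
    qed
  qed
  also have "\<dots> = emeasure ?P E0" by (simp add: UU.emeasure_space_1)
  finally have "measure (PiM I (\<lambda>_. M)) E = measure ?P E0" by (simp add: measure_def)
  then show ?thesis using bound by (simp add: E0_def knn_first)
qed

subsection \<open>The Efron--Stein inequality\<close>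

lemma (in prob_space) integrable_bounded:
  fixes g :: "'a \<Rightarrow> real"
  assumes "g \<in> borel_measurable M" "\<And>x. x \<in> space M \<Longrightarrow> \<bar>g x\<bar> \<le> c"
  shows "integrable M g"
  using assms by (intro integrable_const_bound[where B=c]) auto

text \<open>
  Sample and independent copy are encoded as one family: \<open>w (l, False)\<close> belongs to the sample and
  \<open>w (l, True)\<close> to the copy.
\<close>

lemma efron_stein:
  fixes f :: "('i \<Rightarrow> 'b) \<Rightarrow> real"
  assumes I: "finite I" and \<mu>: "\<And>i. prob_space (\<mu> i)"
    and f[measurable]: "f \<in> borel_measurable (PiM I \<mu>)"
    and bd: "\<And>u. u \<in> space (PiM I \<mu>) \<Longrightarrow> \<bar>f u\<bar> \<le> c"
  shows "(\<integral>u. (f u - (\<integral>v. f v \<partial>PiM I \<mu>))\<^sup>2 \<partial>PiM I \<mu>) \<le>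
    1/2 * (\<Sum>i\<in>I. \<integral>w. (f (\<lambda>l\<in>I. w (l, False)) - f (\<lambda>l\<in>I. w (l, l = i)))\<^sup>2
      \<partial>PiM (I \<times> UNIV) (\<lambda>(l, _). \<mu> l))"
proof -
  let ?Q = "PiM I \<mu>" and ?K = "I \<times> (UNIV :: bool set)"
  define \<nu> where "\<nu> = (\<lambda>(l, _::bool). \<mu> l)"
  let ?W = "PiM ?K \<nu>"
  have \<nu>: "prob_space (\<nu> p)" for p using \<mu> by (cases p) (simp add: \<nu>_def)
  interpret Q: prob_space ?Q by (rule prob_space_PiM) (rule \<mu>)
  interpret W: prob_space ?W by (rule prob_space_PiM) (rule \<nu>)
  \<comment> \<open>\<open>\<pi> A\<close> takes the coordinates in \<open>A\<close> from the copy
    and the others from the sample. \<open>sw A\<close> exchanges sample and copy on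
    \<open>A\<close>; it preserves the law and turns \<open>g B\<close> into \<open>g\<close> of the
    symmetric difference of \<open>A\<close> and \<open>B\<close>.\<close>
  define \<pi> where "\<pi> A w = (\<lambda>l\<in>I. w (l, l \<in> A))" for A :: "'i set" and w :: "'i \<times> bool \<Rightarrow> 'b"
  define g where "g A w = f (\<pi> A w)" for A w
  define sw where "sw A w = (\<lambda>p\<in>?K. w (fst p, (snd p) \<noteq> (fst p \<in> A)))" for A :: "'i set" and w :: "'i \<times> bool \<Rightarrow> 'b"
  have \<pi>[measurable]: "\<pi> A \<in> ?W \<rightarrow>\<^sub>M ?Q" for A
    unfolding \<pi>_def
  proof (rule measurable_restrict)
    fix l assume "l \<in> I"
    then show "(\<lambda>w. w (l, l \<in> A)) \<in> ?W \<rightarrow>\<^sub>M \<mu> l"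
      using measurable_component_singleton[of "(l, l \<in> A)" ?K \<nu>] by (simp add: \<nu>_def)
  qed
  have g[measurable]: "g A \<in> borel_measurable ?W" for A unfolding g_def by measurable
  have gbd: "\<bar>g A w\<bar> \<le> c" if "w \<in> space ?W" for A w
    unfolding g_def by (rule bd) (rule measurable_space[OF \<pi> that])
  have intg: "integrable ?W (\<lambda>w. g A w * g B w)" for A B
    by (rule W.integrable_bounded[where c="c * c"])
      (auto simp: abs_mult intro!: mult_mono gbd order_trans[OF abs_ge_zero gbd])
  have intd: "integrable ?W (\<lambda>w. (g A w - g B w)\<^sup>2)" for A B
  proof -
    have "(\<lambda>w. (g A w - g B w)\<^sup>2) = (\<lambda>w. g A w * g A w - 2 * (g A w * g B w) + g B w * g B w)"
      by (simp add: fun_eq_iff power2_eq_square algebra_simps)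
    then show ?thesis using intg by simp
  qed
  have sw: "distr ?W ?W (sw A) = ?W" for A
  proof -
    let ?s = "\<lambda>p::'i \<times> bool. (fst p, (snd p) \<noteq> (fst p \<in> A))"
    have eq: "(\<lambda>p. \<nu> (?s p)) = \<nu>" by (auto simp: \<nu>_def fun_eq_iff)
    have "inj_on ?s ?K" by (auto simp: inj_on_def)
    moreover have "?s \<in> ?K \<rightarrow> ?K" by auto
    ultimately have "distr ?W (PiM ?K (\<lambda>p. \<nu> (?s p))) (\<lambda>w. \<lambda>p\<in>?K. w (?s p)) = PiM ?K (\<lambda>p. \<nu> (?s p))"
      by (intro distr_PiM_reindex \<nu>)
    then show ?thesis unfolding eq sw_def .
  qed
  have swm[measurable]: "sw A \<in> ?W \<rightarrow>\<^sub>M ?W" for A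
    unfolding sw_def
  proof (rule measurable_restrict)
    fix p assume "p \<in> ?K"
    then show "(\<lambda>w. w (fst p, (snd p) \<noteq> (fst p \<in> A))) \<in> ?W \<rightarrow>\<^sub>M \<nu> p"
      using measurable_component_singleton[of "(fst p, (snd p) \<noteq> (fst p \<in> A))" ?K \<nu>]
      by (cases p) (auto simp: \<nu>_def)
  qed
  have g_sw: "g B (sw A w) = g ((B - A) \<union> (A - B)) w" for A B w
  proof -
    have "\<pi> B (sw A w) = \<pi> ((B - A) \<union> (A - B)) w"
      by (auto simp: \<pi>_def sw_def fun_eq_iff restrict_def intro!: arg_cong[where f=w])
    then show ?thesis by (simp add: g_def)
  qed
  have int_sw: "(\<integral>w. h (sw A w) \<partial>?W) = (\<integral>w. h w \<partial>?W)" if "h \<in> borel_measurable ?W" for h :: "_ \<Rightarrow> real" and A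
    using integral_distr[OF swm that, of A] unfolding sw by (rule sym)
  have amgm: "x * y \<le> 1/2 * x\<^sup>2 + 1/2 * y\<^sup>2" for x y :: real
    using sum_squares_bound[of x y] by simp
  \<comment> \<open>Exchanging coordinate \<open>i\<close> swaps \<open>A\<close> with
    \<open>insert i A\<close> and {} with \<open>{i}\<close>. Averaging the two forms of the
    integral gives half the integral of the product of two differences. The inequality x y \<le>
    (x^2 + y^2) / 2 separates them, and exchanging \<open>A\<close> shows that both squares have the
    same integral.\<close>
  have step: "(\<integral>w. g {} w * (g A w - g (insert i A) w) \<partial>?W) \<le> 1/2 * (\<integral>w. (g {} w - g {i} w)\<^sup>2 \<partial>?W)"
    if i: "i \<notin> A" for i A
  proof -
    have e: "({} - {i}) \<union> ({i} - {}) = {i}" "(A - {i}) \<union> ({i} - A) = insert i A"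
      "(insert i A - {i}) \<union> ({i} - insert i A) = A" "({} - A) \<union> (A - {}) = A"
      "({i} - A) \<union> (A - {i}) = insert i A"
      using i by auto
    have s1: "(\<integral>w. g {} w * (g A w - g (insert i A) w) \<partial>?W) = (\<integral>w. g {i} w * (g (insert i A) w - g A w) \<partial>?W)"
      using int_sw[of "\<lambda>w. g {} w * (g A w - g (insert i A) w)" "{i}"] by (simp only: g_sw e) simp
    have s2: "(\<integral>w. (g {} w - g {i} w)\<^sup>2 \<partial>?W) = (\<integral>w. (g A w - g (insert i A) w)\<^sup>2 \<partial>?W)"
      using int_sw[of "\<lambda>w. (g {} w - g {i} w)\<^sup>2" A] by (simp only: g_sw e) simp
    have i1: "integrable ?W (\<lambda>w. g B w * (g C w - g D w))" for B C D
      using intg by (simp add: right_diff_distrib)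
    have "2 * (\<integral>w. g {} w * (g A w - g (insert i A) w) \<partial>?W) =
        (\<integral>w. g {} w * (g A w - g (insert i A) w) \<partial>?W) + (\<integral>w. g {i} w * (g (insert i A) w - g A w) \<partial>?W)"
      using s1 by simp
    also have "\<dots> = (\<integral>w. g {} w * (g A w - g (insert i A) w) + g {i} w * (g (insert i A) w - g A w) \<partial>?W)"
      by (rule Bochner_Integration.integral_add[symmetric]) (rule i1)+
    also have "\<dots> \<le> (\<integral>w. 1/2 * (g {} w - g {i} w)\<^sup>2 + 1/2 * (g A w - g (insert i A) w)\<^sup>2 \<partial>?W)"
    proof (rule integral_mono)
      fix w
      have "(g {} w - g {i} w) * (g A w - g (insert i A) w) \<le> 1/2 * (g {} w - g {i} w)\<^sup>2 + 1/2 * (g A w - g (insert i A) w)\<^sup>2"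
        by (rule amgm)
      then show "g {} w * (g A w - g (insert i A) w) + g {i} w * (g (insert i A) w - g A w)
          \<le> 1/2 * (g {} w - g {i} w)\<^sup>2 + 1/2 * (g A w - g (insert i A) w)\<^sup>2"
        by (simp add: algebra_simps)
    qed (intro Bochner_Integration.integrable_add integrable_mult_right i1 intd)+
    also have "\<dots> = (\<integral>w. 1/2 * (g {} w - g {i} w)\<^sup>2 \<partial>?W) + (\<integral>w. 1/2 * (g A w - g (insert i A) w)\<^sup>2 \<partial>?W)"
      by (rule Bochner_Integration.integral_add) (intro integrable_mult_right intd)+
    also have "\<dots> = (\<integral>w. (g {} w - g {i} w)\<^sup>2 \<partial>?W)"
      using s2 by simp
    finally show ?thesis by simp
  qed
  \<comment> \<open>The coordinates are exchanged one at a time, and the differences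
    telescope.\<close>
  have tel: "(\<integral>w. g {} w * (g {} w - g A w) \<partial>?W) \<le> 1/2 * (\<Sum>i\<in>A. \<integral>w. (g {} w - g {i} w)\<^sup>2 \<partial>?W)" if "finite A" for A
    using that
  proof (induction A)
    case (insert i A)
    have i1: "integrable ?W (\<lambda>w. g B w * (g C w - g D w))" for B C D
      using intg by (simp add: right_diff_distrib)
    have "(\<integral>w. g {} w * (g {} w - g (insert i A) w) \<partial>?W) =
        (\<integral>w. g {} w * (g {} w - g A w) + g {} w * (g A w - g (insert i A) w) \<partial>?W)"
      by (simp add: algebra_simps)
    also have "\<dots> = (\<integral>w. g {} w * (g {} w - g A w) \<partial>?W) + (\<integral>w. g {} w * (g A w - g (insert i A) w) \<partial>?W)"
      by (rule Bochner_Integration.integral_add) (rule i1)+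
    also have "\<dots> \<le> 1/2 * (\<Sum>i\<in>A. \<integral>w. (g {} w - g {i} w)\<^sup>2 \<partial>?W) + 1/2 * (\<integral>w. (g {} w - g {i} w)\<^sup>2 \<partial>?W)"
      by (intro add_mono insert.IH step insert.hyps)
    finally show ?case using insert.hyps by (simp add: algebra_simps)
  qed simp
  have distr_\<pi>: "distr ?W ?Q (\<pi> A) = ?Q" for A
  proof -
    have "distr ?W (PiM I (\<lambda>l. \<nu> (l, l \<in> A))) (\<lambda>w. \<lambda>l\<in>I. w (l, l \<in> A)) = PiM I (\<lambda>l. \<nu> (l, l \<in> A))"
      by (intro distr_PiM_reindex \<nu>) (auto simp: inj_on_def)
    moreover have "(\<lambda>l. \<nu> (l, l \<in> A)) = \<mu>" by (simp add: \<nu>_def)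
    moreover have "\<pi> A = (\<lambda>w. \<lambda>l\<in>I. w (l, l \<in> A))" by (simp add: \<pi>_def fun_eq_iff)
    ultimately show ?thesis by simp
  qed
  have int_\<pi>: "(\<integral>w. h (\<pi> A w) \<partial>?W) = (\<integral>u. h u \<partial>?Q)" if "h \<in> borel_measurable ?Q" for h :: "_ \<Rightarrow> real" and A
    using integral_distr[OF \<pi> that, of A] unfolding distr_\<pi> by (rule sym)
  let ?E = "\<integral>u. f u \<partial>?Q"
  \<comment> \<open>When all coordinates are exchanged, the two arguments of \<open>f\<close> share
    none. Hence the variance is the integral of \<open>g {} w * (g {} w - g I w)\<close>, to which
    the telescoping bound applies.\<close>
  have indep: "(\<integral>w. g {} w * g I w \<partial>?W) = ?E * ?E"
  proof -
    let ?A = "I \<times> {False}" and ?B = "I \<times> {True}"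
    interpret PP: product_prob_space \<nu> ?K by (rule product_prob_spaceI) (rule \<nu>)
    have U: "?A \<union> ?B = ?K" by (auto simp: UNIV_bool)
    have fin: "finite ?A" "finite ?B" "?A \<inter> ?B = {}" using I by auto
    have half: "(\<integral>w. f (\<lambda>l\<in>I. w (l, t)) \<partial>PiM (I \<times> {t}) \<nu>) = ?E" for t
    proof -
      have m: "(\<lambda>w. \<lambda>l\<in>I. w (l, t)) \<in> PiM (I \<times> {t}) \<nu> \<rightarrow>\<^sub>M ?Q"
      proof (rule measurable_restrict)
        fix l assume "l \<in> I"
        then show "(\<lambda>w. w (l, t)) \<in> PiM (I \<times> {t}) \<nu> \<rightarrow>\<^sub>M \<mu> l"
          using measurable_component_singleton[of "(l, t)" "I \<times> {t}" \<nu>] by (simp add: \<nu>_def)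
      qed
      have "distr (PiM (I \<times> {t}) \<nu>) (PiM I (\<lambda>l. \<nu> (l, t))) (\<lambda>w. \<lambda>l\<in>I. w (l, t)) = PiM I (\<lambda>l. \<nu> (l, t))"
        by (intro distr_PiM_reindex \<nu>) (auto simp: inj_on_def)
      then have "distr (PiM (I \<times> {t}) \<nu>) ?Q (\<lambda>w. \<lambda>l\<in>I. w (l, t)) = ?Q" by (simp add: \<nu>_def)
      then show ?thesis using integral_distr[OF m f] by simp
    qed
    have "(\<integral>w. g {} w * g I w \<partial>?W) = (\<integral>x. (\<integral>y. g {} (merge ?A ?B (x, y)) * g I (merge ?A ?B (x, y)) \<partial>PiM ?B \<nu>) \<partial>PiM ?A \<nu>)"
      using PP.product_integral_fold[OF fin(3,1,2), of "\<lambda>w. g {} w * g I w"] intg unfolding U by simp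
    also have "\<dots> = (\<integral>x. (\<integral>y. f (\<lambda>l\<in>I. x (l, False)) * f (\<lambda>l\<in>I. y (l, True)) \<partial>PiM ?B \<nu>) \<partial>PiM ?A \<nu>)"
    proof -
      have "\<pi> {} (merge ?A ?B (x, y)) = (\<lambda>l\<in>I. x (l, False))" "\<pi> I (merge ?A ?B (x, y)) = (\<lambda>l\<in>I. y (l, True))" for x y
        by (auto simp: \<pi>_def merge_def fun_eq_iff)
      then show ?thesis by (simp add: g_def)
    qed
    also have "\<dots> = ?E * ?E" by (simp add: half)
    finally show ?thesis .
  qed
  have intf: "integrable ?Q f" by (rule Q.integrable_bounded[OF f bd])
  have intff: "integrable ?Q (\<lambda>u. (f u)\<^sup>2)"
  proof (rule Q.integrable_bounded[where c="c * c"])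
    fix u assume u: "u \<in> space ?Q"
    show "\<bar>(f u)\<^sup>2\<bar> \<le> c * c"
      unfolding power2_eq_square abs_mult
      using bd[OF u] by (intro mult_mono) auto
  qed simp
  have "(\<integral>u. (f u - ?E)\<^sup>2 \<partial>?Q) = (\<integral>u. (f u)\<^sup>2 \<partial>?Q) - ?E\<^sup>2"
    by (rule Q.variance_eq[OF intf intff])
  also have "(\<integral>u. (f u)\<^sup>2 \<partial>?Q) = (\<integral>w. g {} w * g {} w \<partial>?W)"
    using int_\<pi>[of "\<lambda>u. (f u)\<^sup>2" "{}"] by (simp add: g_def power2_eq_square)
  also have "(\<integral>w. g {} w * g {} w \<partial>?W) - ?E\<^sup>2 = (\<integral>w. g {} w * (g {} w - g I w) \<partial>?W)"
    using indep intg by (simp add: power2_eq_square right_diff_distrib)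
  also have "\<dots> \<le> 1/2 * (\<Sum>i\<in>I. \<integral>w. (g {} w - g {i} w)\<^sup>2 \<partial>?W)"
    by (rule tel[OF I])
  finally show ?thesis by (simp add: g_def \<pi>_def \<nu>_def)
qed

subsection \<open>The leave-one-out estimator\<close>

text \<open>Each observation carries its coin, so that the estimator is a function of i.i.d.
  variables and a replacement renews the coin as well.\<close>

definition loo_error :: "nat \<Rightarrow> nat set \<Rightarrow> (nat \<Rightarrow> ((real^'d) \<times> real) \<times> bool) \<Rightarrow> nat \<Rightarrow> real" where
  "loo_error k I u j =
     of_bool (knn_rule k (I - {j}) (\<lambda>i. fst (u i)) (snd (u j)) (fst (fst (u j))) \<noteq> snd (fst (u j)))"

text \<open>A necessary condition for observation \<open>i\<close> to influence the prediction at
  \<open>j\<close>. It refers to one sample only, so its probability can be computed without the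
  replacement.\<close>

definition pivotal :: "nat \<Rightarrow> nat set \<Rightarrow> (nat \<Rightarrow> 'a::metric_space \<times> real) \<Rightarrow> nat \<Rightarrow> nat \<Rightarrow> bool" where
  "pivotal k I z i j \<longleftrightarrow> i \<in> knn k (I - {j}) (\<lambda>i. fst (z i)) (fst (z j)) \<and> close_vote k (I - {j}) z (fst (z j))"

definition loo_risk_joint :: "nat \<Rightarrow> nat \<Rightarrow> (nat \<Rightarrow> ((real^'d) \<times> real) \<times> bool) \<Rightarrow> real" where
  "loo_risk_joint k m u = loo_risk k m (\<lambda>i. fst (u i)) (\<lambda>i. snd (u i))"

lemma loo_risk_joint_eq: "loo_risk_joint k m u = (\<Sum>j\<in>{1..m}. loo_error k {1..m} u j) / real m"
  by (simp add: loo_risk_joint_def loo_risk_def loo_error_def)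

lemma loo_risk_joint_bounds: "\<bar>loo_risk_joint k m u\<bar> \<le> 1"
proof (cases "m = 0")
  case False
  have "0 \<le> (\<Sum>j\<in>{1..m}. loo_error k {1..m} u j)"
    by (rule sum_nonneg) (simp add: loo_error_def)
  moreover have "(\<Sum>j\<in>{1..m}. loo_error k {1..m} u j) \<le> real (card {1..m}) * 1"
    by (rule sum_bounded_above) (simp add: loo_error_def)
  ultimately show ?thesis using False by (simp add: loo_risk_joint_eq)
qed (simp add: loo_risk_joint_eq)

lemma knn_cong:
  assumes "\<And>i. i \<in> I \<Longrightarrow> x i = x' i"
  shows "knn k I x y = knn k I x' y"
  unfolding knn_first by (rule first_cong) (use assms in \<open>simp add: nearer_def\<close>)

lemma knn_subset: "knn k I x y \<subseteq> I"
  by (auto simp: knn_def)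

lemma knn_rule_cong:
  assumes "\<And>i. i \<in> I \<Longrightarrow> z i = z' i"
  shows "knn_rule k I z b y = knn_rule k I z' b y"
proof -
  have "knn k I (\<lambda>i. fst (z i)) y = knn k I (\<lambda>i. fst (z' i)) y"
    by (rule knn_cong) (simp add: assms)
  moreover have "(\<Sum>i\<in>knn k I (\<lambda>i. fst (z' i)) y. snd (z i)) = (\<Sum>i\<in>knn k I (\<lambda>i. fst (z' i)) y. snd (z' i))"
  proof (rule sum.cong[OF refl])
    fix i assume "i \<in> knn k I (\<lambda>i. fst (z' i)) y"
    then have "i \<in> I" using knn_subset by (rule subsetD[rotated])
    then show "snd (z i) = snd (z' i)" by (simp add: assms)
  qed
  ultimately show ?thesis by (simp add: knn_rule_def)
qed

lemma loo_risk_cong: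
  assumes "\<And>i. i \<in> {1..m} \<Longrightarrow> z i = z' i" "\<And>i. i \<in> {1..m} \<Longrightarrow> b i = b' i"
  shows "loo_risk k m z b = loo_risk k m z' b'"
proof -
  have "knn_rule k ({1..m} - {i}) z (b i) (fst (z i)) = knn_rule k ({1..m} - {i}) z' (b' i) (fst (z' i))"
    if "i \<in> {1..m}" for i
    using knn_rule_cong[of "{1..m} - {i}" z z' k "b i" "fst (z i)"] assms that by simp
  then show ?thesis unfolding loo_risk_def using assms by (intro arg_cong2[where f="(*)"] sum.cong) auto
qed

lemma stone_bound_cong:
  assumes "\<And>i. i \<in> I \<Longrightarrow> x i = x' i"
  shows "stone_bound \<gamma> I x = stone_bound \<gamma> I x'"
proof -
  have "{j \<in> I - {i}. i \<in> knn k (I - {j}) x (x j)} = {j \<in> I - {i}. i \<in> knn k (I - {j}) x' (x' j)}" for i k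
    using assms knn_cong[of "I - {j}" x x' k for j] by auto
  then show ?thesis by (simp add: stone_bound_def)
qed

text \<open>Of two points, each is the nearest neighbour of the other. They may coincide, since a
  tie would need two distances from the same point. The lower bound absorbs additive constants at
  the end.\<close>

lemma stone_constant_ge_1:
  assumes "stone_constant TYPE('d::finite) \<gamma>"
  shows "\<gamma> \<ge> 1"
proof -
  let ?x = "\<lambda>_::nat. 0 :: real^'d"
  have st: "stone_bound \<gamma> {0, 1} ?x"
    by (rule assms[unfolded stone_constant_def, rule_format]) (auto simp: inj_on_def)
  have "real (card {j \<in> {0, 1} - {0::nat}. 0 \<in> knn 1 ({0, 1} - {j}) ?x (?x j)}) \<le> real 1 * \<gamma>"
    by (rule st[unfolded stone_bound_def, rule_format]) simp_all
  moreover have "{j \<in> {0, 1} - {0::nat}. 0 \<in> knn 1 ({0, 1} - {j}) ?x (?x j)} = {1}"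
    by (auto simp: knn_def nearer_def)
  ultimately show ?thesis by simp
qed

text \<open>For \<open>j\<close> different from \<open>i\<close>, the query point, the label and the
  coin are unchanged, so only the vote matters. The strict inequality \<open>k < card I\<close>
  leaves at least \<open>k\<close> points once \<open>j\<close> is removed.\<close>

lemma loo_error_replace:
  fixes u u' :: "nat \<Rightarrow> ((real^'d) \<times> real) \<times> bool"
  assumes I: "finite I" and k: "k \<ge> 1" "k < card I" and i: "i \<in> I" and j: "j \<in> I" "j \<noteq> i"
    and uu: "\<And>l. l \<in> I \<Longrightarrow> l \<noteq> i \<Longrightarrow> u' l = u l"
    and lab: "\<And>l. l \<in> I \<Longrightarrow> snd (fst (u l)) \<in> {0, 1}" "\<And>l. l \<in> I \<Longrightarrow> snd (fst (u' l)) \<in> {0, 1}"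
  shows "\<bar>loo_error k I u j - loo_error k I u' j\<bar>
    \<le> of_bool (pivotal k I (\<lambda>l. fst (u l)) i j) + of_bool (pivotal k I (\<lambda>l. fst (u' l)) i j)"
proof (cases "loo_error k I u j = loo_error k I u' j")
  case False
  have uj: "u' j = u j" using uu j by simp
  have "knn_rule k (I - {j}) (\<lambda>i. fst (u i)) (snd (u j)) (fst (fst (u j))) \<noteq>
      knn_rule k (I - {j}) (\<lambda>i. fst (u' i)) (snd (u j)) (fst (fst (u j)))"
    using False unfolding loo_error_def uj by auto
  then have "i \<in> knn k (I - {j}) (\<lambda>l. fst (fst (u l))) (fst (fst (u j))) \<and> close_vote k (I - {j}) (\<lambda>l. fst (u l)) (fst (fst (u j))) \<or>
      i \<in> knn k (I - {j}) (\<lambda>l. fst (fst (u' l))) (fst (fst (u j))) \<and> close_vote k (I - {j}) (\<lambda>l. fst (u' l)) (fst (fst (u j)))"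
    using I k i j uu lab by (intro knn_rule_replace) auto
  then have "pivotal k I (\<lambda>l. fst (u l)) i j \<or> pivotal k I (\<lambda>l. fst (u' l)) i j"
    by (simp add: pivotal_def uj)
  then have "1 \<le> of_bool (pivotal k I (\<lambda>l. fst (u l)) i j) + (of_bool (pivotal k I (\<lambda>l. fst (u' l)) i j) :: real)"
    by auto
  moreover have "\<bar>loo_error k I u j - loo_error k I u' j\<bar> \<le> 1" by (simp add: loo_error_def)
  ultimately show ?thesis by linarith
qed simp

lemma sum_of_bool_mem: "finite A \<Longrightarrow> (\<Sum>j\<in>A. of_bool (j \<in> N)) = real (card (A \<inter> N))"
  by (induction A rule: finite_induct) (auto simp: Int_insert_left)

text \<open>The count over predictions for a fixed observation: closeness of the vote is discarded,
  and Stone's lemma bounds how often \<open>i\<close> is a neighbour.\<close>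

lemma sum_pivotal_le_stone:
  fixes z :: "nat \<Rightarrow> 'a::metric_space \<times> real"
  assumes I: "finite I" and k: "k \<ge> 1" and i: "i \<in> I" and st: "stone_bound \<gamma> I (\<lambda>l. fst (z l))"
  shows "(\<Sum>j\<in>I - {i}. of_bool (pivotal k I z i j)) \<le> real k * \<gamma>"
proof -
  let ?N = "{j \<in> I - {i}. i \<in> knn k (I - {j}) (\<lambda>l. fst (z l)) (fst (z j))}"
  have "(\<Sum>j\<in>I - {i}. of_bool (pivotal k I z i j)) \<le> (\<Sum>j\<in>I - {i}. of_bool (j \<in> ?N) :: real)"
    by (rule sum_mono) (auto simp: pivotal_def)
  also have "\<dots> = real (card ((I - {i}) \<inter> ?N))"
    by (rule sum_of_bool_mem) (use I in simp)
  also have "(I - {i}) \<inter> ?N = ?N" by auto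
  also have "real (card ?N) \<le> real k * \<gamma>" using st k i unfolding stone_bound_def by simp
  finally show ?thesis .
qed

text \<open>The summand 1 in \<open>s\<close> pays for the term of \<open>i\<close> itself, which
  may change arbitrarily. Bounding s^2 by (1 + 2 k \<gamma>) s keeps one factor linear, and a linear
  factor needs only an expected value.\<close>

lemma loo_risk_replace:
  fixes u u' :: "nat \<Rightarrow> ((real^'d) \<times> real) \<times> bool" and k m i :: nat
  defines "I \<equiv> {1..m}"
  assumes k: "k \<ge> 1" "k < m" and i: "i \<in> I"
    and uu: "\<And>l. l \<in> I \<Longrightarrow> l \<noteq> i \<Longrightarrow> u' l = u l"
    and lab: "\<And>l. l \<in> I \<Longrightarrow> snd (fst (u l)) \<in> {0, 1}" "\<And>l. l \<in> I \<Longrightarrow> snd (fst (u' l)) \<in> {0, 1}"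
    and st: "stone_bound \<gamma> I (\<lambda>l. fst (fst (u l)))" "stone_bound \<gamma> I (\<lambda>l. fst (fst (u' l)))"
  defines "s \<equiv> 1 + (\<Sum>j\<in>I - {i}. of_bool (pivotal k I (\<lambda>l. fst (u l)) i j) + of_bool (pivotal k I (\<lambda>l. fst (u' l)) i j))"
  shows "s \<le> 1 + 2 * real k * \<gamma>"
    and "(loo_risk_joint k m u - loo_risk_joint k m u')\<^sup>2 \<le> (1 + 2 * real k * \<gamma>) * s / (real m)\<^sup>2"
proof -
  have I: "finite I" "card I = m" by (simp_all add: I_def)
  show s: "s \<le> 1 + 2 * real k * \<gamma>"
    using sum_pivotal_le_stone[OF I(1) k(1) i st(1)] sum_pivotal_le_stone[OF I(1) k(1) i st(2)]
    by (simp add: s_def sum.distrib)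
  have "\<bar>(\<Sum>j\<in>I. loo_error k I u j) - (\<Sum>j\<in>I. loo_error k I u' j)\<bar> \<le> (\<Sum>j\<in>I. \<bar>loo_error k I u j - loo_error k I u' j\<bar>)"
    unfolding sum_subtractf[symmetric] by (rule sum_abs)
  also have "\<dots> = \<bar>loo_error k I u i - loo_error k I u' i\<bar> + (\<Sum>j\<in>I - {i}. \<bar>loo_error k I u j - loo_error k I u' j\<bar>)"
    by (rule sum.remove[OF I(1) i])
  also have "\<dots> \<le> s"
    unfolding s_def
  proof (intro add_mono sum_mono)
    show "\<bar>loo_error k I u i - loo_error k I u' i\<bar> \<le> 1" by (simp add: loo_error_def)
    fix j assume "j \<in> I - {i}"
    then show "\<bar>loo_error k I u j - loo_error k I u' j\<bar> \<le>
        of_bool (pivotal k I (\<lambda>l. fst (u l)) i j) + of_bool (pivotal k I (\<lambda>l. fst (u' l)) i j)"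
      using k i uu lab I by (intro loo_error_replace) auto
  qed
  finally have "\<bar>(\<Sum>j\<in>I. loo_error k I u j) - (\<Sum>j\<in>I. loo_error k I u' j)\<bar> / real m \<le> s / real m"
    by (rule divide_right_mono) simp
  moreover have "loo_risk_joint k m u - loo_risk_joint k m u' =
      ((\<Sum>j\<in>I. loo_error k I u j) - (\<Sum>j\<in>I. loo_error k I u' j)) / real m"
    by (simp add: loo_risk_joint_eq I_def diff_divide_distrib)
  ultimately have d: "\<bar>loo_risk_joint k m u - loo_risk_joint k m u'\<bar> \<le> s / real m"
    by (simp add: abs_divide)
  have s0: "0 \<le> s" unfolding s_def by (intro add_nonneg_nonneg sum_nonneg) auto
  have "(loo_risk_joint k m u - loo_risk_joint k m u')\<^sup>2 \<le> (s / real m)\<^sup>2"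
    using power_mono[OF d, of 2] by simp
  also have "\<dots> = s * s / (real m)\<^sup>2" by (simp add: power2_eq_square)
  also have "\<dots> \<le> (1 + 2 * real k * \<gamma>) * s / (real m)\<^sup>2"
    using s s0 by (intro divide_right_mono mult_right_mono) auto
  finally show "(loo_risk_joint k m u - loo_risk_joint k m u')\<^sup>2 \<le> (1 + 2 * real k * \<gamma>) * s / (real m)\<^sup>2" .
qed

text \<open>The complementary count, over observations for a fixed prediction: a close vote has at
  most \<open>k\<close> pivotal observations, any other vote none.\<close>

lemma sum_pivotal_le:
  fixes z :: "nat \<Rightarrow> 'a::metric_space \<times> real"
  assumes I: "finite I"
  shows "(\<Sum>i\<in>I - {j}. of_bool (pivotal k I z i j)) \<le> real k * of_bool (close_vote k (I - {j}) z (fst (z j)))"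
proof (cases "close_vote k (I - {j}) z (fst (z j))")
  case True
  let ?N = "knn k (I - {j}) (\<lambda>l. fst (z l)) (fst (z j))"
  have "(\<Sum>i\<in>I - {j}. of_bool (pivotal k I z i j)) = (\<Sum>i\<in>I - {j}. of_bool (i \<in> ?N) :: real)"
    by (rule sum.cong[OF refl]) (simp add: pivotal_def True)
  also have "\<dots> = real (card ((I - {j}) \<inter> ?N))"
    by (rule sum_of_bool_mem) (use I in simp)
  also have "(I - {j}) \<inter> ?N = ?N" by (rule Int_absorb1) (rule knn_subset)
  also have "card ?N \<le> k" using I by (simp add: knn_first card_first[OF _ strict_order_nearer])
  finally show ?thesis using True by simp
qed (simp add: pivotal_def)

section \<open>Measurability of votes and errors\<close>

lemma borel_measurable_knn_vote:
  fixes z :: "'w \<Rightarrow> nat \<Rightarrow> 'a::{metric_space,second_countable_topology} \<times> real" and I :: "nat set"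
  assumes I: "finite I"
    and z: "\<And>i. i \<in> I \<Longrightarrow> (\<lambda>w. z w i) \<in> N \<rightarrow>\<^sub>M borel" and y: "y \<in> N \<rightarrow>\<^sub>M borel"
  shows "(\<lambda>w. \<Sum>i\<in>knn k I (\<lambda>i. fst (z w i)) (y w). snd (z w i)) \<in> borel_measurable N"
    and "i \<in> I \<Longrightarrow> Measurable.pred N (\<lambda>w. i \<in> knn k I (\<lambda>i. fst (z w i)) (y w))"
proof -
  have f: "(\<lambda>w. fst (z w i)) \<in> N \<rightarrow>\<^sub>M borel" and s: "(\<lambda>w. snd (z w i)) \<in> borel_measurable N" if "i \<in> I" for i
    using measurable_compose[OF z[OF that], of fst borel] measurable_compose[OF z[OF that], of snd borel]
    unfolding borel_prod[symmetric] by simp_all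
  have d: "(\<lambda>w. dist (fst (z w i)) (y w)) \<in> borel_measurable N" if "i \<in> I" for i
    using f[OF that] y by (rule borel_measurable_dist)
  have p: "Measurable.pred N (\<lambda>w. nearer (\<lambda>i. fst (z w i)) (y w) i j)" if "i \<in> I" "j \<in> I" for i j
    unfolding nearer_def by (rule pred_lexicographic) (use that d in auto)
  show "(\<lambda>w. \<Sum>i\<in>knn k I (\<lambda>i. fst (z w i)) (y w). snd (z w i)) \<in> borel_measurable N"
    unfolding knn_first by (rule borel_measurable_sum_first[OF I p s])
  show "Measurable.pred N (\<lambda>w. i \<in> knn k I (\<lambda>i. fst (z w i)) (y w))" if "i \<in> I"
    unfolding knn_first by (rule measurable_mem_first) (use p that in auto)
qed

lemma pred_close_vote:
  fixes z :: "'w \<Rightarrow> nat \<Rightarrow> 'a::{metric_space,second_countable_topology} \<times> real" and I :: "nat set"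
  assumes "finite I" "\<And>i. i \<in> I \<Longrightarrow> (\<lambda>w. z w i) \<in> N \<rightarrow>\<^sub>M borel" "y \<in> N \<rightarrow>\<^sub>M borel"
  shows "Measurable.pred N (\<lambda>w. close_vote k I (z w) (y w))"
proof -
  note [measurable] = borel_measurable_knn_vote(1)[OF assms]
  show ?thesis unfolding close_vote_def by measurable
qed

lemma measurable_fst_borel:
  fixes z :: "'w \<Rightarrow> 'a::second_countable_topology \<times> 'b::second_countable_topology"
  assumes "z \<in> N \<rightarrow>\<^sub>M borel"
  shows "(\<lambda>w. fst (z w)) \<in> N \<rightarrow>\<^sub>M borel" "(\<lambda>w. snd (z w)) \<in> N \<rightarrow>\<^sub>M borel"
  using measurable_compose[OF assms, of fst borel] measurable_compose[OF assms, of snd borel]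
  unfolding borel_prod[symmetric] by simp_all

lemma pred_pivotal:
  fixes z :: "'w \<Rightarrow> nat \<Rightarrow> 'a::{metric_space,second_countable_topology} \<times> real" and I :: "nat set"
  assumes I: "finite I" and z: "\<And>i. i \<in> I \<Longrightarrow> (\<lambda>w. z w i) \<in> N \<rightarrow>\<^sub>M borel" and ij: "i \<in> I - {j}" "j \<in> I"
  shows "Measurable.pred N (\<lambda>w. pivotal k I (z w) i j)"
proof -
  have J: "finite (I - {j})" using I by simp
  have zJ: "(\<lambda>w. z w l) \<in> N \<rightarrow>\<^sub>M borel" if "l \<in> I - {j}" for l using z that by simp
  have y: "(\<lambda>w. fst (z w j)) \<in> N \<rightarrow>\<^sub>M borel" by (rule measurable_fst_borel(1)[OF z[OF ij(2)]])
  show ?thesis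
    unfolding pivotal_def
    using borel_measurable_knn_vote(2)[OF J zJ y ij(1)] pred_close_vote[OF J zJ y]
    by (rule pred_intros_logic(3))
qed

lemma borel_measurable_vote_error:
    fixes f g :: "'w \<Rightarrow> real" and \<beta> c
  assumes [measurable]: "f \<in> borel_measurable N" "g \<in> borel_measurable N" "Measurable.pred N \<beta>"
  shows "(\<lambda>w. of_bool ((if 1 / 2 < f w / c then 1 else if f w / c < 1 / 2 then 0 else of_bool (\<beta> w)) \<noteq> g w) :: real)
      \<in> borel_measurable N"
proof -
  define h where "h w = (if 1 / 2 < f w / c then 1 else if f w / c < 1 / 2 then 0 else if \<beta> w then 1 else (0::real))" for w
  have [measurable]: "h \<in> borel_measurable N" unfolding h_def by measurable
  have "(\<lambda>w. if h w = g w then 0 else (1::real)) \<in> borel_measurable N" by measurable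
  moreover have "(\<lambda>w. of_bool ((if 1 / 2 < f w / c then 1 else if f w / c < 1 / 2 then 0 else of_bool (\<beta> w)) \<noteq> g w) :: real)
     = (\<lambda>w. if h w = g w then 0 else (1::real))" unfolding h_def of_bool_def by (rule ext) simp
  ultimately show ?thesis by simp
qed

lemma borel_measurable_loo_error:
  fixes u :: "'w \<Rightarrow> nat \<Rightarrow> ((real^'d) \<times> real) \<times> bool" and I :: "nat set"
  assumes I: "finite I" and z: "\<And>i. i \<in> I \<Longrightarrow> (\<lambda>w. fst (u w i)) \<in> N \<rightarrow>\<^sub>M borel"
    and b: "\<And>i. i \<in> I \<Longrightarrow> Measurable.pred N (\<lambda>w. snd (u w i))" and j: "j \<in> I"
  shows "(\<lambda>w. loo_error k I (u w) j) \<in> borel_measurable N"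
proof -
  have J: "finite (I - {j})" using I by simp
  have zJ: "(\<lambda>w. fst (u w l)) \<in> N \<rightarrow>\<^sub>M borel" if "l \<in> I - {j}" for l using z that by simp
  have y: "(\<lambda>w. fst (fst (u w j))) \<in> N \<rightarrow>\<^sub>M borel" by (rule measurable_fst_borel(1)[OF z[OF j]])
  have s: "(\<lambda>w. snd (fst (u w j))) \<in> borel_measurable N" by (rule measurable_fst_borel(2)[OF z[OF j]])
  show ?thesis
    unfolding loo_error_def knn_rule_def Let_def
    using borel_measurable_knn_vote(1)[OF J zJ y] s b[OF j] by (rule borel_measurable_vote_error)
qed

lemma borel_measurable_loo_risk_joint:
  fixes u :: "'w \<Rightarrow> nat \<Rightarrow> ((real^'d) \<times> real) \<times> bool"
  assumes "\<And>i. i \<in> {1..m} \<Longrightarrow> (\<lambda>w. fst (u w i)) \<in> N \<rightarrow>\<^sub>M borel"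
    and "\<And>i. i \<in> {1..m} \<Longrightarrow> Measurable.pred N (\<lambda>w. snd (u w i))"
  shows "(\<lambda>w. loo_risk_joint k m (u w)) \<in> borel_measurable N"
proof -
  have "(\<lambda>w. loo_error k {1..m} (u w) j) \<in> borel_measurable N" if "j \<in> {1..m}" for j
    by (rule borel_measurable_loo_error) (use assms that in auto)
  then show ?thesis unfolding loo_risk_joint_eq by (intro borel_measurable_divide borel_measurable_sum) auto
qed

section \<open>Probability of a close vote and expected number of pivotal pairs\<close>

lemma close_vote_probability:
  fixes P :: "('a::{metric_space,second_countable_topology} \<times> real) measure"
  assumes P: "prob_space P" and sets_P: "sets P = sets borel" and lab: "AE z in P. snd z \<in> {0, 1}"
    and I: "finite I" and k: "k \<ge> 1" "k < card I" and j: "j \<in> I"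
  shows "measure (PiM I (\<lambda>_. P)) {z \<in> space (PiM I (\<lambda>_. P)). close_vote k (I - {j}) z (fst (z j))} \<le> 4 / sqrt (real k)"
proof -
  let ?J = "I - {j}"
  let ?P = "PiM I (\<lambda>_. P)" and ?Q = "PiM ?J (\<lambda>_. P)"
  interpret PP: product_prob_space "\<lambda>_. P" I by (rule product_prob_spaceI) (rule P)
  interpret Q: prob_space ?Q by (rule prob_space_PiM) (rule P)
  have ins: "insert j ?J = I" and J: "finite ?J" "j \<notin> ?J" using I j by auto
  have comp: "(\<lambda>z. z i) \<in> PiM L (\<lambda>_. P) \<rightarrow>\<^sub>M borel" if "i \<in> L" for i L
    using measurable_component_singleton[OF that, of "\<lambda>_. P"]
    unfolding measurable_cong_sets[OF refl sets_P] .
  let ?E = "{z \<in> space ?P. close_vote k ?J z (fst (z j))}"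
  have E: "?E \<in> sets ?P"
  proof -
    have "Measurable.pred ?P (\<lambda>z. close_vote k ?J z (fst (z j)))"
      by (rule pred_close_vote[OF J(1) _ measurable_fst_borel(1)[OF comp[OF j]]]) (simp add: comp)
    then show ?thesis by (simp add: pred_def)
  qed
  have labQ: "AE z in ?Q. \<forall>i\<in>?J. snd (z i) \<in> {0, 1}"
    by (intro AE_finite_allI J AE_PiM_component P lab)
  \<comment> \<open>The query observation is frozen at \<open>v\<close>; the remaining ones are
    independent of it and form an i.i.d. sample of at least \<open>k\<close> points.\<close>
  have bound: "(\<integral>\<^sup>+ z. indicator ?E (z(j := v)) \<partial>?Q) \<le> ennreal (4 / sqrt (real k))" if v: "v \<in> space P" for v
  proof -
    let ?F = "{z \<in> space ?Q. \<bar>(\<Sum>i \<in> knn k ?J (\<lambda>i. fst (z i)) (fst v). of_bool (snd (z i) = 1)) - real k / 2\<bar> \<le> 1}"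
    have "(\<integral>\<^sup>+ z. indicator ?E (z(j := v)) \<partial>?Q) \<le> (\<integral>\<^sup>+ z. indicator ?F z \<partial>?Q)"
    proof (rule nn_integral_mono_AE)
      \<comment> \<open>Where all labels are 0 or 1, each equals the indicator of label 1, so the
        vote is unchanged.\<close>
      show "AE z in ?Q. indicator ?E (z(j := v)) \<le> (indicator ?F z :: ennreal)"
        using labQ AE_space
      proof eventually_elim
        case (elim z)
        have "knn k ?J (\<lambda>i. fst ((z(j := v)) i)) (fst v) = knn k ?J (\<lambda>i. fst (z i)) (fst v)"
          by (rule knn_cong) simp
        moreover have "(\<Sum>i \<in> knn k ?J (\<lambda>i. fst (z i)) (fst v). snd ((z(j := v)) i)) =
            (\<Sum>i \<in> knn k ?J (\<lambda>i. fst (z i)) (fst v). of_bool (snd (z i) = 1))"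
        proof (rule sum.cong[OF refl])
          fix i assume "i \<in> knn k ?J (\<lambda>i. fst (z i)) (fst v)"
          then have i: "i \<in> ?J" using knn_subset by (rule subsetD[rotated])
          then show "snd ((z(j := v)) i) = of_bool (snd (z i) = 1)" using elim(1) by auto
        qed
        ultimately have "close_vote k ?J (z(j := v)) (fst ((z(j := v)) j)) \<longleftrightarrow>
            \<bar>(\<Sum>i \<in> knn k ?J (\<lambda>i. fst (z i)) (fst v). of_bool (snd (z i) = 1)) - real k / 2\<bar> \<le> 1"
          by (simp add: close_vote_def)
        then show ?case using elim(2) by (simp add: indicator_def)
      qed
    qed
    also have "\<dots> \<le> emeasure ?Q ?F"
    proof (cases "?F \<in> sets ?Q")
      case True
      then show ?thesis by simp
    next
      case False
      have c: "(\<lambda>z. (fst (z i), of_bool (snd (z i) = 1) :: real)) \<in> ?Q \<rightarrow>\<^sub>M borel" if "i \<in> ?J" for i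
      proof -
        have [measurable]: "(\<lambda>z. fst (z i)) \<in> ?Q \<rightarrow>\<^sub>M borel" "(\<lambda>z. snd (z i)) \<in> borel_measurable ?Q"
          using measurable_fst_borel[OF comp[OF that]] by auto
        show ?thesis unfolding borel_prod[symmetric] by measurable
      qed
      \<comment> \<open>\<open>?F\<close> is the event of a close vote for the sample relabelled by
        indicators.\<close>
      have "Measurable.pred ?Q (\<lambda>z. close_vote k ?J (\<lambda>i. (fst (z i), of_bool (snd (z i) = 1))) (fst v))"
        by (rule pred_close_vote[OF J(1) c]) simp_all
      then have "?F \<in> sets ?Q" by (simp add: close_vote_def pred_def)
      with False show ?thesis by simp
    qed
    also have "\<dots> \<le> ennreal (4 / sqrt (real k))"
      unfolding Q.emeasure_eq_measure
      by (rule ennreal_leI, rule knn_vote_anticoncentration[OF P sets_P J(1) _ k(1)]) (use k I j in auto)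
    finally show ?thesis .
  qed
  have "emeasure ?P ?E = (\<integral>\<^sup>+ z. indicator ?E z \<partial>PiM (insert j ?J) (\<lambda>_. P))"
    unfolding ins using E by simp
  also have "\<dots> = (\<integral>\<^sup>+ v. (\<integral>\<^sup>+ z. indicator ?E (z(j := v)) \<partial>?Q) \<partial>P)"
    by (rule PP.product_nn_integral_insert_rev[OF J]) (unfold ins, use E in simp)
  also have "\<dots> \<le> (\<integral>\<^sup>+ v. ennreal (4 / sqrt (real k)) \<partial>P)"
    by (rule nn_integral_mono) (rule bound)
  also have "\<dots> = ennreal (4 / sqrt (real k))" by (simp add: prob_space.emeasure_space_1[OF P])
  finally show ?thesis by (simp add: PP.P.emeasure_eq_measure)
qed

text \<open>Exchanging the sums puts the prediction \<open>j\<close> outside. Its at most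
  \<open>k\<close> neighbours count only when the vote is close, and k * 4 / sqrt k = 4 sqrt
  k.\<close>

lemma sum_pivotal_expectation:
  fixes P :: "('a::{metric_space,second_countable_topology} \<times> real) measure"
  assumes P: "prob_space P" and sets_P: "sets P = sets borel" and lab: "AE z in P. snd z \<in> {0, 1}"
    and I: "finite I" and k: "k \<ge> 1" "k < card I"
  shows "(\<Sum>i\<in>I. \<Sum>j\<in>I - {i}. \<integral>z. of_bool (pivotal k I z i j) \<partial>PiM I (\<lambda>_. P)) \<le> 4 * sqrt (real k) * real (card I)"
proof -
  let ?P = "PiM I (\<lambda>_. P)"
  interpret P: prob_space ?P by (rule prob_space_PiM) (rule P)
  have comp: "(\<lambda>z. z i) \<in> ?P \<rightarrow>\<^sub>M borel" if "i \<in> I" for i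
    using measurable_component_singleton[OF that, of "\<lambda>_. P"]
    unfolding measurable_cong_sets[OF refl sets_P] .
  have m: "Measurable.pred ?P (\<lambda>z. pivotal k I z i j)" if "i \<in> I - {j}" "j \<in> I" for i j
    using pred_pivotal[OF I comp that] .
  have int: "integrable ?P (\<lambda>z. of_bool (pivotal k I z i j) :: real)" if "i \<in> I - {j}" "j \<in> I" for i j
  proof (rule P.integrable_bounded[where c=1])
    note [measurable] = m[OF that]
    show "(\<lambda>z. of_bool (pivotal k I z i j) :: real) \<in> borel_measurable ?P" by measurable
  qed simp
  have each: "(\<Sum>i\<in>I - {j}. \<integral>z. of_bool (pivotal k I z i j) \<partial>?P) \<le> 4 * sqrt (real k)" if j: "j \<in> I" for j
  proof -
    let ?E = "{z \<in> space ?P. close_vote k (I - {j}) z (fst (z j))}"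
    have "Measurable.pred ?P (\<lambda>z. close_vote k (I - {j}) z (fst (z j)))"
      by (rule pred_close_vote) (use I comp measurable_fst_borel(1)[OF comp[OF j]] in auto)
    then have E: "?E \<in> sets ?P" by (simp add: pred_def)
    have "(\<Sum>i\<in>I - {j}. \<integral>z. of_bool (pivotal k I z i j) \<partial>?P) = (\<integral>z. (\<Sum>i\<in>I - {j}. of_bool (pivotal k I z i j) :: real) \<partial>?P)"
      by (rule Bochner_Integration.integral_sum[symmetric], rule int) (use j in auto)
    also have "\<dots> \<le> (\<integral>z. real k * indicator ?E z \<partial>?P)"
    proof (rule integral_mono)
      show "integrable ?P (\<lambda>z. \<Sum>i\<in>I - {j}. of_bool (pivotal k I z i j) :: real)"
        by (rule Bochner_Integration.integrable_sum, rule int) (use j in auto)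
      show "integrable ?P (\<lambda>z. real k * indicator ?E z)"
        using E by (intro integrable_mult_right integrable_real_indicator) (auto simp: P.emeasure_eq_measure)
      fix z assume "z \<in> space ?P"
      then show "(\<Sum>i\<in>I - {j}. of_bool (pivotal k I z i j)) \<le> real k * indicator ?E z"
        using sum_pivotal_le[OF I, where z=z and k=k and j=j] by (simp add: indicator_def)
    qed
    also have "\<dots> = real k * measure ?P ?E" using E by simp
    also have "\<dots> \<le> real k * (4 / sqrt (real k))"
      by (intro mult_left_mono close_vote_probability[OF P sets_P lab I k j]) simp
    also have "\<dots> = 4 * (real k / sqrt (real k))" by simp
    also have "real k / sqrt (real k) = sqrt (real k)" by (rule real_div_sqrt) simp
    finally show ?thesis .
  qed
  have "(\<Sum>i\<in>I. \<Sum>j\<in>I - {i}. \<integral>z. of_bool (pivotal k I z i j) \<partial>?P) =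
      (\<Sum>j\<in>I. \<Sum>i\<in>I - {j}. \<integral>z. (of_bool (pivotal k I z i j) :: real) \<partial>?P)"
  proof -
    have "I - {i} = {j \<in> I. j \<noteq> i}" "I - {i} = {j \<in> I. i \<noteq> j}" for i by auto
    then show ?thesis using sum.swap_restrict[OF I I, of "\<lambda>i j. \<integral>z. of_bool (pivotal k I z i j) \<partial>?P" "\<lambda>i j. j \<noteq> i"]
      by simp
  qed
  also have "\<dots> \<le> real (card I) * (4 * sqrt (real k))" by (rule sum_bounded_above) (rule each)
  finally show ?thesis by (simp add: mult_ac)
qed

lemma pivotal_cong:
  assumes z: "\<And>l. l \<in> I \<Longrightarrow> z l = z' l" and j: "j \<in> I"
  shows "pivotal k I z i j = pivotal k I z' i j"
proof -
  have "knn k (I - {j}) (\<lambda>i. fst (z i)) (fst (z' j)) = knn k (I - {j}) (\<lambda>i. fst (z' i)) (fst (z' j))"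
    by (rule knn_cong) (simp add: z)
  moreover have "(\<Sum>i\<in>knn k (I - {j}) (\<lambda>i. fst (z' i)) (fst (z' j)). snd (z i)) =
      (\<Sum>i\<in>knn k (I - {j}) (\<lambda>i. fst (z' i)) (fst (z' j)). snd (z' i))"
  proof (rule sum.cong[OF refl])
    fix i assume "i \<in> knn k (I - {j}) (\<lambda>i. fst (z' i)) (fst (z' j))"
    then have "i \<in> I - {j}" using knn_subset by (rule subsetD[rotated])
    then show "snd (z i) = snd (z' i)" by (simp add: z)
  qed
  ultimately show ?thesis by (simp add: pivotal_def close_vote_def z[OF j])
qed

text \<open>Almost sure properties of the sample thus carry over to the sample with one observation
  renewed. The preimage of a box is a product of two boxes: one is unconstrained at
  \<open>i\<close>, the other constrained only there.\<close>

lemma distr_PiM_fun_upd: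
  assumes M: "\<And>i. prob_space (M i)" and I: "finite I" "i \<in> I"
  shows "(\<lambda>(u, u'). u(i := u' i)) \<in> PiM I M \<Otimes>\<^sub>M PiM I M \<rightarrow>\<^sub>M PiM I M"
    and "distr (PiM I M \<Otimes>\<^sub>M PiM I M) (PiM I M) (\<lambda>(u, u'). u(i := u' i)) = PiM I M"
proof -
  let ?Q = "PiM I M"
  let ?t = "\<lambda>(u, u'). u(i := u' i)"
  interpret product_prob_space M I by (rule product_prob_spaceI) (rule M)
  have sf: "sigma_finite_measure ?Q"
    by (rule prob_space_imp_sigma_finite, rule prob_space_PiM) (rule M)
  have "(\<lambda>p. \<lambda>l\<in>I. if l = i then snd p l else fst p l) \<in> ?Q \<Otimes>\<^sub>M ?Q \<rightarrow>\<^sub>M ?Q"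
  proof (rule measurable_restrict)
    fix l assume l: "l \<in> I"
    show "(\<lambda>p. if l = i then snd p l else fst p l) \<in> ?Q \<Otimes>\<^sub>M ?Q \<rightarrow>\<^sub>M M l"
      using l by (cases "l = i") simp_all
  qed
  moreover have "?t p = (\<lambda>l\<in>I. if l = i then snd p l else fst p l)" if "p \<in> space (?Q \<Otimes>\<^sub>M ?Q)" for p
    using that I(2) by (auto simp: space_pair_measure space_PiM PiE_iff extensional_def fun_eq_iff split_beta)
  ultimately show t: "?t \<in> ?Q \<Otimes>\<^sub>M ?Q \<rightarrow>\<^sub>M ?Q"
    using measurable_cong[of "?Q \<Otimes>\<^sub>M ?Q" ?t "\<lambda>p. \<lambda>l\<in>I. if l = i then snd p l else fst p l" ?Q] by simp
  show "distr (?Q \<Otimes>\<^sub>M ?Q) ?Q ?t = ?Q"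
  proof (rule PiM_eqI[OF I(1)])
    fix A assume A: "\<And>l. l \<in> I \<Longrightarrow> A l \<in> sets (M l)"
    let ?A1 = "\<Pi>\<^sub>E l\<in>I. if l = i then space (M l) else A l"
    let ?A2 = "\<Pi>\<^sub>E l\<in>I. if l = i then A l else space (M l)"
    have 1: "?A1 \<in> sets ?Q" "?A2 \<in> sets ?Q" "Pi\<^sub>E I A \<in> sets ?Q"
      using A I by (auto intro!: sets_PiM_I_finite)
    have "?t -` Pi\<^sub>E I A \<inter> space (?Q \<Otimes>\<^sub>M ?Q) = ?A1 \<times> ?A2"
    proof (intro set_eqI iffI)
      fix p assume "p \<in> ?t -` Pi\<^sub>E I A \<inter> space (?Q \<Otimes>\<^sub>M ?Q)"
      then have p: "(fst p)(i := snd p i) \<in> Pi\<^sub>E I A" "fst p \<in> space ?Q" "snd p \<in> space ?Q"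
        by (auto simp: space_pair_measure)
      have "fst p l \<in> (if l = i then space (M l) else A l)" if "l \<in> I" for l
        using PiE_mem[OF p(1) that] p(2) that by (auto simp: space_PiM split: if_splits)
      moreover have "snd p l \<in> (if l = i then A l else space (M l))" if "l \<in> I" for l
        using PiE_mem[OF p(1) that] p(3) that by (auto simp: space_PiM split: if_splits)
      ultimately show "p \<in> ?A1 \<times> ?A2"
        using p(2,3) by (auto simp: mem_Times_iff PiE_iff space_PiM)
    next
      fix p assume "p \<in> ?A1 \<times> ?A2"
      then have p: "fst p \<in> ?A1" "snd p \<in> ?A2" by (auto simp: mem_Times_iff)
      have s: "fst p \<in> space ?Q" "snd p \<in> space ?Q"
        using p 1 sets.sets_into_space by blast+
      have "((fst p)(i := snd p i)) l \<in> A l" if "l \<in> I" for l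
        using PiE_mem[OF p(1) that] PiE_mem[OF p(2) that] by (auto split: if_splits)
      moreover have "(fst p)(i := snd p i) \<in> extensional I"
        using p(1) I(2) by (auto simp: PiE_iff extensional_def)
      ultimately show "p \<in> ?t -` Pi\<^sub>E I A \<inter> space (?Q \<Otimes>\<^sub>M ?Q)"
        using s by (auto simp: space_pair_measure mem_Times_iff PiE_iff split_beta)
    qed
    then have "emeasure (distr (?Q \<Otimes>\<^sub>M ?Q) ?Q ?t) (Pi\<^sub>E I A) = emeasure ?Q ?A1 * emeasure ?Q ?A2"
      using 1 by (simp add: emeasure_distr[OF t] sigma_finite_measure.emeasure_pair_measure_Times[OF sf])
    also have "emeasure ?Q ?A1 = (\<Prod>l\<in>I. emeasure (M l) (if l = i then space (M l) else A l))"
      by (rule emeasure_PiM) (use I A in auto)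
    also have "emeasure ?Q ?A2 = (\<Prod>l\<in>I. emeasure (M l) (if l = i then A l else space (M l)))"
      by (rule emeasure_PiM) (use I A in auto)
    also have "(\<Prod>l\<in>I. emeasure (M l) (if l = i then space (M l) else A l)) *
        (\<Prod>l\<in>I. emeasure (M l) (if l = i then A l else space (M l))) = (\<Prod>l\<in>I. emeasure (M l) (A l))"
      unfolding prod.distrib[symmetric]
      by (rule prod.cong[OF refl]) (simp add: prob_space.emeasure_space_1[OF M])
    finally show "emeasure (distr (?Q \<Otimes>\<^sub>M ?Q) ?Q ?t) (Pi\<^sub>E I A) = (\<Prod>l\<in>I. emeasure (M l) (A l))" .
  qed simp
qed

section \<open>Moment bounds for i.i.d. observations carrying coins\<close>

locale loo_setting =
  fixes P :: "((real^'d) \<times> real) measure" and k m :: nat and \<gamma> :: real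
  assumes P: "prob_space P" and sets_P: "sets P = sets borel" and lab: "AE z in P. snd z \<in> {0, 1}"
    and stone_AE: "AE x in PiM {1..m} (\<lambda>_. distr P borel fst). stone_bound \<gamma> {1..m} x"
    and k: "k \<ge> 1" "k < m" and \<gamma>: "\<gamma> \<ge> 1"
begin

definition \<mu> :: "(((real^'d) \<times> real) \<times> bool) measure" where
  "\<mu> = P \<Otimes>\<^sub>M measure_pmf (bernoulli_pmf (1/2))"

abbreviation "I \<equiv> {1..m}"
abbreviation "Q \<equiv> PiM I (\<lambda>_. \<mu>)"
abbreviation "f \<equiv> loo_risk_joint k m"
abbreviation "piv u i j \<equiv> (of_bool (pivotal k I (\<lambda>l. fst (u l)) i j) :: real)"

text \<open>The almost sure event on which the deterministic increment bounds apply.\<close>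

definition good :: "(nat \<Rightarrow> ((real^'d) \<times> real) \<times> bool) \<Rightarrow> bool" where
  "good u \<longleftrightarrow> (\<forall>i\<in>I. snd (fst (u i)) \<in> {0, 1}) \<and> stone_bound \<gamma> I (\<lambda>i. fst (fst (u i)))"

lemma prob_\<mu>: "prob_space \<mu>"
  unfolding \<mu>_def by (intro prob_space_pair P prob_space_measure_pmf)

lemma prob_Q: "prob_space Q"
  by (rule prob_space_PiM) (rule prob_\<mu>)

lemma distr_\<mu>_fst: "distr \<mu> P fst = P"
  unfolding \<mu>_def by (rule prob_space.distr_pair_fst[OF prob_space_measure_pmf])

lemma fst_\<mu>: "fst \<in> \<mu> \<rightarrow>\<^sub>M P"
  by (simp add: \<mu>_def)

lemma fst_component: "(\<lambda>u. fst (u i)) \<in> Q \<rightarrow>\<^sub>M borel" if "i \<in> I" for i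
proof -
  have "(\<lambda>u. fst (u i)) \<in> Q \<rightarrow>\<^sub>M P"
    by (rule measurable_compose[OF _ fst_\<mu>]) (use that in simp)
  then show ?thesis unfolding measurable_cong_sets[OF refl sets_P] .
qed

lemma snd_component: "Measurable.pred Q (\<lambda>u. snd (u i))" if "i \<in> I" for i
proof -
  have "snd \<in> \<mu> \<rightarrow>\<^sub>M count_space UNIV"
    unfolding \<mu>_def using measurable_snd[of P "measure_pmf (bernoulli_pmf (1/2))"]
    by (simp add: measurable_cong_sets[OF refl, of "measure_pmf (bernoulli_pmf (1/2))" "count_space UNIV"])
  then show ?thesis by (rule measurable_compose[rotated]) (use that in simp)
qed

lemma f_measurable: "f \<in> borel_measurable Q"
  by (rule borel_measurable_loo_risk_joint) (use fst_component snd_component in auto)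

lemma piv_measurable:
  assumes "i \<in> I - {j}" "j \<in> I"
  shows "(\<lambda>u. piv u i j) \<in> borel_measurable Q"
proof -
  have [measurable]: "Measurable.pred Q (\<lambda>u. pivotal k I (\<lambda>l. fst (u l)) i j)"
    by (rule pred_pivotal[OF _ fst_component assms]) auto
  show ?thesis by measurable
qed

text \<open>Labels and points are images of the observations under coordinatewise projections, so
  both properties are pulled back from the corresponding product laws.\<close>

lemma AE_good: "AE u in Q. good u"
proof -
  let ?X = "distr P borel (fst :: _ \<Rightarrow> real^'d)"
  have fP: "fst \<in> P \<rightarrow>\<^sub>M (borel :: (real^'d) measure)"
    using measurable_fst_borel(1)[OF measurable_ident_sets[OF sets_P]] by (simp add: id_def)
  have X: "prob_space ?X" by (rule prob_space.prob_space_distr[OF P fP])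
  have "AE v in distr \<mu> P fst. snd v \<in> {0, 1}" unfolding distr_\<mu>_fst by (rule lab)
  then have "AE v in \<mu>. snd (fst v) \<in> {0, 1}" by (rule AE_distrD[OF fst_\<mu>])
  then have 1: "AE u in Q. \<forall>i\<in>I. snd (fst (u i)) \<in> {0, 1}"
    by (intro AE_finite_allI AE_PiM_component prob_\<mu>) auto
  have ff: "(\<lambda>v. fst (fst v)) \<in> \<mu> \<rightarrow>\<^sub>M ?X"
    using measurable_compose[OF fst_\<mu> fP] by simp
  have "distr \<mu> ?X (\<lambda>v. fst (fst v)) = distr (distr \<mu> P fst) ?X fst"
    using distr_distr[of fst P ?X fst \<mu>] fst_\<mu> fP by (simp add: comp_def)
  also have "\<dots> = ?X" unfolding distr_\<mu>_fst by (rule distr_cong) auto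
  finally have dd: "distr Q (PiM I (\<lambda>_. ?X)) (compose I (\<lambda>v. fst (fst v))) = PiM I (\<lambda>_. ?X)"
    using distr_PiM_finite_prob_space'[of I "\<lambda>_. \<mu>" "\<lambda>_. ?X" "\<lambda>v. fst (fst v)"] prob_\<mu> X ff by simp
  have "AE x in distr Q (PiM I (\<lambda>_. ?X)) (compose I (\<lambda>v. fst (fst v))). stone_bound \<gamma> I x"
    unfolding dd by (rule stone_AE)
  moreover have "compose I (\<lambda>v. fst (fst v)) \<in> Q \<rightarrow>\<^sub>M PiM I (\<lambda>_. ?X)"
    unfolding compose_def
    by (rule measurable_restrict) (rule measurable_compose[OF _ ff], simp)
  ultimately have "AE u in Q. stone_bound \<gamma> I (compose I (\<lambda>v. fst (fst v)) u)"
    by (rule AE_distrD[rotated])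
  then have 2: "AE u in Q. stone_bound \<gamma> I (\<lambda>i. fst (fst (u i)))"
  proof eventually_elim
    case (elim u)
    then show ?case
      using stone_bound_cong[of I "compose I (\<lambda>v. fst (fst v)) u" "\<lambda>i. fst (fst (u i))" \<gamma>]
      by (simp add: compose_def)
  qed
  show ?thesis using 1 2 by eventually_elim (simp add: good_def)
qed

text \<open>Pivotality does not depend on the coins, which are integrated out.\<close>

lemma sum_piv_expectation: "(\<Sum>i\<in>I. \<Sum>j\<in>I - {i}. \<integral>u. piv u i j \<partial>Q) \<le> 4 * sqrt (real k) * real m"
proof -
  have c: "compose I fst \<in> Q \<rightarrow>\<^sub>M PiM I (\<lambda>_. P)"
    unfolding compose_def by (rule measurable_restrict) (rule measurable_compose[OF _ fst_\<mu>], simp)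
  have d: "distr Q (PiM I (\<lambda>_. P)) (compose I fst) = PiM I (\<lambda>_. P)"
    using distr_PiM_finite_prob_space'[of I "\<lambda>_. \<mu>" "\<lambda>_. P" fst] prob_\<mu> P fst_\<mu> distr_\<mu>_fst by simp
  have e: "(\<integral>u. piv u i j \<partial>Q) = (\<integral>z. of_bool (pivotal k I z i j) \<partial>PiM I (\<lambda>_. P))"
    if ij: "i \<in> I" "j \<in> I - {i}" for i j
  proof -
    have comp: "(\<lambda>z. z l) \<in> PiM I (\<lambda>_. P) \<rightarrow>\<^sub>M borel" if "l \<in> I" for l
      using measurable_component_singleton[OF that, of "\<lambda>_. P"]
      unfolding measurable_cong_sets[OF refl sets_P] .
    have [measurable]: "Measurable.pred (PiM I (\<lambda>_. P)) (\<lambda>z. pivotal k I z i j)"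
      by (rule pred_pivotal[OF _ comp]) (use ij in auto)
    have m: "(\<lambda>z. of_bool (pivotal k I z i j) :: real) \<in> borel_measurable (PiM I (\<lambda>_. P))" by measurable
    have "(\<integral>z. of_bool (pivotal k I z i j) \<partial>PiM I (\<lambda>_. P)) = (\<integral>u. (of_bool (pivotal k I (compose I fst u) i j) :: real) \<partial>Q)"
      using integral_distr[OF c m] unfolding d .
    also have "\<dots> = (\<integral>u. piv u i j \<partial>Q)"
    proof (rule Bochner_Integration.integral_cong[OF refl])
      fix u
      show "of_bool (pivotal k I (compose I fst u) i j) = piv u i j"
        using pivotal_cong[of I "compose I fst u" "\<lambda>l. fst (u l)" j k i] ij by (simp add: compose_def)
    qed
    finally show ?thesis by simp
  qed
  have "(\<Sum>i\<in>I. \<Sum>j\<in>I - {i}. \<integral>u. piv u i j \<partial>Q) =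
      (\<Sum>i\<in>I. \<Sum>j\<in>I - {i}. \<integral>z. of_bool (pivotal k I z i j) \<partial>PiM I (\<lambda>_. P))"
    by (intro sum.cong refl e)
  also have "\<dots> \<le> 4 * sqrt (real k) * real (card I)"
    by (rule sum_pivotal_expectation[OF P sets_P lab]) (use k in auto)
  finally show ?thesis by simp
qed

text \<open>The factor 1 + 2 k \<gamma> is the almost sure bound on the number of changed terms. The
  factor 1 + 8 sqrt k bounds its expectation averaged over the replaced observation: 1 for the own
  term and 4 sqrt k for each of the two samples.\<close>

lemma variance_bound:
  "(\<integral>u. (f u - (\<integral>v. f v \<partial>Q))\<^sup>2 \<partial>Q) \<le> 1/2 * (1 + 2 * real k * \<gamma>) * (1 + 8 * sqrt (real k)) / real m"
proof -
  let ?W = "PiM (I \<times> (UNIV :: bool set)) (\<lambda>(l, _). \<mu>)"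
  have \<nu>: "prob_space ((\<lambda>(l, _). \<mu>) p)" for p :: "nat \<times> bool" by (simp add: split_beta prob_\<mu>)
  interpret W: prob_space ?W by (rule prob_space_PiM) (rule \<nu>)
  define \<pi> where "\<pi> t w = (\<lambda>l\<in>I. w (l, t l))" for t :: "nat \<Rightarrow> bool" and w :: "nat \<times> bool \<Rightarrow> ((real^'d) \<times> real) \<times> bool"
  have \<pi>[measurable]: "\<pi> t \<in> ?W \<rightarrow>\<^sub>M Q" for t
    unfolding \<pi>_def
  proof (rule measurable_restrict)
    fix l assume "l \<in> I"
    then show "(\<lambda>w. w (l, t l)) \<in> ?W \<rightarrow>\<^sub>M \<mu>"
      using measurable_component_singleton[of "(l, t l)" "I \<times> UNIV" "\<lambda>(l, _). \<mu>"] by simp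
  qed
  \<comment> \<open>However the coordinates are chosen from sample and copy, the result has law
    \<open>Q\<close>; this treats the original and the modified sample alike.\<close>
  have d\<pi>: "distr ?W Q (\<pi> t) = Q" for t
  proof -
    have "distr ?W (PiM I (\<lambda>l. (\<lambda>(l, _::bool). \<mu>) (l, t l))) (\<lambda>w. \<lambda>l\<in>I. w (l, t l)) = PiM I (\<lambda>l. (\<lambda>(l, _::bool). \<mu>) (l, t l))"
      by (intro distr_PiM_reindex \<nu>) (auto simp: inj_on_def)
    moreover have "\<pi> t = (\<lambda>w. \<lambda>l\<in>I. w (l, t l))" by (simp add: \<pi>_def fun_eq_iff)
    ultimately show ?thesis by simp
  qed
  have good_AE: "AE w in ?W. good (\<pi> t w)" for t
    by (rule AE_distrD[OF \<pi>], unfold d\<pi>) (rule AE_good)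
  have f_\<pi>[measurable]: "(\<lambda>w. f (\<pi> t w)) \<in> borel_measurable ?W" for t
    by (rule measurable_compose[OF \<pi> f_measurable])
  have piv_\<pi>[measurable]: "(\<lambda>w. piv (\<pi> t w) i j) \<in> borel_measurable ?W" if "i \<in> I" "j \<in> I - {i}" for t i j
    by (rule measurable_compose[OF \<pi> piv_measurable]) (use that in auto)
  have int_piv: "integrable ?W (\<lambda>w. piv (\<pi> t w) i j)" if "i \<in> I" "j \<in> I - {i}" for t i j
    by (rule W.integrable_bounded[where c=1]) (use piv_\<pi>[OF that] in auto)
  have E_piv: "(\<integral>w. piv (\<pi> t w) i j \<partial>?W) = (\<integral>u. piv u i j \<partial>Q)" if "i \<in> I" "j \<in> I - {i}" for t i j
    using integral_distr[OF \<pi>[of t] piv_measurable[of i j]] that unfolding d\<pi> by auto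
  let ?K = "(1 + 2 * real k * \<gamma>) / (real m)\<^sup>2"
  have each: "(\<integral>w. (f (\<lambda>l\<in>I. w (l, False)) - f (\<lambda>l\<in>I. w (l, l = i)))\<^sup>2 \<partial>?W)
      \<le> ?K * (1 + 2 * (\<Sum>j\<in>I - {i}. \<integral>u. piv u i j \<partial>Q))" if i: "i \<in> I" for i
  proof -
    let ?a = "\<pi> (\<lambda>_. False)" and ?b = "\<pi> (\<lambda>l. l = i)"
    let ?s = "\<lambda>w. 1 + (\<Sum>j\<in>I - {i}. piv (?a w) i j + piv (?b w) i j)"
    have ints: "integrable ?W ?s"
      by (intro Bochner_Integration.integrable_add Bochner_Integration.integrable_sum int_piv i W.integrable_const)
    have "(\<integral>w. (f (?a w) - f (?b w))\<^sup>2 \<partial>?W) \<le> (\<integral>w. ?K * ?s w \<partial>?W)"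
    proof (rule integral_mono_AE)
      show "integrable ?W (\<lambda>w. (f (?a w) - f (?b w))\<^sup>2)"
      proof (rule W.integrable_bounded[where c=4])
        fix w
        have "\<bar>f (?a w) - f (?b w)\<bar> \<le> 2"
          using loo_risk_joint_bounds[of k m "?a w"] loo_risk_joint_bounds[of k m "?b w"] by linarith
        then have "\<bar>f (?a w) - f (?b w)\<bar>\<^sup>2 \<le> 2\<^sup>2" by (intro power_mono) auto
        then show "\<bar>(f (?a w) - f (?b w))\<^sup>2\<bar> \<le> 4" by simp
      qed measurable
      show "integrable ?W (\<lambda>w. ?K * ?s w)" by (intro integrable_mult_right ints)
      show "AE w in ?W. (f (?a w) - f (?b w))\<^sup>2 \<le> ?K * ?s w"
        using good_AE[of "\<lambda>_. False"] good_AE[of "\<lambda>l. l = i"]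
      proof eventually_elim
        case (elim w)
        have "(f (?a w) - f (?b w))\<^sup>2 \<le> (1 + 2 * real k * \<gamma>) * ?s w / (real m)\<^sup>2"
          by (rule loo_risk_replace(2)[OF k i]) (use elim in \<open>auto simp: good_def \<pi>_def\<close>)
        then show ?case by simp
      qed
    qed
    also have "\<dots> = ?K * (\<integral>w. ?s w \<partial>?W)" by simp
    also have "(\<integral>w. ?s w \<partial>?W) = 1 + (\<Sum>j\<in>I - {i}. (\<integral>w. piv (?a w) i j \<partial>?W) + (\<integral>w. piv (?b w) i j \<partial>?W))"
    proof -
      have "(\<integral>w. ?s w \<partial>?W) = (\<integral>w. 1 \<partial>?W) + (\<integral>w. (\<Sum>j\<in>I - {i}. piv (?a w) i j + piv (?b w) i j) \<partial>?W)"
        by (intro Bochner_Integration.integral_add Bochner_Integration.integrable_add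
            Bochner_Integration.integrable_sum int_piv i W.integrable_const)
      also have "(\<integral>w. (\<Sum>j\<in>I - {i}. piv (?a w) i j + piv (?b w) i j) \<partial>?W) =
          (\<Sum>j\<in>I - {i}. \<integral>w. piv (?a w) i j + piv (?b w) i j \<partial>?W)"
        by (intro Bochner_Integration.integral_sum Bochner_Integration.integrable_add int_piv i)
      also have "\<dots> = (\<Sum>j\<in>I - {i}. (\<integral>w. piv (?a w) i j \<partial>?W) + (\<integral>w. piv (?b w) i j \<partial>?W))"
        by (intro sum.cong refl Bochner_Integration.integral_add int_piv i)
      also have "(\<integral>w. 1 \<partial>?W) = (1::real)"
        by (simp only: lebesgue_integral_const W.prob_space scaleR_one)
      finally show ?thesis .
    qed
    also have "\<dots> = 1 + 2 * (\<Sum>j\<in>I - {i}. \<integral>u. piv u i j \<partial>Q)"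
      using E_piv[OF i] by (simp add: sum_distrib_left)
    finally show ?thesis unfolding \<pi>_def .
  qed
  have "(\<integral>u. (f u - (\<integral>v. f v \<partial>Q))\<^sup>2 \<partial>Q) \<le>
      1/2 * (\<Sum>i\<in>I. \<integral>w. (f (\<lambda>l\<in>I. w (l, False)) - f (\<lambda>l\<in>I. w (l, l = i)))\<^sup>2 \<partial>?W)"
    by (rule efron_stein[OF _ prob_\<mu> f_measurable loo_risk_joint_bounds]) simp
  also have "\<dots> \<le> 1/2 * (\<Sum>i\<in>I. ?K * (1 + 2 * (\<Sum>j\<in>I - {i}. \<integral>u. piv u i j \<partial>Q)))"
    by (intro mult_left_mono sum_mono each) auto
  also have "\<dots> = 1/2 * ?K * (real m + 2 * (\<Sum>i\<in>I. \<Sum>j\<in>I - {i}. \<integral>u. piv u i j \<partial>Q))"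
  proof -
    have "(\<Sum>i\<in>I. c * (1 + 2 * F i)) = c * (real m + 2 * sum F I)" for c and F :: "nat \<Rightarrow> real"
      unfolding sum_distrib_left[symmetric] sum.distrib by simp
    then show ?thesis by (simp only: mult.assoc)
  qed
  also have "\<dots> \<le> 1/2 * ?K * (real m + 2 * (4 * sqrt (real k) * real m))"
    using \<gamma> by (intro mult_left_mono add_left_mono sum_piv_expectation) auto
  also have "\<dots> = 1/2 * (1 + 2 * real k * \<gamma>) * (1 + 8 * sqrt (real k)) / real m"
    using k by (simp add: field_simps power2_eq_square)
  finally show ?thesis .
qed

end

context loo_setting
begin

text \<open>Each of the \<open>m\<close> squared increments is almost surely at most ((1 + 2 k
  \<gamma>) / m)^2. So their sum \<open>D\<close> is bounded by the constant \<open>c\<close>, and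
  so is every norm of \<open>D\<close>.\<close>

lemma deviation_bound:
  assumes \<kappa>: "efron_stein_constant TYPE(((real^'d) \<times> real) \<times> bool) \<kappa>" and q: "q > 2"
  shows "(\<integral>u. \<bar>f u - (\<integral>v. f v \<partial>Q)\<bar> powr q \<partial>Q)
           \<le> (4 * \<gamma> * sqrt (2 * \<kappa>) * real k) powr q * (q / real m) powr (q / 2)"
proof -
  let ?QQ = "Q \<Otimes>\<^sub>M Q"
  interpret Q: prob_space Q by (rule prob_Q)
  interpret QQ: pair_prob_space Q Q ..
  define D :: "(nat \<Rightarrow> ((real^'d) \<times> real) \<times> bool) \<times> (nat \<Rightarrow> ((real^'d) \<times> real) \<times> bool) \<Rightarrow> real"
    where "D = (\<lambda>(u, u'). \<Sum>i=1..m. (f u - f (u(i := u' i)))\<^sup>2)"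
  define c where "c = (1 + 2 * real k * \<gamma>)\<^sup>2 / real m"
  define L where "L = lnorm Q q (\<lambda>u. f u - (\<integral>v. f v \<partial>Q))"
  define X where "X = (\<integral>u. \<bar>f u - (\<integral>v. f v \<partial>Q)\<bar> powr q \<partial>Q)"
  have m0: "real m > 0" and k0: "real k \<ge> 1" using k by auto
  have c0: "c \<ge> 0" by (simp add: c_def)
  have t: "(\<lambda>(u, u'). u(i := u' i)) \<in> ?QQ \<rightarrow>\<^sub>M Q"
    "distr ?QQ Q (\<lambda>(u, u'). u(i := u' i)) = Q" if "i \<in> I" for i
    using distr_PiM_fun_upd[of "\<lambda>_. \<mu>" I i] prob_\<mu> that by auto
  have D_meas: "D \<in> borel_measurable ?QQ"
    unfolding D_def split_beta
  proof (intro borel_measurable_sum borel_measurable_power borel_measurable_diff)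
    fix i assume i: "i \<in> I"
    show "(\<lambda>p. f (fst p)) \<in> borel_measurable ?QQ"
      by (rule measurable_compose[OF measurable_fst f_measurable])
    show "(\<lambda>p. f ((fst p)(i := snd p i))) \<in> borel_measurable ?QQ"
      using measurable_compose[OF t(1)[OF i] f_measurable] by (simp add: split_beta)
  qed
  have D0: "0 \<le> D p" for p by (simp add: D_def split_beta sum_nonneg)
  have D4: "D p \<le> 4 * real m" for p
  proof -
    have "(f u - f u')\<^sup>2 \<le> 4" for u u' :: "nat \<Rightarrow> ((real^'d) \<times> real) \<times> bool"
    proof -
      have "\<bar>f u - f u'\<bar> \<le> 2"
        using loo_risk_joint_bounds[of k m u] loo_risk_joint_bounds[of k m u'] by linarith
      then have "\<bar>f u - f u'\<bar>\<^sup>2 \<le> 2\<^sup>2" by (intro power_mono) auto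
      then show ?thesis by simp
    qed
    then have "(\<Sum>i\<in>I. (f (fst p) - f ((fst p)(i := snd p i)))\<^sup>2) \<le> real (card I) * 4"
      by (intro sum_bounded_above)
    then show ?thesis by (simp add: D_def split_beta)
  qed
  \<comment> \<open>Integrability uses the crude bound 4 m, which comes from the estimator being
    bounded by 1 and holds everywhere.\<close>
  have D_int: "integrable ?QQ (\<lambda>p. \<bar>D p\<bar> powr (q / 2))"
  proof (rule QQ.P.integrable_bounded[where c="(4 * real m) powr (q / 2)"])
    show "(\<lambda>p. \<bar>D p\<bar> powr (q / 2)) \<in> borel_measurable ?QQ" using D_meas by measurable
    show "\<bar>\<bar>D p\<bar> powr (q / 2)\<bar> \<le> (4 * real m) powr (q / 2)" for p
      using D0[of p] D4[of p] q by (simp add: powr_mono2)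
  qed
  have good1: "AE p in ?QQ. good (fst p)"
  proof (rule AE_distrD[OF measurable_fst])
    have "distr ?QQ Q fst = Q" by (rule Q.distr_pair_fst)
    then show "AE u in distr ?QQ Q fst. good u" using AE_good by metis
  qed
  have good2: "AE p in ?QQ. good ((fst p)(i := snd p i))" if i: "i \<in> I" for i
  proof -
    have "AE u in distr ?QQ Q (\<lambda>(u, u'). u(i := u' i)). good u"
      unfolding t(2)[OF i] by (rule AE_good)
    from AE_distrD[OF t(1)[OF i] this] show ?thesis by (simp add: split_beta)
  qed
  have "AE p in ?QQ. \<forall>i\<in>I. good ((fst p)(i := snd p i))"
    by (intro AE_finite_allI good2) auto
  then have Dc: "AE p in ?QQ. D p \<le> c"
    using good1
  proof eventually_elim
    case (elim p)
    have "(\<Sum>i\<in>I. (f (fst p) - f ((fst p)(i := snd p i)))\<^sup>2) \<le> real (card I) * ((1 + 2 * real k * \<gamma>)\<^sup>2 / (real m)\<^sup>2)"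
    proof (rule sum_bounded_above)
      fix i assume i: "i \<in> I"
      let ?u = "fst p" and ?u' = "(fst p)(i := snd p i)"
      have g: "good ?u" "good ?u'" using elim i by auto
      let ?s = "1 + (\<Sum>j\<in>I - {i}. piv ?u i j + piv ?u' i j)"
      have s: "?s \<le> 1 + 2 * real k * \<gamma>"
        by (rule loo_risk_replace(1)[OF k i]) (use g in \<open>auto simp: good_def\<close>)
      have "(f ?u - f ?u')\<^sup>2 \<le> (1 + 2 * real k * \<gamma>) * ?s / (real m)\<^sup>2"
        by (rule loo_risk_replace(2)[OF k i]) (use g in \<open>auto simp: good_def\<close>)
      also have "\<dots> \<le> (1 + 2 * real k * \<gamma>) * (1 + 2 * real k * \<gamma>) / (real m)\<^sup>2"
        using s \<gamma> by (intro divide_right_mono mult_left_mono) auto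
      finally show "(f ?u - f ?u')\<^sup>2 \<le> (1 + 2 * real k * \<gamma>)\<^sup>2 / (real m)\<^sup>2"
        by (simp add: power2_eq_square)
    qed
    also have "\<dots> = c" using m0 by (simp add: c_def power2_eq_square)
    finally show ?case by (simp add: D_def split_beta)
  qed
  have normD: "lnorm ?QQ (q / 2) D \<le> c"
  proof -
    have "(\<integral>p. \<bar>D p\<bar> powr (q / 2) \<partial>?QQ) \<le> (\<integral>p. c powr (q / 2) \<partial>?QQ)"
    proof (rule integral_mono_AE[OF D_int])
      show "integrable ?QQ (\<lambda>p. c powr (q / 2))" by (rule QQ.P.integrable_const)
      show "AE p in ?QQ. \<bar>D p\<bar> powr (q / 2) \<le> c powr (q / 2)"
        using Dc
      proof eventually_elim
        case (elim p)
        then show ?case using D0[of p] q by (simp add: powr_mono2)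
      qed
    qed
    also have "\<dots> = c powr (q / 2)"
      by (simp only: lebesgue_integral_const QQ.P.prob_space real_scaleR_def mult_1_left)
    finally have "(\<integral>p. \<bar>D p\<bar> powr (q / 2) \<partial>?QQ) powr (1 / (q / 2)) \<le> (c powr (q / 2)) powr (1 / (q / 2))"
      using q by (intro powr_mono2) (auto intro!: Bochner_Integration.integral_nonneg)
    also have "\<dots> = c" using q c0 by (simp add: powr_powr)
    finally show ?thesis by (simp add: lnorm_def)
  qed
  have "integrable Q f"
    by (rule Q.integrable_bounded[OF f_measurable loo_risk_joint_bounds])
  then have ES: "L \<le> sqrt (2 * \<kappa> * q) * sqrt (lnorm ?QQ (q / 2) D)"
    using \<kappa>[unfolded efron_stein_constant_def Let_def, rule_format, of q m "\<lambda>_. \<mu>" f]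
      q prob_\<mu> f_measurable D_int
    unfolding L_def D_def by auto
  have X0: "X \<ge> 0" unfolding X_def by (rule Bochner_Integration.integral_nonneg) simp
  have LX: "L = X powr (1 / q)" by (simp add: L_def X_def lnorm_def)
  have XL: "X = L powr q" using q X0 by (simp add: LX powr_powr)
  have L0: "L \<ge> 0" by (simp add: LX)
  have rhs0: "0 \<le> (4 * \<gamma> * sqrt (2 * \<kappa>) * real k) powr q * (q / real m) powr (q / 2)" by simp
  show ?thesis
  proof (cases "\<kappa> \<le> 0") \<comment> \<open>\<open>sqrt\<close> is odd here, so a nonpositive \<open>\<kappa>\<close> forces the norm to vanish\<close>
    case True
    then have "sqrt (2 * \<kappa> * q) \<le> 0" using q by (simp add: mult_nonpos_nonneg)
    moreover have "sqrt (lnorm ?QQ (q / 2) D) \<ge> 0" by (simp add: lnorm_def)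
    ultimately have "L \<le> 0" using ES mult_nonpos_nonneg order_trans by blast
    then have "L = 0" using L0 by simp
    then have "X = 0" using XL q by simp
    then show ?thesis using rhs0 by (simp add: X_def)
  next
    case False
    then have \<kappa>0: "\<kappa> > 0" by simp
    have "sqrt (lnorm ?QQ (q / 2) D) \<le> sqrt c" using normD by simp
    also have "\<dots> = (1 + 2 * real k * \<gamma>) / sqrt (real m)"
      using \<gamma> by (simp add: c_def real_sqrt_divide)
    also have "\<dots> \<le> 4 * \<gamma> * real k / sqrt (real m)"
    proof (rule divide_right_mono)
      \<comment> \<open>The constant 4 in \<open>C2\<close> arises here: 1 is absorbed because
        \<gamma> k \<ge> 1.\<close>
      have "1 \<le> \<gamma> * real k" using mult_mono[OF \<gamma> k0] \<gamma> by simp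
      then show "1 + 2 * real k * \<gamma> \<le> 4 * \<gamma> * real k" by (simp add: mult_ac)
    qed simp
    finally have S: "sqrt (lnorm ?QQ (q / 2) D) \<le> 4 * \<gamma> * real k / sqrt (real m)" .
    have "L \<le> sqrt (2 * \<kappa> * q) * (4 * \<gamma> * real k / sqrt (real m))"
      using ES S \<kappa>0 q by (meson mult_left_mono order_trans real_sqrt_ge_zero mult_nonneg_nonneg less_imp_le zero_le_numeral order_less_trans zero_less_numeral)
    also have "\<dots> = 4 * \<gamma> * sqrt (2 * \<kappa>) * real k * sqrt (q / real m)"
      by (simp add: real_sqrt_mult real_sqrt_divide)
    finally have "L powr q \<le> (4 * \<gamma> * sqrt (2 * \<kappa>) * real k * sqrt (q / real m)) powr q"
      using L0 q by (intro powr_mono2) auto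
    also have "\<dots> = (4 * \<gamma> * sqrt (2 * \<kappa>) * real k) powr q * (sqrt (q / real m)) powr q"
      by (rule powr_mult)
    also have "(sqrt (q / real m)) powr q = (q / real m) powr (q / 2)"
      using q m0 by (simp add: powr_half_sqrt[symmetric] powr_powr)
    finally show ?thesis using XL by (simp add: X_def)
  qed
qed

end

section \<open>Transfer from the given random variables to the product space\<close>

lemma (in prob_space) distr_pairs_PiM:
  fixes Z :: "nat \<Rightarrow> 'a \<Rightarrow> 'b" and B :: "nat \<Rightarrow> 'a \<Rightarrow> 'c"
  assumes I: "finite I" "I \<noteq> {}" "I \<subseteq> J"
    and Z: "indep_vars (\<lambda>_. S) Z J" and B: "indep_vars (\<lambda>_. T) B I"
    and ZP: "\<And>i. i \<in> I \<Longrightarrow> distr M S (Z i) = P" and BP: "\<And>i. i \<in> I \<Longrightarrow> distr M T (B i) = R"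
    and P: "prob_space P" "sets P = sets S" and R: "prob_space R" "sets R = sets T"
    and ZB: "indep_set
          (sets (vimage_algebra (space M) (\<lambda>\<omega>. \<lambda>i\<in>J. Z i \<omega>) (PiM J (\<lambda>_. S))))
          (sets (vimage_algebra (space M) (\<lambda>\<omega>. \<lambda>i\<in>I. B i \<omega>) (PiM I (\<lambda>_. T))))"
  shows "(\<lambda>\<omega>. \<lambda>i\<in>I. (Z i \<omega>, B i \<omega>)) \<in> M \<rightarrow>\<^sub>M PiM I (\<lambda>_. P \<Otimes>\<^sub>M R)"
    and "distr M (PiM I (\<lambda>_. P \<Otimes>\<^sub>M R)) (\<lambda>\<omega>. \<lambda>i\<in>I. (Z i \<omega>, B i \<omega>)) = PiM I (\<lambda>_. P \<Otimes>\<^sub>M R)"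
proof -
  have Zrv: "Z i \<in> M \<rightarrow>\<^sub>M S" if "i \<in> J" for i using Z that by (auto simp: indep_vars_def)
  have Brv: "B i \<in> M \<rightarrow>\<^sub>M T" if "i \<in> I" for i using B that by (auto simp: indep_vars_def)
  let ?ZJ = "\<lambda>\<omega>. \<lambda>i\<in>J. Z i \<omega>" and ?ZI = "\<lambda>\<omega>. \<lambda>i\<in>I. Z i \<omega>" and ?BI = "\<lambda>\<omega>. \<lambda>i\<in>I. B i \<omega>"
  have ZJm: "?ZJ \<in> M \<rightarrow>\<^sub>M PiM J (\<lambda>_. S)" by (rule measurable_restrict) (rule Zrv)
  have ZIm: "?ZI \<in> M \<rightarrow>\<^sub>M PiM I (\<lambda>_. S)" by (rule measurable_restrict) (use Zrv I in auto)
  have BIm: "?BI \<in> M \<rightarrow>\<^sub>M PiM I (\<lambda>_. T)" by (rule measurable_restrict) (rule Brv)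
  \<comment> \<open>Independence of the two families makes their joint law a product, which is
    checked on rectangles. Independence within each family is used afterwards, to identify the two
    factors.\<close>
  have joint: "distr M (PiM I (\<lambda>_. S)) ?ZI \<Otimes>\<^sub>M distr M (PiM I (\<lambda>_. T)) ?BI =
      distr M (PiM I (\<lambda>_. S) \<Otimes>\<^sub>M PiM I (\<lambda>_. T)) (\<lambda>\<omega>. (?ZI \<omega>, ?BI \<omega>))"
  proof (rule pair_measure_eqI)
    show "sigma_finite_measure (distr M (PiM I (\<lambda>_. S)) ?ZI)"
      by (intro prob_space_imp_sigma_finite prob_space_distr ZIm)
    show "sigma_finite_measure (distr M (PiM I (\<lambda>_. T)) ?BI)"
      by (intro prob_space_imp_sigma_finite prob_space_distr BIm)
    show "sets (distr M (PiM I (\<lambda>_. S)) ?ZI \<Otimes>\<^sub>M distr M (PiM I (\<lambda>_. T)) ?BI) =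
        sets (distr M (PiM I (\<lambda>_. S) \<Otimes>\<^sub>M PiM I (\<lambda>_. T)) (\<lambda>\<omega>. (?ZI \<omega>, ?BI \<omega>)))"
      by (simp add: sets_pair_measure_cong[OF sets_distr sets_distr])
    fix A A' assume "A \<in> sets (distr M (PiM I (\<lambda>_. S)) ?ZI)" "A' \<in> sets (distr M (PiM I (\<lambda>_. T)) ?BI)"
    then have A: "A \<in> sets (PiM I (\<lambda>_. S))" and A': "A' \<in> sets (PiM I (\<lambda>_. T))" by simp_all
    let ?r = "\<lambda>x. restrict x I"
    have r: "?r \<in> PiM J (\<lambda>_. S) \<rightarrow>\<^sub>M PiM I (\<lambda>_. S)" by (rule measurable_restrict_subset[OF I(3)])
    \<comment> \<open>Independence is assumed for the whole family over \<open>J\<close>; an event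
      about the part over \<open>I\<close> is one of its events, by restriction.\<close>
    have "?ZI -` A \<inter> space M = ?ZJ -` (?r -` A \<inter> space (PiM J (\<lambda>_. S))) \<inter> space M"
    proof -
      have "?r (?ZJ \<omega>) = ?ZI \<omega>" for \<omega> using I(3) by (auto simp: fun_eq_iff restrict_def)
      then show ?thesis using measurable_space[OF ZJm] by auto
    qed
    then have 1: "?ZI -` A \<inter> space M \<in> sets (vimage_algebra (space M) ?ZJ (PiM J (\<lambda>_. S)))"
      using in_vimage_algebra[OF measurable_sets[OF r A], of ?ZJ "space M"] by simp
    have 2: "?BI -` A' \<inter> space M \<in> sets (vimage_algebra (space M) ?BI (PiM I (\<lambda>_. T)))"
      by (rule in_vimage_algebra[OF A'])
    have "(\<lambda>\<omega>. (?ZI \<omega>, ?BI \<omega>)) -` (A \<times> A') \<inter> space M = (?ZI -` A \<inter> space M) \<inter> (?BI -` A' \<inter> space M)"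
      by auto
    then have "emeasure (distr M (PiM I (\<lambda>_. S) \<Otimes>\<^sub>M PiM I (\<lambda>_. T)) (\<lambda>\<omega>. (?ZI \<omega>, ?BI \<omega>))) (A \<times> A') =
        emeasure M ((?ZI -` A \<inter> space M) \<inter> (?BI -` A' \<inter> space M))"
      using A A' by (simp add: emeasure_distr[OF measurable_Pair[OF ZIm BIm]])
    also have "\<dots> = emeasure M (?ZI -` A \<inter> space M) * emeasure M (?BI -` A' \<inter> space M)"
      using indep_setD[OF ZB 1 2] by (simp add: emeasure_eq_measure ennreal_mult')
    finally show "emeasure (distr M (PiM I (\<lambda>_. S)) ?ZI) A * emeasure (distr M (PiM I (\<lambda>_. T)) ?BI) A' =
        emeasure (distr M (PiM I (\<lambda>_. S) \<Otimes>\<^sub>M PiM I (\<lambda>_. T)) (\<lambda>\<omega>. (?ZI \<omega>, ?BI \<omega>))) (A \<times> A')"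
      using A A' by (simp add: emeasure_distr[OF ZIm] emeasure_distr[OF BIm])
  qed
  have "indep_vars (\<lambda>_. S) Z I" by (rule indep_vars_subset[OF Z I(3)])
  then have "distr M (PiM I (\<lambda>_. S)) ?ZI = PiM I (\<lambda>i. distr M S (Z i))"
    using indep_vars_iff_distr_eq_PiM'[of I Z "\<lambda>_. S"] I Zrv by blast
  also have "\<dots> = PiM I (\<lambda>_. P)" by (rule PiM_cong) (use ZP in auto)
  finally have dZ: "distr M (PiM I (\<lambda>_. S)) ?ZI = PiM I (\<lambda>_. P)" .
  have "distr M (PiM I (\<lambda>_. T)) ?BI = PiM I (\<lambda>i. distr M T (B i))"
    using indep_vars_iff_distr_eq_PiM'[of I B "\<lambda>_. T"] I Brv B by blast
  also have "\<dots> = PiM I (\<lambda>_. R)" by (rule PiM_cong) (use BP in auto)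
  finally have dB: "distr M (PiM I (\<lambda>_. T)) ?BI = PiM I (\<lambda>_. R)" .
  let ?N = "PiM I (\<lambda>_. P \<Otimes>\<^sub>M R)"
  let ?t = "\<lambda>(x, y). \<lambda>i\<in>I. (x i, y i)"
  have s: "sets (PiM I (\<lambda>_. S) \<Otimes>\<^sub>M PiM I (\<lambda>_. T)) = sets (PiM I (\<lambda>_. P) \<Otimes>\<^sub>M PiM I (\<lambda>_. R))"
    using P R by (intro sets_pair_measure_cong sets_PiM_cong) auto
  have "?t \<in> PiM I (\<lambda>_. P) \<Otimes>\<^sub>M PiM I (\<lambda>_. R) \<rightarrow>\<^sub>M ?N"
    unfolding split_beta by (rule measurable_restrict) measurable
  then have t: "?t \<in> PiM I (\<lambda>_. S) \<Otimes>\<^sub>M PiM I (\<lambda>_. T) \<rightarrow>\<^sub>M ?N"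
    unfolding measurable_cong_sets[OF s refl] .
  have pair: "(\<lambda>\<omega>. (?ZI \<omega>, ?BI \<omega>)) \<in> M \<rightarrow>\<^sub>M PiM I (\<lambda>_. S) \<Otimes>\<^sub>M PiM I (\<lambda>_. T)"
    by (rule measurable_Pair[OF ZIm BIm])
  have comp: "?t \<circ> (\<lambda>\<omega>. (?ZI \<omega>, ?BI \<omega>)) = (\<lambda>\<omega>. \<lambda>i\<in>I. (Z i \<omega>, B i \<omega>))"
    by (auto simp: fun_eq_iff)
  show "(\<lambda>\<omega>. \<lambda>i\<in>I. (Z i \<omega>, B i \<omega>)) \<in> M \<rightarrow>\<^sub>M ?N"
    using measurable_comp[OF pair t] unfolding comp .
  have "distr M ?N (\<lambda>\<omega>. \<lambda>i\<in>I. (Z i \<omega>, B i \<omega>)) =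
      distr (distr M (PiM I (\<lambda>_. S) \<Otimes>\<^sub>M PiM I (\<lambda>_. T)) (\<lambda>\<omega>. (?ZI \<omega>, ?BI \<omega>))) ?N ?t"
    using distr_distr[OF t pair] unfolding comp by simp
  also have "\<dots> = distr (PiM I (\<lambda>_. P) \<Otimes>\<^sub>M PiM I (\<lambda>_. R)) ?N ?t"
    unfolding joint[symmetric] dZ dB ..
  also have "\<dots> = ?N" by (rule distr_pair_PiM[OF I(1)]) (rule P R)+
  finally show "distr M ?N (\<lambda>\<omega>. \<lambda>i\<in>I. (Z i \<omega>, B i \<omega>)) = ?N" .
qed

theorem theorem3p1:
  fixes M :: "'w measure"
    and S :: "(real^'d) set"
    and P :: "((real^'d) \<times> real) measure"
    and Z :: "nat \<Rightarrow> 'w \<Rightarrow> (real^'d) \<times> real"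
    and B :: "nat \<Rightarrow> 'w \<Rightarrow> bool"
    and k p n m :: nat
    and \<gamma> \<kappa> C1 C2 :: real
    and R :: "'w \<Rightarrow> real"
  assumes kp: "k \<ge> 1" "p \<ge> 1" "p + k \<le> n"
    and m: "m = n - p + 1"
    and M: "prob_space M"
    and Z_range: "\<And>i \<omega>. i \<in> {1..n} \<Longrightarrow> \<omega> \<in> space M \<Longrightarrow> Z i \<omega> \<in> S \<times> {0, 1}"
    and Z_indep: "prob_space.indep_vars M (\<lambda>_. borel) Z {1..n}"
    and Z_distr: "\<And>i. i \<in> {1..n} \<Longrightarrow> distr M borel (Z i) = P"
    and B_indep: "prob_space.indep_vars M (\<lambda>_. count_space UNIV) B {1..m}"
    and B_distr: "\<And>i. i \<in> {1..m} \<Longrightarrow>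
          distr M (count_space UNIV) (B i) = measure_pmf (bernoulli_pmf (1/2))"
    and B_indep_Z: "prob_space.indep_set M
          (sets (vimage_algebra (space M)
             (\<lambda>\<omega>. \<lambda>i\<in>{1..n}. Z i \<omega>) (PiM {1..n} (\<lambda>_. borel))))
          (sets (vimage_algebra (space M)
             (\<lambda>\<omega>. \<lambda>i\<in>{1..m}. B i \<omega>) (PiM {1..m} (\<lambda>_. count_space UNIV))))"
    and stone: "stone_constant TYPE('d) \<gamma>"
    and stone_AE: "\<And>N. AE x in PiM {1..N} (\<lambda>_. distr P borel fst). stone_bound \<gamma> {1..N} x"
    and \<kappa>: "\<kappa> \<le> 1.271" "efron_stein_constant TYPE(((real^'d) \<times> real) \<times> bool) \<kappa>"
    and C1: "C1 = 2 + 16 * \<gamma>"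
    and C2: "C2 = 4 * \<gamma> * sqrt (2 * \<kappa>)"
    and R: "R = (\<lambda>\<omega>. loo_risk k m (\<lambda>i. Z i \<omega>) (\<lambda>i. B i \<omega>))"
  shows "(\<integral>\<omega>. (R \<omega> - (\<integral>\<omega>'. R \<omega>' \<partial>M))\<^sup>2 \<partial>M) \<le> C1 * (real k powr (3/2) / real m) \<and>
         (\<forall>q>2. (\<integral>\<omega>. \<bar>R \<omega> - (\<integral>\<omega>'. R \<omega>' \<partial>M)\<bar> powr q \<partial>M)
                  \<le> (C2 * real k) powr q * (q / real m) powr (q / 2))"
proof -
  interpret prob_space M by (rule M)
  \<comment> \<open>From p + k \<le> n one gets m \<ge> k + 1, so \<open>k\<close> neighbours remain
    after leaving one out, and p \<ge> 1 gives m \<le> n.\<close>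
  have m1: "m \<ge> 1" "k < m" "{1..m} \<subseteq> {1..n}" using kp m by auto
  then have I: "finite {1..m}" "{1..m} \<noteq> {}" and one: "1 \<in> {1..n}" by auto
  have Z_rv: "Z i \<in> borel_measurable M" if "i \<in> {1..n}" for i
    using Z_indep that by (auto simp: indep_vars_def)
  have P1: "P = distr M borel (Z 1)" using Z_distr[OF one] by simp
  have P: "prob_space P" unfolding P1 by (rule prob_space_distr) (rule Z_rv[OF one])
  have sets_P: "sets P = sets borel" by (simp add: P1)
  have lab: "AE z in P. snd z \<in> {0, 1}"
  proof -
    have "(\<lambda>z. z) \<in> (borel :: ((real^'d) \<times> real) measure) \<rightarrow>\<^sub>M borel" by simp
    then have "(snd :: (real^'d) \<times> real \<Rightarrow> real) \<in> borel_measurable borel"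
      using measurable_fst_borel(2) by blast
    then have "{z \<in> space (borel :: ((real^'d) \<times> real) measure). snd z \<in> {0, 1}} \<in> sets borel"
      using measurable_sets[of snd borel borel "{0, 1}"] by (simp add: vimage_def)
    then show ?thesis
      unfolding P1 by (subst AE_distr_iff[OF Z_rv[OF one]]) (use Z_range[OF one] in \<open>auto simp: mem_Times_iff\<close>)
  qed
  have \<gamma>: "\<gamma> \<ge> 1" using stone by (rule stone_constant_ge_1)
  interpret loo_setting P k m \<gamma>
    by (rule loo_setting.intro) (rule P sets_P lab stone_AE kp(1) m1(2) \<gamma>)+
  let ?N = "PiM {1..m} (\<lambda>_. P \<Otimes>\<^sub>M measure_pmf (bernoulli_pmf (1/2)))"
  let ?U = "\<lambda>\<omega>. \<lambda>i\<in>{1..m}. (Z i \<omega>, B i \<omega>)"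
  have U: "?U \<in> M \<rightarrow>\<^sub>M ?N" "distr M ?N ?U = ?N"
  proof -
    have "distr M borel (Z i) = P" if "i \<in> {1..m}" for i using Z_distr m1(3) that by blast
    moreover have "sets (measure_pmf (bernoulli_pmf (1/2))) = sets (count_space UNIV)" by simp
    ultimately show "?U \<in> M \<rightarrow>\<^sub>M ?N" "distr M ?N ?U = ?N"
      using distr_pairs_PiM[OF I m1(3) Z_indep B_indep _ B_distr P sets_P prob_space_measure_pmf _ B_indep_Z]
      by blast+
  qed
  have QN: "?N = PiM {1..m} (\<lambda>_. \<mu>)" by (simp add: \<mu>_def)
  note U = U[unfolded QN]
  have RU: "R \<omega> = loo_risk_joint k m (?U \<omega>)" for \<omega>
    unfolding R loo_risk_joint_def by (rule loo_risk_cong) auto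
  \<comment> \<open>Both claims concern expectations of functions of \<open>R\<close> alone, so the
    law of the pairs of observation and coin is all that matters.\<close>
  have transfer: "(\<integral>\<omega>. h (R \<omega>) \<partial>M) = (\<integral>u. h (loo_risk_joint k m u) \<partial>PiM {1..m} (\<lambda>_. \<mu>))"
    if [measurable]: "h \<in> borel_measurable borel" for h :: "real \<Rightarrow> real"
  proof -
    have "(\<lambda>u. h (loo_risk_joint k m u)) \<in> borel_measurable (PiM {1..m} (\<lambda>_. \<mu>))"
      using f_measurable by measurable
    from integral_distr[OF U(1) this] show ?thesis unfolding U(2) RU by simp
  qed
  have mean: "(\<integral>\<omega>. R \<omega> \<partial>M) = (\<integral>u. loo_risk_joint k m u \<partial>PiM {1..m} (\<lambda>_. \<mu>))"
    using transfer[of "\<lambda>x. x"] by simp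
  let ?c = "\<integral>u. loo_risk_joint k m u \<partial>PiM {1..m} (\<lambda>_. \<mu>)"
  show ?thesis
  proof (intro conjI allI impI)
    let ?s = "sqrt (real k)"
    have s: "?s \<ge> 1" using kp(1) by simp
    have k32: "real k powr (3/2) = ?s ^ 3"
    proof -
      have "?s ^ 3 = ?s powr 3" using s by (simp add: powr_numeral)
      also have "\<dots> = (real k powr (1/2)) powr 3" by (simp add: powr_half_sqrt)
      also have "\<dots> = real k powr (3/2)" by (simp only: powr_powr) simp
      finally show ?thesis by simp
    qed
    have "(\<integral>\<omega>. (R \<omega> - (\<integral>\<omega>'. R \<omega>' \<partial>M))\<^sup>2 \<partial>M) =
        (\<integral>u. (loo_risk_joint k m u - ?c)\<^sup>2 \<partial>PiM {1..m} (\<lambda>_. \<mu>))"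
      unfolding mean by (rule transfer[of "\<lambda>x. (x - ?c)\<^sup>2"]) measurable
    also have "\<dots> \<le> 1/2 * (1 + 2 * real k * \<gamma>) * (1 + 8 * ?s) / real m"
      by (rule variance_bound)
    also have "\<dots> \<le> C1 * ?s ^ 3 / real m"
    proof (rule divide_right_mono)
      \<comment> \<open>As k \<ge> 1, the summands 1 are absorbed into k and sqrt k; the product
        then has the order k^(3/2), written as a cube of the square root.\<close>
      have "1 + 2 * real k * \<gamma> \<le> ?s\<^sup>2 * (1 + 2 * \<gamma>)"
        using kp(1) by (simp add: algebra_simps)
      moreover have "1 + 8 * ?s \<le> 9 * ?s" using s by simp
      ultimately have "(1 + 2 * real k * \<gamma>) * (1 + 8 * ?s) \<le> (?s\<^sup>2 * (1 + 2 * \<gamma>)) * (9 * ?s)"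
        using \<gamma> s by (intro mult_mono) auto
      also have "\<dots> = (9 + 18 * \<gamma>) * ?s ^ 3"
        by (simp add: power2_eq_square power3_eq_cube algebra_simps)
      \<comment> \<open>The inequality 9 + 18 \<gamma> \<le> 4 + 32 \<gamma> amounts to 5 \<le> 14
        \<gamma>, which follows from \<gamma> \<ge> 1.\<close>
      also have "\<dots> \<le> (2 * C1) * ?s ^ 3"
        using \<gamma> s by (intro mult_right_mono) (auto simp: C1)
      finally show "1/2 * (1 + 2 * real k * \<gamma>) * (1 + 8 * ?s) \<le> C1 * ?s ^ 3" by simp
    qed simp
    finally show "(\<integral>\<omega>. (R \<omega> - (\<integral>\<omega>'. R \<omega>' \<partial>M))\<^sup>2 \<partial>M) \<le> C1 * (real k powr (3/2) / real m)"
      by (simp add: k32)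
  next
    fix q :: real assume q: "2 < q"
    have "(\<integral>\<omega>. \<bar>R \<omega> - (\<integral>\<omega>'. R \<omega>' \<partial>M)\<bar> powr q \<partial>M) =
        (\<integral>u. \<bar>loo_risk_joint k m u - ?c\<bar> powr q \<partial>PiM {1..m} (\<lambda>_. \<mu>))"
      unfolding mean by (rule transfer[of "\<lambda>x. \<bar>x - ?c\<bar> powr q"]) measurable
    also have "\<dots> \<le> (C2 * real k) powr q * (q / real m) powr (q / 2)"
      unfolding C2 by (rule deviation_bound[OF \<kappa>(2) q])
    finally show "(\<integral>\<omega>. \<bar>R \<omega> - (\<integral>\<omega>'. R \<omega>' \<partial>M)\<bar> powr q \<partial>M)
        \<le> (C2 * real k) powr q * (q / real m) powr (q / 2)" .
  qed
qed

end
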